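(* Let $n\in\mathbb{N}$, let $V=\mathbb{R}^n$ and let $h:\mathbb{N}^n\to\mathbb{R}$. Then $$p_h(\mathbb{R}\mathcal{F})=T(V)^{\mathrm{Stab}(h)},$$ where $p_h:\mathbb{R}\mathcal{F}\to T(V)$ is the linear map from quantum fragments to the tensor algebra of $V$ associated with $h$, and $\mathrm{Stab}(h)\subseteq O(n)$ is the stabilizer of $h$ in the real orthogonal group.
   Context: Conventions: $\mathbb{N}=\{0,1,2,\ldots\}$ and $[n]=\{1,\ldots,n\}$. Fragments: graphs are finite and may have multiple edges, loops and circles; a circle is a loop which does not contain any vertex (it is an element of the edge set, incident with no vertex). A $k$-fragment is a graph in which $k$ of its vertices are labeled $1,\ldots,k$, each of these having degree one. The labeled vertices are called open ends, and the edge connected to an open end is called a half edge. (An edge may have both its endpoints open ends.) $\mathcal{F}_k$ is the collection of all $k$-fragments (up to label-preserving isomorphism), $\mathcal{F}=\bigcup_{k\ge 0}\mathcal{F}_k$, and $\mathbb{R}\mathcal{F}$ is the real vector space of finite formal $\mathbb{R}$-linear combinations of fragments (quantum fragments). For a fragment $F$, $VF$ denotes the set of its vertices that are not open ends, and $EF$ the set of its edges, including half edges and circles. The map $p_h$: for $F\in\mathcal{F}_k$, $\psi:EF\to[n]$ and $v\in VF$, let $\delta(v)$ be the multiset of edges incident with $v$ (a loop counts twice), and view the multiset $\psi(\delta(v))$ as the element $\alpha\in\mathbb{N}^n$ whose $i$-th coordinate is the number of elements of $\delta(v)$, counted with multiplicity, that $\psi$ maps to $i$. For $\phi:[k]\to[n]$,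 say $\psi$ extends $\phi$, written $\psi\unrhd\phi$, if for every $i\in[k]$ the half edge incident with the open end labeled $i$ is mapped by $\psi$ to $\phi(i)$ (so if an edge joins the open ends $i$ and $j$ and $\phi(i)\neq\phi(j)$, no $\psi$ extends $\phi$). Define $$h_\phi(F)=\sum_{\substack{\psi:EF\to[n]\\ \psi\unrhd\phi}}\ \prod_{v\in VF}h(\psi(\delta(v))).$$ Let $T(V)=\bigoplus_{k=0}^\infty V^{\otimes k}$ be the tensor algebra of $V=\mathbb{R}^n$, let $e_1,\ldots,e_n$ be the standard basis of $V$, and for $\phi:[k]\to[n]$ let $e_\phi=e_{\phi(1)}\otimes e_{\phi(2)}\otimes\cdots\otimes e_{\phi(k)}$. Define $p_h:\mathbb{R}\mathcal{F}\to T(V)$ by $$p_h(F)=\sum_{\phi:[k]\to[n]}h_\phi(F)\,e_\phi\qquad\text{for }F\in\mathcal{F}_k,\ k\ge 0,$$ extended linearly to $\mathbb{R}\mathcal{F}$. Group actions: $O(n)=\{U\in\mathbb{R}^{n\times n}\mid U^TU=I\}$. Let $R=\mathbb{R}[x_1,\ldots,x_n]$. $O(n)$ acts on $R$ by $(Uq)(v)=q(U^{-1}v)$ for $q\in R$, $v\in\mathbb{R}^n$, and on the space $R^*$ of linear functions $R\to\mathbb{R}$ by $(Uh)(q)=h(U^{-1}q)$. A map $h:\mathbb{N}^n\to\mathbb{R}$ is identified with the linear function $h:R\to\mathbb{R}$ determined by $h(x_1^{\alpha_1}\cdots x_n^{\alpha_n})=h(\alpha)$ for $\alpha\in\mathbb{N}^n$.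 Then $\mathrm{Stab}(h)=\{U\in O(n)\mid Uh=h\}$. $O(n)$ acts on each $V^{\otimes k}$ diagonally, $U(v_1\otimes\cdots\otimes v_k)=Uv_1\otimes\cdots\otimes Uv_k$ (trivially on $V^{\otimes 0}=\mathbb{R}$), hence linearly on $T(V)$, and for a subgroup $H\subseteq O(n)$, $T(V)^H=\{v\in T(V)\mid Uv=v\text{ for all }U\in H\}$. *)

theory Defs
  imports
    "HOL-Library.Multiset"
    "HOL-Library.FuncSet"
    "HOL-Library.Poly_Mapping"
    "Jordan_Normal_Form.Matrix"
    "Jordan_Normal_Form.Determinant"
begin

text \<open>
  Index sets are zero-based: \<open>{1,\<dots>,n}\<close> is rendered as \<open>{..<n}\<close>, and the open ends of a
  \<open>k\<close>-fragment are labeled by \<open>{..<k}\<close>.  A map from \<open>{..<k}\<close> to \<open>{..<n}\<close> is a word of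
  length \<open>k\<close> over \<open>{..<n}\<close>.
\<close>

definition words :: "nat \<Rightarrow> nat \<Rightarrow> nat list set" where
  "words n k = {w. length w = k \<and> set w \<subseteq> {..<n}}"

text \<open>
  The vector space with basis \<^typ>\<open>'a\<close> is \<^typ>\<open>'a \<Rightarrow>\<^sub>0 real\<close>; \<open>lin_ext f\<close> is the linear map
  which sends the basis element \<open>a\<close> to \<open>f a\<close>.
\<close>

definition scale_pm :: "real \<Rightarrow> ('a \<Rightarrow>\<^sub>0 real) \<Rightarrow> ('a \<Rightarrow>\<^sub>0 real)" where
  "scale_pm c p = Poly_Mapping.map ((*) c) p"

definition lin_ext :: "('a \<Rightarrow> ('b \<Rightarrow>\<^sub>0 real)) \<Rightarrow> ('a \<Rightarrow>\<^sub>0 real) \<Rightarrow> ('b \<Rightarrow>\<^sub>0 real)" where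
  "lin_ext f q = (\<Sum>a\<in>Poly_Mapping.keys q. scale_pm (Poly_Mapping.lookup q a) (f a))"

lemma lookup_scale_pm [simp]:
  "Poly_Mapping.lookup (scale_pm c p) a = c * Poly_Mapping.lookup p a"
  by (simp add: scale_pm_def Poly_Mapping.map.rep_eq when_def)

lemma lookup_lin_ext:
  assumes "finite A" "Poly_Mapping.keys q \<subseteq> A"
  shows "Poly_Mapping.lookup (lin_ext f q) b
    = (\<Sum>a\<in>A. Poly_Mapping.lookup q a * Poly_Mapping.lookup (f a) b)"
  unfolding lin_ext_def lookup_sum lookup_scale_pm
  using assms by (intro sum.mono_neutral_left) (auto simp: in_keys_iff)

lemma lin_ext_single [simp]: "lin_ext f (Poly_Mapping.single a 1) = f a"
  by (rule poly_mapping_eqI) (simp add: lookup_lin_ext[of "{a}"])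

lemma lin_ext_add: "lin_ext f (p + q) = lin_ext f p + lin_ext f q"
proof (rule poly_mapping_eqI)
  fix b
  let ?A = "Poly_Mapping.keys p \<union> Poly_Mapping.keys q"
  have "Poly_Mapping.keys (p + q) \<subseteq> ?A" by (rule Poly_Mapping.keys_add)
  then show "Poly_Mapping.lookup (lin_ext f (p + q)) b
      = Poly_Mapping.lookup (lin_ext f p + lin_ext f q) b"
    by (simp add: lookup_add lookup_lin_ext[of ?A] sum.distrib distrib_right)
qed

lemma lin_ext_scale: "lin_ext f (scale_pm c q) = scale_pm c (lin_ext f q)"
proof (rule poly_mapping_eqI)
  fix b
  have "Poly_Mapping.keys (scale_pm c q) \<subseteq> Poly_Mapping.keys q"
    by (auto simp: in_keys_iff)
  then show "Poly_Mapping.lookup (lin_ext f (scale_pm c q)) b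
      = Poly_Mapping.lookup (scale_pm c (lin_ext f q)) b"
    by (simp add: lookup_lin_ext[of "Poly_Mapping.keys q"] sum_distrib_left mult.assoc)
qed


section \<open>Fragments\<close>

text \<open>
  An edge has the multiset \<open>{#u, v#}\<close> of its endpoints as \<open>ends\<close> (\<open>{#v, v#}\<close> for a loop), and
  a circle is an edge with \<open>{#}\<close> as \<open>ends\<close>.  The list \<open>opens\<close> has as its \<open>i\<close>-th entry the open
  end labeled \<open>i\<close>.  Since fragments are finite and only considered up to isomorphism, vertices
  and edges can be taken to be natural numbers.
\<close>

datatype pre_fragment = Pre_Fragment
  (verts: "nat set") (edges: "nat set") (ends: "nat \<Rightarrow> nat multiset") (opens: "nat list")

definition inc_edges :: "pre_fragment \<Rightarrow> nat \<Rightarrow> nat multiset" where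
  "inc_edges F v = (\<Sum>e\<in>edges F. replicate_mset (count (ends F e) v) e)"

definition wf_fragment :: "pre_fragment \<Rightarrow> bool" where
  "wf_fragment F \<longleftrightarrow> finite (verts F) \<and> finite (edges F)
     \<and> (\<forall>e\<in>edges F. set_mset (ends F e) \<subseteq> verts F \<and> size (ends F e) \<in> {0, 2})
     \<and> distinct (opens F) \<and> set (opens F) \<subseteq> verts F
     \<and> (\<forall>v\<in>set (opens F). size (inc_edges F v) = 1)"

definition fragment_iso :: "pre_fragment \<Rightarrow> pre_fragment \<Rightarrow> bool" where
  "fragment_iso F G \<longleftrightarrow> (\<exists>f g. bij_betw f (verts F) (verts G) \<and> bij_betw g (edges F) (edges G)
     \<and> (\<forall>e\<in>edges F. ends G (g e) = image_mset f (ends F e))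
     \<and> opens G = map f (opens F))"

definition fragment_rel :: "pre_fragment \<Rightarrow> pre_fragment \<Rightarrow> bool" where
  "fragment_rel F G \<longleftrightarrow> wf_fragment F \<and> wf_fragment G \<and> fragment_iso F G"

definition inner_verts :: "pre_fragment \<Rightarrow> nat set" where
  "inner_verts F = verts F - set (opens F)"

lemma fragment_iso_refl: "fragment_iso F F"
  unfolding fragment_iso_def by (intro exI[of _ id]) auto

lemma fragment_iso_sym:
  assumes wf: "wf_fragment F" and iso: "fragment_iso F G"
  shows "fragment_iso G F"
proof -
  obtain f g where f: "bij_betw f (verts F) (verts G)" and g: "bij_betw g (edges F) (edges G)"
    and e: "\<forall>e\<in>edges F. ends G (g e) = image_mset f (ends F e)" and o: "opens G = map f (opens F)"
    using iso unfolding fragment_iso_def by blast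
  let ?f = "inv_into (verts F) f" and ?g = "inv_into (edges F) g"
  have inv: "?f (f v) = v" if "v \<in> verts F" for v
    using f that by (simp add: bij_betw_def)
  have "ends F (?g d) = image_mset ?f (ends G d)" if d: "d \<in> edges G" for d
  proof -
    have d': "?g d \<in> edges F" "g (?g d) = d"
      using g d by (auto simp: bij_betw_def inv_into_into f_inv_into_f)
    then have "ends G d = image_mset f (ends F (?g d))" using e by metis
    moreover have "set_mset (ends F (?g d)) \<subseteq> verts F"
      using wf d' by (auto simp: wf_fragment_def)
    then have "image_mset (?f \<circ> f) (ends F (?g d)) = image_mset id (ends F (?g d))"
      by (intro image_mset_cong) (auto simp: inv subset_iff)
    ultimately show ?thesis by (simp add: multiset.map_comp)
  qed
  moreover have "opens F = map ?f (opens G)"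
    using wf by (auto simp: o o_def wf_fragment_def inv subset_iff intro!: map_idI[symmetric])
  ultimately show ?thesis
    unfolding fragment_iso_def using f g by (intro exI[of _ ?f] exI[of _ ?g]) (auto simp: bij_betw_inv_into)
qed

lemma fragment_iso_trans:
  assumes "fragment_iso F G" "fragment_iso G H"
  shows "fragment_iso F H"
proof -
  obtain f g where f: "bij_betw f (verts F) (verts G)" "bij_betw g (edges F) (edges G)"
    "\<forall>e\<in>edges F. ends G (g e) = image_mset f (ends F e)" "opens G = map f (opens F)"
    using assms(1) unfolding fragment_iso_def by blast
  obtain f' g' where f': "bij_betw f' (verts G) (verts H)" "bij_betw g' (edges G) (edges H)"
    "\<forall>e\<in>edges G. ends H (g' e) = image_mset f' (ends G e)" "opens H = map f' (opens G)"
    using assms(2) unfolding fragment_iso_def by blast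
  have "ends H (g' (g e)) = image_mset (f' \<circ> f) (ends F e)" if "e \<in> edges F" for e
  proof -
    have "g e \<in> edges G" using f(2) that by (auto simp: bij_betw_def)
    then show ?thesis using f(3) f'(3) that by (simp add: multiset.map_comp)
  qed
  then show ?thesis
    unfolding fragment_iso_def using f f'
    by (intro exI[of _ "f' \<circ> f"] exI[of _ "g' \<circ> g"]) (auto intro: bij_betw_trans)
qed

quotient_type fragment = pre_fragment / partial: fragment_rel
proof (rule part_equivpI)
  show "\<exists>F. fragment_rel F F"
    by (rule exI[of _ "Pre_Fragment {} {} (\<lambda>_. {#}) []"])
      (simp add: fragment_rel_def wf_fragment_def fragment_iso_refl)
  show "symp fragment_rel"
    by (auto simp: symp_def fragment_rel_def fragment_iso_sym)
  show "transp fragment_rel"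
    by (auto simp: transp_def fragment_rel_def intro: fragment_iso_trans)
qed

type_synonym quantum_fragment = "fragment \<Rightarrow>\<^sub>0 real"

lift_definition num_opens :: "fragment \<Rightarrow> nat" is "\<lambda>F. length (opens F)"
  by (auto simp: fragment_rel_def fragment_iso_def)


section \<open>The map \<open>p_h\<close>\<close>

text \<open>
  The set of maps from \<open>{..<n}\<close> to the natural numbers is rendered as the set of those
  \<open>\<alpha> :: nat \<Rightarrow>\<^sub>0 nat\<close> with \<open>keys \<alpha> \<subseteq> {..<n}\<close>; the values of \<open>h\<close> at all other arguments are
  never used.
\<close>

definition exponent_of :: "nat multiset \<Rightarrow> (nat \<Rightarrow>\<^sub>0 nat)" where
  "exponent_of M = Abs_poly_mapping (count M)"

lemma lookup_exponent_of [simp]: "Poly_Mapping.lookup (exponent_of M) i = count M i"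
  unfolding exponent_of_def by (subst lookup_Abs_poly_mapping) simp_all

definition edge_colorings :: "nat \<Rightarrow> pre_fragment \<Rightarrow> nat list \<Rightarrow> (nat \<Rightarrow> nat) set" where
  "edge_colorings n F \<phi> = {\<psi> \<in> edges F \<rightarrow>\<^sub>E {..<n}.
     \<forall>i<length (opens F). \<forall>e\<in>edges F. opens F ! i \<in># ends F e \<longrightarrow> \<psi> e = \<phi> ! i}"

definition pre_h_coeff :: "nat \<Rightarrow> ((nat \<Rightarrow>\<^sub>0 nat) \<Rightarrow> real) \<Rightarrow> nat list \<Rightarrow> pre_fragment \<Rightarrow> real" where
  "pre_h_coeff n h \<phi> F = (\<Sum>\<psi>\<in>edge_colorings n F \<phi>.
     \<Prod>v\<in>inner_verts F. h (exponent_of (image_mset \<psi> (inc_edges F v))))"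

lemma pre_h_coeff_iso:
  assumes rel: "fragment_rel F G"
  shows "pre_h_coeff n h \<phi> F = pre_h_coeff n h \<phi> G"
proof -
  have wf: "wf_fragment F" using rel by (simp add: fragment_rel_def)
  obtain f g where f: "bij_betw f (verts F) (verts G)" and g: "bij_betw g (edges F) (edges G)"
    and e: "\<And>e. e \<in> edges F \<Longrightarrow> ends G (g e) = image_mset f (ends F e)"
    and o: "opens G = map f (opens F)"
    using rel unfolding fragment_rel_def fragment_iso_def by blast
  have opens: "set (opens F) \<subseteq> verts F" using wf by (simp add: wf_fragment_def)
  have ends: "set_mset (ends F d) \<subseteq> verts F" if "d \<in> edges F" for d
    using wf that by (simp add: wf_fragment_def)
  have injf: "inj_on f (verts F)" and injg: "inj_on g (edges F)"
    and imf: "f ` verts F = verts G" and img: "g ` edges F = edges G"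
    using f g by (auto simp: bij_betw_def)
  have fmem: "f v \<in># ends G (g d) \<longleftrightarrow> v \<in># ends F d" if "d \<in> edges F" "v \<in> verts F" for d v
    using e[OF that(1)] ends[OF that(1)] that(2) injf by (auto simp: inj_on_def subset_iff)
  have cnt: "count (ends G (g d)) (f v) = count (ends F d) v" if "d \<in> edges F" "v \<in> verts F" for d v
  proof -
    have "f -` {f v} \<inter> set_mset (ends F d) = {v} \<inter> set_mset (ends F d)"
      using ends[OF that(1)] that(2) injf by (auto simp: inj_on_def subset_iff)
    then show ?thesis
      by (cases "v \<in># ends F d") (simp_all add: e[OF that(1)] count_image_mset not_in_iff)
  qed
  have inc: "inc_edges G (f v) = image_mset g (inc_edges F v)" if v: "v \<in> verts F" for v
  proof -
    have fin: "finite (edges F)" using wf by (simp add: wf_fragment_def)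
    have im: "image_mset g (\<Sum>e\<in>A. replicate_mset (count (ends F e) v) e)
        = (\<Sum>e\<in>A. replicate_mset (count (ends F e) v) (g e))" if "finite A" for A
      using that by (induction A) auto
    have "inc_edges G (f v) = (\<Sum>d\<in>edges F. replicate_mset (count (ends G (g d)) (f v)) (g d))"
      unfolding inc_edges_def img[symmetric] by (subst sum.reindex[OF injg]) simp
    also have "\<dots> = (\<Sum>d\<in>edges F. replicate_mset (count (ends F d) v) (g d))"
      by (intro sum.cong) (simp_all add: cnt v)
    finally show ?thesis by (simp add: inc_edges_def im[OF fin])
  qed
  have incsub: "set_mset (inc_edges F v) \<subseteq> edges F" for v
    using wf by (auto simp: wf_fragment_def inc_edges_def set_mset_sum in_replicate_mset)
  have inner: "bij_betw f (inner_verts F) (inner_verts G)"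
  proof -
    have "f ` (verts F - set (opens F)) = verts G - set (opens G)"
      using injf opens imf o by (simp add: inj_on_image_set_diff)
    then show ?thesis
      using injf by (auto simp: inner_verts_def bij_betw_def intro: inj_on_subset)
  qed
  let ?g = "inv_into (edges F) g"
  have ig: "?g (g d) = d" if "d \<in> edges F" for d using injg that by simp
  have gi: "?g d \<in> edges F" "g (?g d) = d" if "d \<in> edges G" for d
    using that img by (auto simp: inv_into_into f_inv_into_f)
  have gin: "g d \<in> edges G" if "d \<in> edges F" for d using img that by blast
  have fv: "opens G ! i = f (opens F ! i)" "opens F ! i \<in> verts F" if "i < length (opens F)" for i
    using that o opens by (auto simp: subset_iff)
  show ?thesis
    unfolding pre_h_coeff_def
  proof (rule sum.reindex_bij_witness[where i = "\<lambda>\<psi>. restrict (\<psi> \<circ> g) (edges F)"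
        and j = "\<lambda>\<psi>. restrict (\<psi> \<circ> ?g) (edges G)"])
    fix \<psi> assume \<psi>: "\<psi> \<in> edge_colorings n F \<phi>"
    then have \<psi>P: "\<psi> \<in> edges F \<rightarrow>\<^sub>E {..<n}" by (simp add: edge_colorings_def)
    show "restrict (restrict (\<psi> \<circ> ?g) (edges G) \<circ> g) (edges F) = \<psi>"
    proof
      fix d show "restrict (restrict (\<psi> \<circ> ?g) (edges G) \<circ> g) (edges F) d = \<psi> d"
        by (cases "d \<in> edges F") (simp_all add: ig gin PiE_arb[OF \<psi>P])
    qed
    show "restrict (\<psi> \<circ> ?g) (edges G) \<in> edge_colorings n G \<phi>"
      unfolding edge_colorings_def mem_Collect_eq
    proof (intro conjI allI impI ballI)
      show "restrict (\<psi> \<circ> ?g) (edges G) \<in> edges G \<rightarrow>\<^sub>E {..<n}"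
        using \<psi>P gi(1) by (auto simp: PiE_mem)
    next
      fix i d assume i: "i < length (opens G)" and d: "d \<in> edges G" and m: "opens G ! i \<in># ends G d"
      have i': "i < length (opens F)" using i o by simp
      have "opens F ! i \<in># ends F (?g d)"
        using fmem[OF gi(1)[OF d] fv(2)[OF i']] m fv(1)[OF i'] gi(2)[OF d] by simp
      then show "restrict (\<psi> \<circ> ?g) (edges G) d = \<phi> ! i"
        using \<psi> i' gi(1)[OF d] d by (auto simp: edge_colorings_def)
    qed
    have "h (exponent_of (image_mset (restrict (\<psi> \<circ> ?g) (edges G)) (inc_edges G (f v))))
        = h (exponent_of (image_mset \<psi> (inc_edges F v)))" if "v \<in> inner_verts F" for v
    proof -
      have "v \<in> verts F" using that by (simp add: inner_verts_def)
      then have "image_mset (restrict (\<psi> \<circ> ?g) (edges G)) (inc_edges G (f v))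
          = image_mset (restrict (\<psi> \<circ> ?g) (edges G) \<circ> g) (inc_edges F v)"
        by (simp add: inc multiset.map_comp)
      also have "\<dots> = image_mset \<psi> (inc_edges F v)"
      proof (rule image_mset_cong)
        fix d assume "d \<in># inc_edges F v"
        then have "d \<in> edges F" using incsub[of v] by blast
        then show "(restrict (\<psi> \<circ> ?g) (edges G) \<circ> g) d = \<psi> d" by (simp add: ig gin)
      qed
      finally have "image_mset (restrict (\<psi> \<circ> ?g) (edges G)) (inc_edges G (f v))
          = image_mset \<psi> (inc_edges F v)" .
      then show ?thesis by simp
    qed
    then show "(\<Prod>v\<in>inner_verts G. h (exponent_of (image_mset (restrict (\<psi> \<circ> ?g) (edges G)) (inc_edges G v))))
        = (\<Prod>v\<in>inner_verts F. h (exponent_of (image_mset \<psi> (inc_edges F v))))"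
      by (subst prod.reindex_bij_betw[OF inner, symmetric]) simp
  next
    fix \<psi> assume \<psi>: "\<psi> \<in> edge_colorings n G \<phi>"
    then have \<psi>P: "\<psi> \<in> edges G \<rightarrow>\<^sub>E {..<n}" by (simp add: edge_colorings_def)
    show "restrict (restrict (\<psi> \<circ> g) (edges F) \<circ> ?g) (edges G) = \<psi>"
    proof
      fix d show "restrict (restrict (\<psi> \<circ> g) (edges F) \<circ> ?g) (edges G) d = \<psi> d"
        by (cases "d \<in> edges G") (simp_all add: gi PiE_arb[OF \<psi>P])
    qed
    show "restrict (\<psi> \<circ> g) (edges F) \<in> edge_colorings n F \<phi>"
      unfolding edge_colorings_def mem_Collect_eq
    proof (intro conjI allI impI ballI)
      show "restrict (\<psi> \<circ> g) (edges F) \<in> edges F \<rightarrow>\<^sub>E {..<n}"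
        using \<psi>P gin by (auto simp: PiE_mem)
    next
      fix i d assume i: "i < length (opens F)" and d: "d \<in> edges F" and m: "opens F ! i \<in># ends F d"
      have "opens G ! i \<in># ends G (g d)"
        using fmem[OF d fv(2)[OF i]] m fv(1)[OF i] by simp
      then show "restrict (\<psi> \<circ> g) (edges F) d = \<phi> ! i"
        using \<psi> i o gin[OF d] d by (auto simp: edge_colorings_def)
    qed
  qed
qed

lift_definition h_coeff :: "nat \<Rightarrow> ((nat \<Rightarrow>\<^sub>0 nat) \<Rightarrow> real) \<Rightarrow> nat list \<Rightarrow> fragment \<Rightarrow> real"
  is pre_h_coeff
  by (rule pre_h_coeff_iso)

text \<open>
  The words over \<open>{..<n}\<close> form a basis of the tensor algebra of \<open>V = \<real>\<^sup>n\<close>: the word \<open>\<phi>\<close> of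
  length \<open>k\<close> stands for the tensor \<open>e\<^sub>\<phi>\<close> in the \<open>k\<close>-th tensor power of \<open>V\<close>.
\<close>

type_synonym tensor = "nat list \<Rightarrow>\<^sub>0 real"

definition tensor_algebra :: "nat \<Rightarrow> tensor set" where
  "tensor_algebra n = {t. \<forall>w\<in>Poly_Mapping.keys t. set w \<subseteq> {..<n}}"

definition p_fragment :: "nat \<Rightarrow> ((nat \<Rightarrow>\<^sub>0 nat) \<Rightarrow> real) \<Rightarrow> fragment \<Rightarrow> tensor" where
  "p_fragment n h F = (\<Sum>\<phi>\<in>words n (num_opens F). Poly_Mapping.single \<phi> (h_coeff n h \<phi> F))"

definition p_map :: "nat \<Rightarrow> ((nat \<Rightarrow>\<^sub>0 nat) \<Rightarrow> real) \<Rightarrow> quantum_fragment \<Rightarrow> tensor" where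
  "p_map n h = lin_ext (p_fragment n h)"


section \<open>The orthogonal group and its actions\<close>

definition orthogonal_group :: "nat \<Rightarrow> real mat set" where
  "orthogonal_group n = {U \<in> carrier_mat n n. transpose_mat U * U = 1\<^sub>m n}"

lemma transpose_orthogonal_inverse:
  assumes "U \<in> orthogonal_group n"
  shows "transpose_mat U \<in> orthogonal_group n"
    and "inverts_mat U (transpose_mat U)" and "inverts_mat (transpose_mat U) U"
proof -
  have U: "U \<in> carrier_mat n n" "transpose_mat U * U = 1\<^sub>m n"
    using assms by (auto simp: orthogonal_group_def)
  then have "U * transpose_mat U = 1\<^sub>m n"
    by (intro mat_mult_left_right_inverse[of "transpose_mat U" n U]) auto
  then show "transpose_mat U \<in> orthogonal_group n"
    "inverts_mat U (transpose_mat U)" "inverts_mat (transpose_mat U) U"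
    using U by (auto simp: orthogonal_group_def inverts_mat_def)
qed

type_synonym rpoly = "(nat \<Rightarrow>\<^sub>0 nat) \<Rightarrow>\<^sub>0 real"

definition polys :: "nat \<Rightarrow> rpoly set" where
  "polys n = {q. \<forall>\<alpha>\<in>Poly_Mapping.keys q. Poly_Mapping.keys \<alpha> \<subseteq> {..<n}}"

definition var :: "nat \<Rightarrow> rpoly" where
  "var i = Poly_Mapping.single (Poly_Mapping.single i 1) 1"

definition poly_eval :: "rpoly \<Rightarrow> (nat \<Rightarrow> real) \<Rightarrow> real" where
  "poly_eval q x = (\<Sum>\<alpha>\<in>Poly_Mapping.keys q. Poly_Mapping.lookup q \<alpha>
     * (\<Prod>j\<in>Poly_Mapping.keys \<alpha>. x j ^ Poly_Mapping.lookup \<alpha> j))"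

definition poly_subst :: "(nat \<Rightarrow> rpoly) \<Rightarrow> rpoly \<Rightarrow> rpoly" where
  "poly_subst \<sigma> q = (\<Sum>\<alpha>\<in>Poly_Mapping.keys q. Poly_Mapping.single 0 (Poly_Mapping.lookup q \<alpha>)
     * (\<Prod>j\<in>Poly_Mapping.keys \<alpha>. \<sigma> j ^ Poly_Mapping.lookup \<alpha> j))"

text \<open>
  \<open>U q\<close> arises from \<open>q\<close> by substituting the linear form \<open>v \<mapsto> (U\<^sup>-\<^sup>1 v)\<^sub>j\<close> for the variable with
  index \<open>j\<close>, where the inverse of an orthogonal \<open>U\<close> is written as its transpose.  Lemma
  \<open>poly_eval_act\<close> below is the defining property \<open>(U q)(v) = q(U\<^sup>-\<^sup>1 v)\<close>.
\<close>

definition poly_act :: "nat \<Rightarrow> real mat \<Rightarrow> rpoly \<Rightarrow> rpoly" where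
  "poly_act n U = poly_subst
     (\<lambda>j. \<Sum>i<n. Poly_Mapping.single 0 (transpose_mat U $$ (j, i)) * var i)"

definition dual_act :: "nat \<Rightarrow> real mat \<Rightarrow> (rpoly \<Rightarrow> real) \<Rightarrow> (rpoly \<Rightarrow> real)" where
  "dual_act n U f = (\<lambda>q. f (poly_act n (transpose_mat U) q))"

definition functional :: "((nat \<Rightarrow>\<^sub>0 nat) \<Rightarrow> real) \<Rightarrow> rpoly \<Rightarrow> real" where
  "functional h q = (\<Sum>\<alpha>\<in>Poly_Mapping.keys q. Poly_Mapping.lookup q \<alpha> * h \<alpha>)"

definition Stab :: "nat \<Rightarrow> ((nat \<Rightarrow>\<^sub>0 nat) \<Rightarrow> real) \<Rightarrow> real mat set" where
  "Stab n h = {U \<in> orthogonal_group n. \<forall>q\<in>polys n. dual_act n U (functional h) q = functional h q}"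

text \<open>\<open>pure_tensor n [v\<^sub>1, \<dots>, v\<^sub>k]\<close> is the tensor product of the vectors \<open>v\<^sub>1, \<dots>, v\<^sub>k\<close>.\<close>

definition pure_tensor :: "nat \<Rightarrow> real vec list \<Rightarrow> tensor" where
  "pure_tensor n vs = (\<Sum>w\<in>words n (length vs).
     Poly_Mapping.single w (\<Prod>i<length vs. vs ! i $ (w ! i)))"

definition tensor_act :: "nat \<Rightarrow> real mat \<Rightarrow> tensor \<Rightarrow> tensor" where
  "tensor_act n U = lin_ext (\<lambda>w. pure_tensor n (map (\<lambda>j. U *\<^sub>v unit_vec n j) w))"

definition tensor_invariants :: "nat \<Rightarrow> real mat set \<Rightarrow> tensor set" where
  "tensor_invariants n H = {t \<in> tensor_algebra n. \<forall>U\<in>H. tensor_act n U t = t}"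


section \<open>The actions in terms of vectors\<close>

definition mono_eval :: "(nat \<Rightarrow>\<^sub>0 nat) \<Rightarrow> (nat \<Rightarrow> real) \<Rightarrow> real" where
  "mono_eval \<alpha> x = (\<Prod>j\<in>Poly_Mapping.keys \<alpha>. x j ^ Poly_Mapping.lookup \<alpha> j)"

lemma mono_eval_superset:
  assumes "finite A" "Poly_Mapping.keys \<alpha> \<subseteq> A"
  shows "mono_eval \<alpha> x = (\<Prod>j\<in>A. x j ^ Poly_Mapping.lookup \<alpha> j)"
  unfolding mono_eval_def using assms
  by (intro prod.mono_neutral_left) (auto simp: in_keys_iff)

lemma mono_eval_add: "mono_eval (\<alpha> + \<beta>) x = mono_eval \<alpha> x * mono_eval \<beta> x"
proof -
  let ?A = "Poly_Mapping.keys \<alpha> \<union> Poly_Mapping.keys \<beta>"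
  have "Poly_Mapping.keys (\<alpha> + \<beta>) \<subseteq> ?A" by (rule Poly_Mapping.keys_add)
  then show ?thesis
    by (simp add: mono_eval_superset[of ?A] lookup_add power_add prod.distrib)
qed

lemma poly_eval_superset:
  assumes "finite A" "Poly_Mapping.keys q \<subseteq> A"
  shows "poly_eval q x = (\<Sum>\<alpha>\<in>A. Poly_Mapping.lookup q \<alpha> * mono_eval \<alpha> x)"
  unfolding poly_eval_def mono_eval_def[symmetric] using assms
  by (intro sum.mono_neutral_left) (auto simp: in_keys_iff)

lemma poly_eval_single: "poly_eval (Poly_Mapping.single \<alpha> c) x = c * mono_eval \<alpha> x"
  by (simp add: poly_eval_superset[of "{\<alpha>}"])

lemma poly_eval_add: "poly_eval (p + q) x = poly_eval p x + poly_eval q x"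
proof -
  let ?A = "Poly_Mapping.keys p \<union> Poly_Mapping.keys q"
  have "Poly_Mapping.keys (p + q) \<subseteq> ?A" by (rule Poly_Mapping.keys_add)
  then show ?thesis
    by (simp add: poly_eval_superset[of ?A] lookup_add distrib_right sum.distrib)
qed

lemma poly_eval_sum: "poly_eval (\<Sum>a\<in>A. f a) x = (\<Sum>a\<in>A. poly_eval (f a) x)"
  by (induction A rule: infinite_finite_induct)
    (simp_all add: poly_eval_add, simp_all add: poly_eval_def)

lemma rpoly_sum_single:
  fixes q :: rpoly
  shows "q = (\<Sum>\<alpha>\<in>Poly_Mapping.keys q. Poly_Mapping.single \<alpha> (Poly_Mapping.lookup q \<alpha>))"
  by (rule poly_mapping_eqI)
    (auto simp: lookup_sum lookup_single when_def in_keys_iff)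

lemma poly_eval_mult: "poly_eval (p * q) x = poly_eval p x * poly_eval q x"
proof -
  have "p * q = (\<Sum>\<alpha>\<in>Poly_Mapping.keys p. \<Sum>\<beta>\<in>Poly_Mapping.keys q.
      Poly_Mapping.single (\<alpha> + \<beta>) (Poly_Mapping.lookup p \<alpha> * Poly_Mapping.lookup q \<beta>))"
    by (subst (1) rpoly_sum_single[of p], subst (1) rpoly_sum_single[of q])
      (simp add: sum_product mult_single)
  then show ?thesis
    by (simp add: poly_eval_sum poly_eval_single mono_eval_add sum_product
        poly_eval_superset[of "Poly_Mapping.keys p" p] poly_eval_superset[of "Poly_Mapping.keys q" q]
        mult_ac)
qed

lemma poly_eval_one: "poly_eval 1 x = 1"
  by (simp add: poly_eval_single mono_eval_def flip: single_one)

lemma poly_eval_power: "poly_eval (p ^ k) x = poly_eval p x ^ k"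
  by (induction k) (simp_all add: poly_eval_one poly_eval_mult)

lemma poly_eval_prod: "poly_eval (\<Prod>a\<in>A. f a) x = (\<Prod>a\<in>A. poly_eval (f a) x)"
  by (induction A rule: infinite_finite_induct) (simp_all add: poly_eval_one poly_eval_mult)

lemma poly_eval_subst: "poly_eval (poly_subst \<sigma> q) x = poly_eval q (\<lambda>j. poly_eval (\<sigma> j) x)"
  by (simp add: poly_subst_def poly_eval_sum poly_eval_mult poly_eval_prod poly_eval_power
      poly_eval_single mono_eval_def poly_eval_def[of q])

lemma poly_eval_var: "poly_eval (var i) x = x i"
  by (simp add: var_def poly_eval_single mono_eval_def)

lemma poly_eval_act:
  assumes U: "U \<in> carrier_mat n n" and v: "v \<in> carrier_vec n" and q: "q \<in> polys n"
  shows "poly_eval (poly_act n U q) (($) v) = poly_eval q (($) (transpose_mat U *\<^sub>v v))"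
proof -
  have "poly_eval (\<Sum>i<n. Poly_Mapping.single 0 (transpose_mat U $$ (j, i)) * var i) (($) v)
      = (transpose_mat U *\<^sub>v v) $ j" if "j < n" for j
    using U v that
    by (simp add: poly_eval_sum poly_eval_mult poly_eval_single poly_eval_var mono_eval_def
        scalar_prod_def lessThan_atLeast0)
  moreover have "j < n" if "\<alpha> \<in> Poly_Mapping.keys q" "j \<in> Poly_Mapping.keys \<alpha>" for \<alpha> j
    using q that by (auto simp: polys_def)
  ultimately show ?thesis
    unfolding poly_act_def poly_eval_subst poly_eval_def[of q]
    by (intro sum.cong prod.cong arg_cong2[where f = "(*)"] refl) simp
qed

lemma finite_words: "finite (words n k)"
  using finite_lists_length_eq[of "{..<n}" k] by (simp add: words_def conj_commute)

lemma lookup_pure_tensor: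
  "Poly_Mapping.lookup (pure_tensor n vs) w
    = (if w \<in> words n (length vs) then \<Prod>i<length vs. vs ! i $ (w ! i) else 0)"
  by (simp add: pure_tensor_def lookup_sum lookup_single when_def finite_words)

lemma sum_words_prod:
  "(\<Sum>w\<in>words n k. \<Prod>i<k. f i (w ! i)) = (\<Prod>i<k. \<Sum>j<n. (f i j :: real))"
proof (induction k arbitrary: f)
  case 0
  have "words n 0 = {[]}" by (auto simp: words_def)
  then show ?case by simp
next
  case (Suc k)
  have "words n (Suc k) = (\<lambda>(j, w). j # w) ` ({..<n} \<times> words n k)"
    by (auto simp: words_def length_Suc_conv image_iff)
  moreover have "inj_on (\<lambda>(j, w). j # w) ({..<n} \<times> words n k)" by (auto simp: inj_on_def)
  ultimately have "(\<Sum>w\<in>words n (Suc k). \<Prod>i<Suc k. f i (w ! i))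
      = (\<Sum>(j, w)\<in>{..<n} \<times> words n k. \<Prod>i<Suc k. f i ((j # w) ! i))"
    by (simp add: sum.reindex case_prod_beta' del: prod.lessThan_Suc)
  also have "\<dots> = (\<Sum>j<n. f 0 j) * (\<Sum>w\<in>words n k. \<Prod>i<k. f (Suc i) (w ! i))"
    by (simp add: prod.lessThan_Suc_shift sum.cartesian_product[symmetric] sum_product
        del: prod.lessThan_Suc)
  finally show ?case
    by (simp only: Suc.IH[of "\<lambda>i. f (Suc i)"] prod.lessThan_Suc_shift o_def)
qed

lemma tensor_act_pure_tensor:
  assumes U: "U \<in> carrier_mat n n" and vs: "set vs \<subseteq> carrier_vec n"
  shows "tensor_act n U (pure_tensor n vs) = pure_tensor n (map (\<lambda>v. U *\<^sub>v v) vs)"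
proof (rule poly_mapping_eqI)
  fix w
  let ?k = "length vs"
  have keys: "Poly_Mapping.keys (pure_tensor n vs) \<subseteq> words n ?k"
    by (auto simp: in_keys_iff lookup_pure_tensor split: if_splits)
  have len: "length u = ?k" if "u \<in> words n ?k" for u using that by (simp add: words_def)
  have "Poly_Mapping.lookup (tensor_act n U (pure_tensor n vs)) w
    = (\<Sum>u\<in>words n ?k. (\<Prod>i<?k. vs ! i $ (u ! i))
        * Poly_Mapping.lookup (pure_tensor n (map (\<lambda>j. U *\<^sub>v unit_vec n j) u)) w)"
    unfolding tensor_act_def lookup_lin_ext[OF finite_words keys]
    by (intro sum.cong) (simp_all add: lookup_pure_tensor)
  also have "\<dots> = Poly_Mapping.lookup (pure_tensor n (map (\<lambda>v. U *\<^sub>v v) vs)) w"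
  proof (cases "w \<in> words n ?k")
    case True
    have w: "w ! i < n" if "i < ?k" for i
      using True that by (auto simp: words_def subset_iff)
    have "(\<Sum>u\<in>words n ?k. (\<Prod>i<?k. vs ! i $ (u ! i))
        * Poly_Mapping.lookup (pure_tensor n (map (\<lambda>j. U *\<^sub>v unit_vec n j) u)) w)
      = (\<Sum>u\<in>words n ?k. \<Prod>i<?k. vs ! i $ (u ! i) * U $$ (w ! i, u ! i))"
    proof (rule sum.cong[OF refl])
      fix u assume u: "u \<in> words n ?k"
      have "(U *\<^sub>v unit_vec n (u ! i)) $ (w ! i) = U $$ (w ! i, u ! i)" if "i < ?k" for i
      proof -
        have "u ! i < n" using u that by (auto simp: words_def subset_iff)
        then show ?thesis using U w[OF that] by simp
      qed
      then show "(\<Prod>i<?k. vs ! i $ (u ! i))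
          * Poly_Mapping.lookup (pure_tensor n (map (\<lambda>j. U *\<^sub>v unit_vec n j) u)) w
        = (\<Prod>i<?k. vs ! i $ (u ! i) * U $$ (w ! i, u ! i))"
        using True len[OF u] by (simp add: lookup_pure_tensor prod.distrib)
    qed
    also have "\<dots> = (\<Prod>i<?k. \<Sum>j<n. vs ! i $ j * U $$ (w ! i, j))"
      by (rule sum_words_prod)
    also have "\<dots> = (\<Prod>i<?k. (U *\<^sub>v (vs ! i)) $ (w ! i))"
    proof (rule prod.cong[OF refl])
      fix i assume "i \<in> {..<?k}"
      then have i: "i < ?k" by simp
      have "vs ! i \<in> carrier_vec n" using vs i by auto
      then show "(\<Sum>j<n. vs ! i $ j * U $$ (w ! i, j)) = (U *\<^sub>v (vs ! i)) $ (w ! i)"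
        using U w[OF i] by (simp add: scalar_prod_def lessThan_atLeast0 mult.commute)
    qed
    finally show ?thesis using True by (simp add: lookup_pure_tensor)
  next
    case False
    then show ?thesis by (simp add: lookup_pure_tensor len)
  qed
  finally show "Poly_Mapping.lookup (tensor_act n U (pure_tensor n vs)) w
    = Poly_Mapping.lookup (pure_tensor n (map (\<lambda>v. U *\<^sub>v v) vs)) w" .
qed

end

theory Submission
  imports Defs "HOL-Probability.Distributions"
begin

text \<open>
  Write \<open>V = \<real>\<^sup>n\<close>, let \<open>h\<^sub>d\<close> be the symmetric tensor of degree \<open>d\<close> whose entry at a word \<open>v\<close> is
  \<open>h\<close> at the exponent of \<open>v\<close> (\<open>vertex_tensor\<close>), and for a matrix \<open>X\<close> and a tensor \<open>T\<close> let \<open>X T\<close>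
  be the diagonal action (\<open>transform\<close>).

  The image of \<open>p_h\<close> consists of invariants because a coefficient of a fragment is a contraction
  in which every vertex carries some \<open>h\<^sub>d\<close> and every edge carries the standard inner product.
  An orthogonal \<open>U\<close> preserves the inner product, and it preserves all \<open>h\<^sub>d\<close> exactly if
  it lies in the stabilizer (\<open>Stab_iff\<close>); so it can be pushed through the contraction
  (\<open>pre_h_coeff_invariant\<close>).

  For the converse, project an invariant tensor orthogonally onto the image of \<open>p_h\<close>.  The
  difference \<open>x\<close> is invariant and orthogonal to the tensor of every fragment, and the point is to
  show that \<open>x = 0\<close> (\<open>invariant_orthogonal_zero\<close>).  To this end consider functions of a
  variable \<open>n \<times> n\<close> matrix \<open>X\<close>, and the algebra \<open>R\<close> generated by the entries of \<open>X X\<^sup>T\<close> and the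
  entries of all \<open>X h\<^sub>d\<close>.

  \<^item> Orthogonality.  For independent Gaussian entries of \<open>X\<close>, the expectation of a monomial is,
    by Wick's formula (\<open>wick\<close>), a sum over the perfect matchings of its factors.  Applied to
    \<open>(X x)\<^sub>u\<close> times a product of generators, each matching connects \<open>x\<close>, copies of \<open>h\<^sub>d\<close> and
    copies of the identity tensor to the inner product of \<open>x\<close> with the tensor of a fragment, up
    to a scalar.  These inner products are zero, so every entry \<open>(X x)\<^sub>u\<close> is orthogonal to \<open>R\<close>
    (\<open>mean_orthogonal\<close>).

  \<^item> Density.  Suppose all generators agree at \<open>X\<close> and at an invertible \<open>Y\<close>.  Then
    \<open>W = Y\<^sup>-\<^sup>1 X\<close> is orthogonal and fixes every \<open>h\<^sub>d\<close>, hence \<open>W\<close> is in the stabilizer,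
    \<open>W x = x\<close> and \<open>X x = Y x\<close>.  So \<open>F(X) = det(X X\<^sup>T) (X x)\<^sub>u\<close>, in which the determinant takes care
    of singular matrices, is a function of the values of the generators, and the
    Stone-Weierstrass theorem makes it a uniform limit of elements of \<open>R\<close> on any compact set
    (\<open>Stone_Weierstrass_fibres\<close>).

  Since \<open>F\<close> is in turn orthogonal to \<open>R\<close>, it follows that the mean of \<open>F\<^sup>2\<close> is zero, provided
  that the measure lives on a compact set.  The Gaussian measure does not, but its image under
  \<open>X \<mapsto> exp(- |X|\<^sup>2) X\<close> does, and this substitution multiplies all moments of degree \<open>d\<close> by one
  factor that depends on \<open>d\<close> only (\<open>mean_monomial\<close>), so orthogonality survives.  Hence \<open>F\<close> vanishes
  at a positive multiple of the identity matrix, where its value is a nonzero multiple of the entry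
  of \<open>x\<close> at \<open>u\<close>.

  For \<open>h = 0\<close> the theorem is the first fundamental theorem of invariant theory for the
  real orthogonal group, and the argument above contains a proof of it.
\<close>

unbundle no vec_syntax


section \<open>Tensors as functions on words\<close>

lemma words_Nil [simp]: "words n 0 = {[]}"
  by (auto simp: words_def)

lemma length_words: "w \<in> words n k \<Longrightarrow> length w = k"
  by (simp add: words_def)

lemma nth_words: "w \<in> words n k \<Longrightarrow> i < k \<Longrightarrow> w ! i < n"
  by (auto simp: words_def subset_iff)

lemma sum_words_append:
  "(\<Sum>w\<in>words n (k + l). f w) = (\<Sum>u\<in>words n k. \<Sum>v\<in>words n l. f (u @ v))"
  for f :: "nat list \<Rightarrow> 'a::comm_monoid_add"
proof -
  have "(\<Sum>w\<in>words n (k + l). f w) = (\<Sum>(u, v)\<in>words n k \<times> words n l. f (u @ v))"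
    by (rule sum.reindex_bij_witness[where j = "\<lambda>w. (take k w, drop k w)" and i = "\<lambda>(u, v). u @ v"])
      (auto simp: words_def dest: in_set_takeD in_set_dropD)
  then show ?thesis by (simp add: sum.cartesian_product)
qed

lemma sum_words_Suc:
  "(\<Sum>w\<in>words n (Suc k). f w) = (\<Sum>j<n. \<Sum>v\<in>words n k. f (j # v))"
  for f :: "nat list \<Rightarrow> 'a::comm_monoid_add"
proof -
  have "(\<Sum>w\<in>words n (Suc k). f w) = (\<Sum>(j, v)\<in>{..<n} \<times> words n k. f (j # v))"
    by (rule sum.reindex_bij_witness[where j = "\<lambda>w. (hd w, tl w)" and i = "\<lambda>(u, v). u # v"])
      (auto simp: words_def length_Suc_conv)
  then show ?thesis by (simp add: sum.cartesian_product)
qed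

text \<open>
  The entry of a tensor power of the matrix \<open>X\<close> in row \<open>u\<close> and column \<open>v\<close>.
\<close>

definition word_entry :: "(nat \<times> nat \<Rightarrow> real) \<Rightarrow> nat list \<Rightarrow> nat list \<Rightarrow> real" where
  "word_entry X u v = (\<Prod>r<length u. X (u ! r, v ! r))"

text \<open>
  A tensor is given by its entries on words, without a fixed degree: \<open>transform n X T\<close> applies
  the matrix \<open>X\<close> to every factor of each homogeneous component of \<open>T\<close>.  As matrices vary over all
  of \<open>\<real>\<^sup>n\<^sup>\<times>\<^sup>n\<close> below, they are treated as functions of index pairs, that is, as points of a
  product space.
\<close>

definition transform :: "nat \<Rightarrow> (nat \<times> nat \<Rightarrow> real) \<Rightarrow> (nat list \<Rightarrow> real) \<Rightarrow> nat list \<Rightarrow> real" where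
  "transform n X T u = (\<Sum>v\<in>words n (length u). T v * word_entry X u v)"

lemma word_entry_Nil [simp]: "word_entry X [] v = 1"
  by (simp add: word_entry_def)

lemma word_entry_Cons: "word_entry X (i # u) (j # v) = X (i, j) * word_entry X u v"
  by (simp add: word_entry_def prod.lessThan_Suc_shift del: prod.lessThan_Suc)

lemma word_entry_append:
  "length u = length v \<Longrightarrow> word_entry X (u @ u') (v @ v') = word_entry X u v * word_entry X u' v'"
  by (induction u v rule: list_induct2) (simp_all add: word_entry_Cons)

lemma transform_cong:
  assumes "\<And>v. v \<in> words n (length u) \<Longrightarrow> T v = T' v"
  shows "transform n X T u = transform n X T' u"
  unfolding transform_def using assms by (intro sum.cong) auto

text \<open>
  A product of entries of tensors is an entry of their tensor product; this turns
  every product of generators into one single entry.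
\<close>

lemma transform_mult:
  "transform n X T u * transform n X T' u' =
    transform n X (\<lambda>w. T (take (length u) w) * T' (drop (length u) w)) (u @ u')"
proof -
  have "transform n X (\<lambda>w. T (take (length u) w) * T' (drop (length u) w)) (u @ u')
    = (\<Sum>v\<in>words n (length u). \<Sum>v'\<in>words n (length u').
        (T v * word_entry X u v) * (T' v' * word_entry X u' v'))"
    unfolding transform_def length_append sum_words_append
    by (intro sum.cong refl) (simp add: length_words word_entry_append mult_ac)
  then show ?thesis by (simp add: transform_def sum_product)
qed

definition mat_prod :: "nat \<Rightarrow> (nat \<times> nat \<Rightarrow> real) \<Rightarrow> (nat \<times> nat \<Rightarrow> real) \<Rightarrow> nat \<times> nat \<Rightarrow> real" where
  "mat_prod n X Y = (\<lambda>(i, j). \<Sum>l<n. X (i, l) * Y (l, j))"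

lemma transform_transform:
  "transform n X (transform n Y T) u = transform n (mat_prod n X Y) T u"
proof -
  let ?k = "length u"
  have "transform n X (transform n Y T) u
      = (\<Sum>v\<in>words n ?k. \<Sum>w\<in>words n ?k. (T w * word_entry Y v w) * word_entry X u v)"
    by (simp add: transform_def sum_distrib_right length_words)
  also have "\<dots> = (\<Sum>v\<in>words n ?k. \<Sum>w\<in>words n ?k. T w * (word_entry X u v * word_entry Y v w))"
    by (intro sum.cong refl) (simp only: mult_ac)
  also have "\<dots> = (\<Sum>w\<in>words n ?k. T w * (\<Sum>v\<in>words n ?k. word_entry X u v * word_entry Y v w))"
    by (subst sum.swap) (simp add: sum_distrib_left)
  also have "\<dots> = (\<Sum>w\<in>words n ?k. T w * word_entry (mat_prod n X Y) u w)"
  proof (intro sum.cong refl arg_cong2[where f = "(*)"])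
    fix w
    have "(\<Sum>v\<in>words n ?k. word_entry X u v * word_entry Y v w)
        = (\<Sum>v\<in>words n ?k. \<Prod>r<?k. X (u ! r, v ! r) * Y (v ! r, w ! r))"
      by (intro sum.cong) (simp_all add: word_entry_def length_words prod.distrib)
    also have "\<dots> = word_entry (mat_prod n X Y) u w"
      by (subst sum_words_prod) (simp add: word_entry_def mat_prod_def)
    finally show "(\<Sum>v\<in>words n ?k. word_entry X u v * word_entry Y v w)
      = word_entry (mat_prod n X Y) u w" .
  qed
  finally show ?thesis by (simp add: transform_def)
qed

lemma word_entry_scaled_one:
  assumes "u \<in> words n k" "v \<in> words n k" "\<And>i j. i < n \<Longrightarrow> j < n \<Longrightarrow> X (i, j) = (if i = j then c else 0)"
  shows "word_entry X u v = (if v = u then c ^ k else 0)"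
proof (cases "v = u")
  case True
  then show ?thesis using assms nth_words[OF assms(1)]
    by (simp add: word_entry_def length_words)
next
  case False
  then obtain r where "r < k" "u ! r \<noteq> v ! r"
    using assms(1,2) by (metis length_words nth_equalityI)
  then show ?thesis using False assms nth_words[OF assms(1)] nth_words[OF assms(2)]
    by (auto simp: word_entry_def length_words)
qed

lemma transform_scaled_one:
  assumes "u \<in> words n k" "\<And>i j. i < n \<Longrightarrow> j < n \<Longrightarrow> X (i, j) = (if i = j then c else 0)"
  shows "transform n X T u = c ^ k * T u"
proof -
  have "transform n X T u = (\<Sum>v\<in>words n k. if v = u then c ^ k * T v else 0)"
    unfolding transform_def length_words[OF assms(1)]
    by (intro sum.cong refl) (simp add: word_entry_scaled_one[OF assms(1) _ assms(2)])
  then show ?thesis using assms(1) by (simp add: finite_words)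
qed

lemma transform_entry_cong:
  assumes "u \<in> words n k" "\<And>i j. i < n \<Longrightarrow> j < n \<Longrightarrow> X (i, j) = Y (i, j)"
  shows "transform n X T u = transform n Y T u"
  unfolding transform_def word_entry_def
  using assms by (intro sum.cong prod.cong arg_cong2[where f = "(*)"] refl)
    (auto simp: length_words nth_words)

definition entries :: "real mat \<Rightarrow> nat \<times> nat \<Rightarrow> real" where
  "entries U = (\<lambda>(i, j). U $$ (i, j))"

lemma lookup_tensor_act:
  assumes U: "U \<in> carrier_mat n n" and t: "t \<in> tensor_algebra n"
  shows "Poly_Mapping.lookup (tensor_act n U t) w =
    (if set w \<subseteq> {..<n} then transform n (entries U) (Poly_Mapping.lookup t) w else 0)"
proof -
  let ?A = "Poly_Mapping.keys t \<union> words n (length w)"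
  have fin: "finite ?A" by (simp add: finite_words)
  have keys: "u \<in> words n (length u)" if "u \<in> Poly_Mapping.keys t" for u
    using t that by (auto simp: tensor_algebra_def words_def)
  have entry: "Poly_Mapping.lookup (pure_tensor n (map (\<lambda>j. U *\<^sub>v unit_vec n j) u)) w
      = (if w \<in> words n (length u) then word_entry (entries U) w u else 0)"
    if u: "u \<in> ?A" for u
  proof -
    have u': "u \<in> words n (length u)" using u keys by (auto simp: length_words)
    have "(U *\<^sub>v unit_vec n (u ! i)) $ (w ! i) = entries U (w ! i, u ! i)"
      if "i < length u" "w \<in> words n (length u)" for i
      using U nth_words[OF that(2,1)] nth_words[OF u' that(1)] by (simp add: entries_def)
    then show ?thesis by (auto simp: lookup_pure_tensor word_entry_def length_words)
  qed
  have "Poly_Mapping.lookup (tensor_act n U t) w = (\<Sum>u\<in>?A. Poly_Mapping.lookup t u *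
      (if w \<in> words n (length u) then word_entry (entries U) w u else 0))"
    unfolding tensor_act_def by (subst lookup_lin_ext[OF fin]) (auto simp: entry)
  also have "\<dots> = (\<Sum>u\<in>words n (length w). Poly_Mapping.lookup t u *
      (if w \<in> words n (length u) then word_entry (entries U) w u else 0))"
    using fin keys by (intro sum.mono_neutral_right) (auto simp: words_def)
  also have "\<dots> = (if set w \<subseteq> {..<n} then transform n (entries U) (Poly_Mapping.lookup t) w else 0)"
  proof (cases "set w \<subseteq> {..<n}")
    case True
    then have "w \<in> words n (length u)" if "u \<in> words n (length w)" for u
      using that by (simp add: words_def)
    then show ?thesis using True by (simp add: transform_def)
  next
    case False
    then have "w \<notin> words n m" for m by (simp add: words_def)
    then show ?thesis using False by simp
  qed
  finally show ?thesis .
qed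


section \<open>The stabilizer as a group of tensor symmetries\<close>

definition vertex_tensor :: "((nat \<Rightarrow>\<^sub>0 nat) \<Rightarrow> real) \<Rightarrow> nat list \<Rightarrow> real" where
  "vertex_tensor h w = h (exponent_of (mset w))"

lemma functional_superset:
  assumes "finite A" "Poly_Mapping.keys q \<subseteq> A"
  shows "functional h q = (\<Sum>\<alpha>\<in>A. Poly_Mapping.lookup q \<alpha> * h \<alpha>)"
  unfolding functional_def using assms by (intro sum.mono_neutral_left) (auto simp: in_keys_iff)

lemma functional_add: "functional h (p + q) = functional h p + functional h q"
proof -
  let ?A = "Poly_Mapping.keys p \<union> Poly_Mapping.keys q"
  have "Poly_Mapping.keys (p + q) \<subseteq> ?A" by (rule Poly_Mapping.keys_add)
  then show ?thesis
    by (simp add: functional_superset[of ?A] lookup_add distrib_right sum.distrib)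
qed

lemma functional_sum: "functional h (\<Sum>a\<in>A. f a) = (\<Sum>a\<in>A. functional h (f a))"
  by (induction A rule: infinite_finite_induct)
    (simp_all add: functional_add, simp_all add: functional_def)

lemma functional_single: "functional h (Poly_Mapping.single \<alpha> c) = c * h \<alpha>"
  by (simp add: functional_superset[of "{\<alpha>}"])

lemma exponent_of_add: "exponent_of (M + N) = exponent_of M + exponent_of N"
  by (rule poly_mapping_eqI) (simp add: lookup_add)

lemma exponent_of_single: "exponent_of {#i#} = Poly_Mapping.single i 1"
  by (rule poly_mapping_eqI) (simp add: lookup_single when_def)

lemma exponent_of_empty: "exponent_of {#} = 0"
  by (rule poly_mapping_eqI) simp

lemma keys_exponent_of: "Poly_Mapping.keys (exponent_of M) = set_mset M"
  by (auto simp: in_keys_iff)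

text \<open>
  Expanding a product of linear forms gives one term for each word; words with the same letters in
  a different order contribute to the same monomial.
\<close>

lemma prod_linear_forms:
  "prod_list (map (\<lambda>j. \<Sum>i<n. Poly_Mapping.single 0 (X (j, i)) * var i) u)
    = (\<Sum>v\<in>words n (length u). Poly_Mapping.single (exponent_of (mset v)) (word_entry X u v))"
proof (induction u)
  case Nil
  then show ?case by (simp add: exponent_of_empty)
next
  case (Cons j u)
  have "exponent_of (add_mset i (mset v)) = Poly_Mapping.single i 1 + exponent_of (mset v)" for i v
    using exponent_of_add[of "{#i#}" "mset v"] by (simp add: exponent_of_single)
  moreover have "Poly_Mapping.single 0 c * var i * Poly_Mapping.single \<alpha> d
      = Poly_Mapping.single (Poly_Mapping.single i 1 + \<alpha>) (c * d)" for c d i \<alpha>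
    by (simp add: var_def mult_single)
  ultimately show ?case
    by (simp only: list.map prod_list.Cons Cons.IH list.size(4) add_Suc_right add_0_right
        sum_words_Suc sum_product word_entry_Cons mset.simps)
qed

lemma functional_poly_act:
  assumes q: "q \<in> polys n" and U: "U \<in> carrier_mat n n"
  shows "functional h (poly_act n (transpose_mat U) q) = (\<Sum>\<alpha>\<in>Poly_Mapping.keys q.
    Poly_Mapping.lookup q \<alpha> * functional h (\<Prod>j\<in>Poly_Mapping.keys \<alpha>.
      (\<Sum>i<n. Poly_Mapping.single 0 (entries U (j, i)) * var i) ^ Poly_Mapping.lookup \<alpha> j))"
proof -
  have scale: "functional h (Poly_Mapping.single 0 c * p) = c * functional h p" for c p
  proof -
    have "Poly_Mapping.single 0 c * p = (\<Sum>\<alpha>\<in>Poly_Mapping.keys p. Poly_Mapping.single \<alpha> (c * Poly_Mapping.lookup p \<alpha>))"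
      by (subst rpoly_sum_single[of p]) (simp add: sum_distrib_left mult_single)
    then show ?thesis
      by (simp add: functional_sum functional_single) (simp add: functional_def sum_distrib_left mult_ac)
  qed
  show ?thesis
    unfolding poly_act_def poly_subst_def functional_sum scale transpose_transpose entries_def by simp
qed

lemma functional_linear_forms:
  "functional h (\<Prod>j\<in>Poly_Mapping.keys (exponent_of (mset u)).
      (\<Sum>i<n. Poly_Mapping.single 0 (X (j, i)) * var i) ^ Poly_Mapping.lookup (exponent_of (mset u)) j)
    = transform n X (vertex_tensor h) u"
proof -
  have *: "(\<Prod>j\<in>Poly_Mapping.keys (exponent_of (mset u)).
      (\<Sum>i<n. Poly_Mapping.single 0 (X (j, i)) * var i) ^ Poly_Mapping.lookup (exponent_of (mset u)) j)
    = prod_list (map (\<lambda>j. \<Sum>i<n. Poly_Mapping.single 0 (X (j, i)) * var i) u)"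
    by (simp only: keys_exponent_of lookup_exponent_of image_prod_mset_multiplicity[symmetric]
        prod_mset_prod_list[symmetric] mset_map)
  show ?thesis
    unfolding * prod_linear_forms functional_sum functional_single transform_def vertex_tensor_def
    by (simp add: mult.commute)
qed

text \<open>
  Every monomial is the product of the letters of some word, which allows passing from
  polynomials to symmetric tensors.
\<close>

lemma monomial_is_word:
  assumes "Poly_Mapping.keys \<alpha> \<subseteq> {..<n}"
  obtains u k where "u \<in> words n k" "\<alpha> = exponent_of (mset u)"
proof -
  obtain u where u: "mset u = Abs_multiset (Poly_Mapping.lookup \<alpha>)"
    using ex_mset by blast
  have "count (Abs_multiset (Poly_Mapping.lookup \<alpha>)) = Poly_Mapping.lookup \<alpha>"
    by (rule count_Abs_multiset) (metis (mono_tags, lifting) Collect_cong finite_lookup gr_zeroI less_irrefl)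
  then have "\<alpha> = exponent_of (mset u)" by (intro poly_mapping_eqI) (simp add: u)
  moreover from this have "u \<in> words n (length u)"
    using assms keys_exponent_of[of "mset u"] by (simp add: words_def)
  ultimately show ?thesis by (rule that[rotated])
qed

text \<open>
  The value of \<open>h\<close> at the polynomial obtained from the monomial of \<open>u\<close> by the substitution \<open>U\<close> is
  the entry at \<open>u\<close> of the transformed vertex tensor.  As monomials span all polynomials,
  invariance of the linear functional is invariance of the vertex tensors.
\<close>

lemma Stab_iff:
  "U \<in> Stab n h \<longleftrightarrow> U \<in> orthogonal_group n \<and>
    (\<forall>d. \<forall>u\<in>words n d. transform n (entries U) (vertex_tensor h) u = vertex_tensor h u)"
proof (cases "U \<in> orthogonal_group n")
  case True
  then have U: "U \<in> carrier_mat n n" by (simp add: orthogonal_group_def)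
  have word: "functional h (poly_act n (transpose_mat U) (Poly_Mapping.single (exponent_of (mset u)) 1))
      = transform n (entries U) (vertex_tensor h) u"
    and poly: "Poly_Mapping.single (exponent_of (mset u)) 1 \<in> polys n" if "u \<in> words n d" for u d
  proof -
    show *: "Poly_Mapping.single (exponent_of (mset u)) 1 \<in> polys n"
      using that by (auto simp: polys_def keys_exponent_of words_def)
    show "functional h (poly_act n (transpose_mat U) (Poly_Mapping.single (exponent_of (mset u)) 1))
      = transform n (entries U) (vertex_tensor h) u"
      using functional_linear_forms[where u = u and n = n and X = "entries U" and h = h] by (simp add: functional_poly_act[OF * U])
  qed
  show ?thesis
  proof (intro iffI conjI allI ballI)
    assume S: "U \<in> Stab n h"
    show "U \<in> orthogonal_group n" by fact
    fix d u assume u: "u \<in> words n d"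
    have "functional h (poly_act n (transpose_mat U) (Poly_Mapping.single (exponent_of (mset u)) 1))
      = functional h (Poly_Mapping.single (exponent_of (mset u)) 1)"
      using S poly[OF u] by (auto simp: Stab_def dual_act_def)
    then show "transform n (entries U) (vertex_tensor h) u = vertex_tensor h u"
      by (simp add: word[OF u] functional_single vertex_tensor_def)
  next
    assume R: "U \<in> orthogonal_group n \<and>
      (\<forall>d. \<forall>u\<in>words n d. transform n (entries U) (vertex_tensor h) u = vertex_tensor h u)"
    have "functional h (poly_act n (transpose_mat U) q) = functional h q" if q: "q \<in> polys n" for q
    proof -
      have "functional h (\<Prod>j\<in>Poly_Mapping.keys \<alpha>.
        (\<Sum>i<n. Poly_Mapping.single 0 (entries U (j, i)) * var i) ^ Poly_Mapping.lookup \<alpha> j) = h \<alpha>"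
        if \<alpha>: "\<alpha> \<in> Poly_Mapping.keys q" for \<alpha>
      proof -
        have "Poly_Mapping.keys \<alpha> \<subseteq> {..<n}" using q \<alpha> by (auto simp: polys_def)
        then obtain u k where u: "u \<in> words n k" "\<alpha> = exponent_of (mset u)"
          by (rule monomial_is_word)
        show ?thesis using R u(1)
          unfolding u(2) functional_linear_forms by (simp add: vertex_tensor_def)
      qed
      then show ?thesis by (simp add: functional_poly_act[OF q U] functional_def[of h q])
    qed
    then show "U \<in> Stab n h" using True by (simp add: Stab_def dual_act_def)
  qed
qed (simp add: Stab_def)


section \<open>Moments of the contracted Gaussian measure\<close>

text \<open>
  The moments of the standard normal distribution; the recursion is integration by parts, and
  it is the form in which they count matchings.
\<close>

fun gauss_moment :: "nat \<Rightarrow> real" where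
  "gauss_moment 0 = 1"
| "gauss_moment (Suc 0) = 0"
| "gauss_moment (Suc (Suc a)) = (real a + 1) * gauss_moment a"

lemma gauss_moment_odd: "gauss_moment (2 * k + 1) = 0"
  by (induction k) simp_all

lemma gauss_moment_even: "gauss_moment (2 * k) = fact (2 * k) / (2 ^ k * fact k)"
proof (induction k)
  case (Suc k)
  have "gauss_moment (2 * Suc k) = (2 * real k + 1) * (fact (2 * k) / (2 ^ k * fact k))"
    using Suc.IH by simp
  also have "\<dots> = fact (2 * Suc k) / (2 ^ Suc k * fact (Suc k))"
    by (simp add: divide_simps)
  finally show ?case .
qed simp

abbreviation std_normal :: "real measure" where
  "std_normal \<equiv> density lborel std_normal_density"

text \<open>
  The weight \<open>exp (- d x\<^sup>2)\<close> merely changes the variance of the normal distribution to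
  \<open>1 / (1 + 2 d)\<close>, so the moments are rescaled.
\<close>

lemma std_normal_integral_power_exp:
  fixes d :: real
  assumes "d \<ge> 0"
  shows "has_bochner_integral std_normal (\<lambda>x. x ^ a * exp (- d * x\<^sup>2))
    ((1 / sqrt (1 + 2 * d)) ^ Suc a * gauss_moment a)"
proof -
  define \<sigma> where "\<sigma> = 1 / sqrt (1 + 2 * d)"
  have \<sigma>: "\<sigma> > 0" and \<sigma>2: "\<sigma>\<^sup>2 = 1 / (1 + 2 * d)"
    using assms by (simp_all add: \<sigma>_def power_divide)
  have dens: "std_normal_density x * (x ^ a * exp (- d * x\<^sup>2)) = normal_density 0 \<sigma> x * (x - 0) ^ a * \<sigma>" for x
  proof -
    have "exp (- x\<^sup>2 / 2) * exp (- d * x\<^sup>2) = exp (- x\<^sup>2 / (2 * \<sigma>\<^sup>2))"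
      unfolding \<sigma>2 mult_exp_exp using assms by (simp add: field_simps)
    moreover have "sqrt (2 * pi * \<sigma>\<^sup>2) = sqrt (2 * pi) * \<sigma>"
      using \<sigma> by (simp add: real_sqrt_mult)
    ultimately show ?thesis
      using \<sigma> by (simp add: normal_density_def std_normal_density_def field_simps)
  qed
  have "has_bochner_integral lborel (\<lambda>x. normal_density 0 \<sigma> x * (x - 0) ^ a) (\<sigma> ^ a * gauss_moment a)"
  proof (cases "even a")
    case True
    then obtain k where k: "a = 2 * k" by blast
    have "fact (2 * k) / ((2 / \<sigma>\<^sup>2) ^ k * fact k) = \<sigma> ^ a * gauss_moment a"
      unfolding k gauss_moment_even using \<sigma> by (simp add: power_divide power_mult)
    then show ?thesis using normal_moment_even[OF \<sigma>, of 0 k] k by simp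
  next
    case False
    then obtain k where k: "a = 2 * k + 1" by (auto elim: oddE)
    show ?thesis using normal_moment_odd[OF \<sigma>, of 0 k] unfolding k gauss_moment_odd by simp
  qed
  from has_bochner_integral_mult_left[OF this, of \<sigma>]
  have "has_bochner_integral lborel (\<lambda>x. std_normal_density x *\<^sub>R (x ^ a * exp (- d * x\<^sup>2))) (\<sigma> ^ Suc a * gauss_moment a)"
    unfolding real_scaleR_def dens by (simp add: mult_ac)
  then show ?thesis
    unfolding \<sigma>_def by (intro has_bochner_integral_density) auto
qed

definition gauss :: "'v set \<Rightarrow> ('v \<Rightarrow> real) measure" where
  "gauss I = PiM I (\<lambda>_. std_normal)"

text \<open>
  All values of this map lie in a cube, so that the image of the Gaussian measure has compact
  support.
\<close>

definition shrink :: "'v set \<Rightarrow> ('v \<Rightarrow> real) \<Rightarrow> 'v \<Rightarrow> real" where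
  "shrink I X = (\<lambda>v. if v \<in> I then exp (- (\<Sum>u\<in>I. (X u)\<^sup>2)) * X v else 0)"

definition mean :: "'v set \<Rightarrow> (('v \<Rightarrow> real) \<Rightarrow> real) \<Rightarrow> real" where
  "mean I f = (\<integral>X. f (shrink I X) \<partial>gauss I)"

definition cube :: "'v set \<Rightarrow> ('v \<Rightarrow> real) set" where
  "cube I = PiE UNIV (\<lambda>v. if v \<in> I then {-1..1} else {0})"

lemma prob_space_gauss: "prob_space (gauss I)"
  unfolding gauss_def by (intro prob_space_PiM prob_space_normal_density) simp

lemma product_sigma_finite_std_normal: "product_sigma_finite (\<lambda>_ :: 'v. std_normal)"
proof -
  interpret prob_space std_normal by (intro prob_space_normal_density) simp
  show ?thesis by standard
qed

lemma compact_cube: "compact (cube I)"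
proof -
  have "compactin (product_topology (\<lambda>i. euclidean) UNIV) (cube I)"
    unfolding cube_def compactin_PiE by (auto simp: compactin_euclidean_iff)
  then show ?thesis by (simp add: euclidean_product_topology compactin_euclidean_iff)
qed

lemma shrink_in_cube:
  assumes "finite I"
  shows "shrink I X \<in> cube I"
proof -
  have "\<bar>exp (- (\<Sum>u\<in>I. (X u)\<^sup>2)) * X v\<bar> \<le> 1" if "v \<in> I" for v
  proof -
    have "(X v)\<^sup>2 \<le> (\<Sum>u\<in>I. (X u)\<^sup>2)" using assms that by (intro member_le_sum) auto
    moreover have "\<bar>X v\<bar> \<le> 1 + (X v)\<^sup>2"
      using zero_le_square[of "\<bar>X v\<bar> - 1"] by (simp add: power2_eq_square algebra_simps) 
    ultimately have "\<bar>X v\<bar> \<le> exp (\<Sum>u\<in>I. (X u)\<^sup>2)"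
      using exp_ge_add_one_self[of "\<Sum>u\<in>I. (X u)\<^sup>2"] by linarith
    then have "exp (- (\<Sum>u\<in>I. (X u)\<^sup>2)) * \<bar>X v\<bar> \<le> exp (- (\<Sum>u\<in>I. (X u)\<^sup>2)) * exp (\<Sum>u\<in>I. (X u)\<^sup>2)"
      by (intro mult_left_mono) auto
    then show ?thesis by (simp add: abs_mult flip: exp_add)
  qed
  then show ?thesis by (auto simp: cube_def shrink_def abs_le_iff)
qed

text \<open>
  The shrinking map multiplies a monomial of degree \<open>d\<close> by \<open>exp (- d |X|\<^sup>2)\<close>, which is
  again a product over the coordinates.  The resulting factor depends on the degree
  and the number of coordinates only, not on the monomial; so linear relations between moments of
  equal degree are the same as for the Gaussian measure.
\<close>

lemma mean_monomial:
  fixes f :: "'p \<Rightarrow> 'v"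
  assumes I: "finite I" and H: "finite H" and f: "f ` H \<subseteq> I"
  shows "mean I (\<lambda>Y. \<Prod>p\<in>H. Y (f p)) =
    (1 / sqrt (1 + 2 * real (card H))) ^ (card I + card H)
      * (\<Prod>i\<in>I. gauss_moment (card {p\<in>H. f p = i}))"
proof -
  interpret product_sigma_finite "\<lambda>_ :: 'v. std_normal" by (rule product_sigma_finite_std_normal)
  define a where "a i = card {p\<in>H. f p = i}" for i
  let ?d = "real (card H)"
  have sum_a: "(\<Sum>i\<in>I. a i) = card H"
    using sum.group[OF H I f, of "\<lambda>_. 1 :: nat"] by (simp add: a_def)
  have "(\<Prod>p\<in>H. shrink I X (f p)) = (\<Prod>i\<in>I. X i ^ a i * exp (- ?d * (X i)\<^sup>2))" for X
  proof -
    have "(\<Prod>p\<in>H. shrink I X (f p)) = (\<Prod>p\<in>H. exp (- (\<Sum>u\<in>I. (X u)\<^sup>2)) * X (f p))"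
      using f by (intro prod.cong) (auto simp: shrink_def)
    also have "\<dots> = exp (- (\<Sum>u\<in>I. (X u)\<^sup>2)) ^ card H * (\<Prod>p\<in>H. X (f p))"
      by (simp add: prod.distrib)
    also have "(\<Prod>p\<in>H. X (f p)) = (\<Prod>i\<in>I. \<Prod>p\<in>{p\<in>H. f p = i}. X (f p))"
      by (rule prod.group[OF H I f, symmetric])
    also have "\<dots> = (\<Prod>i\<in>I. X i ^ a i)"
      by (simp add: a_def)
    also have "exp (- (\<Sum>u\<in>I. (X u)\<^sup>2)) ^ card H = (\<Prod>i\<in>I. exp (- ?d * (X i)\<^sup>2))"
      using I by (simp add: exp_of_nat_mult[symmetric] exp_sum[symmetric] sum_distrib_left sum_negf)
    finally show ?thesis by (simp add: prod.distrib mult.commute)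
  qed
  then have "mean I (\<lambda>Y. \<Prod>p\<in>H. Y (f p)) = (\<integral>X. (\<Prod>i\<in>I. X i ^ a i * exp (- ?d * (X i)\<^sup>2)) \<partial>gauss I)"
    by (simp add: mean_def)
  also have "\<dots> = (\<Prod>i\<in>I. \<integral>x. x ^ a i * exp (- ?d * x\<^sup>2) \<partial>std_normal)"
    unfolding gauss_def using std_normal_integral_power_exp[of ?d]
    by (intro product_integral_prod I) (auto simp: has_bochner_integral_iff)
  also have "\<dots> = (\<Prod>i\<in>I. (1 / sqrt (1 + 2 * ?d)) ^ Suc (a i) * gauss_moment (a i))"
    using std_normal_integral_power_exp[of ?d] by (intro prod.cong) (auto simp: has_bochner_integral_iff)
  also have "\<dots> = (1 / sqrt (1 + 2 * ?d)) ^ (\<Sum>i\<in>I. Suc (a i)) * (\<Prod>i\<in>I. gauss_moment (a i))"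
    by (simp only: prod.distrib power_sum)
  also have "(\<Sum>i\<in>I. Suc (a i)) = card I + card H"
    using sum_a by (simp only: Suc_eq_plus1 sum.distrib) simp
  finally show ?thesis by (simp add: a_def)
qed


section \<open>Matchings and the formula of Wick\<close>

text \<open>
  A perfect matching is represented by the involution without fixed points which exchanges the two
  elements of each pair; its values outside of \<open>H\<close> are arbitrary.
\<close>

definition matchings :: "'p set \<Rightarrow> ('p \<Rightarrow> 'p) set" where
  "matchings H = {\<pi>. \<forall>p\<in>H. \<pi> p \<in> H \<and> \<pi> p \<noteq> p \<and> \<pi> (\<pi> p) = p}"

definition pair_constant :: "'p set \<Rightarrow> ('p \<Rightarrow> 'p) \<Rightarrow> ('p \<Rightarrow> 'v) \<Rightarrow> bool" where
  "pair_constant H \<pi> f \<longleftrightarrow> (\<forall>p\<in>H. f (\<pi> p) = f p)"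

lemma pair_constant_insert_pair:
  assumes q: "q \<noteq> p" "p \<in> H" "q \<in> H"
  shows "pair_constant H (\<pi>(p := q, q := p)) f \<longleftrightarrow> f q = f p \<and> pair_constant (H - {p, q}) \<pi> f"
  using assms by (auto simp: pair_constant_def)

lemma matching_extend:
  assumes "q \<noteq> p" "p \<in> H" "q \<in> H" "\<pi> \<in> matchings (H - {p, q})"
  shows "\<pi>(p := q, q := p) \<in> matchings H"
  using assms by (auto simp: matchings_def)

text \<open>
  The element \<open>p\<close> is paired with each other element \<open>q\<close> of the same color.  If its color class has
  \<open>a\<close> elements, there are \<open>a - 1\<close> choices, and each leaves a class with \<open>a - 2\<close> elements, as in
  the recursion for the moments.
\<close>

lemma moment_recursion:
  fixes f :: "'p \<Rightarrow> 'v"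
  assumes I: "finite I" and H: "finite H" and f: "f ` H \<subseteq> I" and p: "p \<in> H"
  shows "(\<Prod>i\<in>I. gauss_moment (card {r\<in>H. f r = i})) = (\<Sum>q\<in>H - {p}.
    of_bool (f q = f p) * (\<Prod>i\<in>I. gauss_moment (card {r\<in>H - {p, q}. f r = i})))"
proof -
  let ?c = "f p"
  have c: "?c \<in> I" using f p by auto
  define Q where "Q = {q\<in>H - {p}. f q = ?c}"
  define rest where "rest = (\<Prod>i\<in>I - {?c}. gauss_moment (card {r\<in>H. f r = i}))"
  have finQ: "finite Q" using H by (simp add: Q_def)
  have cls: "{r\<in>H. f r = ?c} = insert p Q" using p by (auto simp: Q_def)
  have cardc: "card {r\<in>H. f r = ?c} = Suc (card Q)"
    unfolding cls using finQ by (subst card_insert_disjoint) (auto simp: Q_def)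
  have q: "(\<Prod>i\<in>I. gauss_moment (card {r\<in>H - {p, q}. f r = i})) = gauss_moment (card Q - 1) * rest"
    if "q \<in> Q" for q
  proof -
    have "{r\<in>H - {p, q}. f r = i} = {r\<in>H. f r = i}" if "i \<noteq> ?c" for i
      using that \<open>q \<in> Q\<close> by (auto simp: Q_def)
    moreover have "{r\<in>H - {p, q}. f r = ?c} = Q - {q}" by (auto simp: Q_def)
    ultimately show ?thesis
      using that finQ by (subst prod.remove[OF I c]) (simp add: rest_def)
  qed
  have "(\<Sum>q\<in>H - {p}. of_bool (f q = f p) * (\<Prod>i\<in>I. gauss_moment (card {r\<in>H - {p, q}. f r = i})))
      = (\<Sum>q\<in>Q. \<Prod>i\<in>I. gauss_moment (card {r\<in>H - {p, q}. f r = i}))"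
    using H by (intro sum.mono_neutral_cong_right) (auto simp: Q_def)
  also have "\<dots> = real (card Q) * (gauss_moment (card Q - 1) * rest)"
    by (subst sum.cong[OF refl q]) simp_all
  also have "real (card Q) * gauss_moment (card Q - 1) = gauss_moment (Suc (card Q))"
    by (cases "card Q") simp_all
  then have "real (card Q) * (gauss_moment (card Q - 1) * rest) = gauss_moment (Suc (card Q)) * rest"
    by simp
  also have "\<dots> = (\<Prod>i\<in>I. gauss_moment (card {r\<in>H. f r = i}))"
    using prod.remove[OF I c, of "\<lambda>i. gauss_moment (card {r\<in>H. f r = i})"]
    by (simp add: rest_def cardc)
  finally show ?thesis by simp
qed

text \<open>
  Removing some \<open>p\<close> together with its partner \<open>q\<close> reduces the formula to smaller sets, by
  \<open>moment_recursion\<close>.  One list of matchings serves all colorings \<open>f\<close> at once, which is what allows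
  the sum to be interchanged with a contraction.
\<close>

lemma wick:
  fixes H :: "'p set" and I :: "'v set"
  assumes I: "finite I" and H: "finite H"
  shows "\<exists>\<pi>s. set \<pi>s \<subseteq> matchings H \<and> (\<forall>f. f ` H \<subseteq> I \<longrightarrow>
    (\<Prod>i\<in>I. gauss_moment (card {p\<in>H. f p = i})) = (\<Sum>\<pi>\<leftarrow>\<pi>s. of_bool (pair_constant H \<pi> f)))"
  using H
proof (induction "card H" arbitrary: H rule: less_induct)
  case less
  show ?case
  proof (cases "H = {}")
    case True
    then show ?thesis
      by (intro exI[of _ "[id]"]) (simp add: matchings_def pair_constant_def)
  next
    case False
    then obtain p where p: "p \<in> H" by blast
    let ?Q = "H - {p}"
    have "\<forall>q\<in>?Q. \<exists>\<pi>s. set \<pi>s \<subseteq> matchings (H - {p, q}) \<and> (\<forall>f. f ` (H - {p, q}) \<subseteq> I \<longrightarrow>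
      (\<Prod>i\<in>I. gauss_moment (card {r\<in>H - {p, q}. f r = i})) = (\<Sum>\<pi>\<leftarrow>\<pi>s. of_bool (pair_constant (H - {p, q}) \<pi> f)))"
      using less p by (intro ballI less.hyps psubset_card_mono) auto
    then obtain S where S': "\<forall>q\<in>?Q. set (S q) \<subseteq> matchings (H - {p, q}) \<and> (\<forall>f. f ` (H - {p, q}) \<subseteq> I \<longrightarrow>
      (\<Prod>i\<in>I. gauss_moment (card {r\<in>H - {p, q}. f r = i})) = (\<Sum>\<pi>\<leftarrow>S q. of_bool (pair_constant (H - {p, q}) \<pi> f)))"
      unfolding bchoice_iff ..
    have S: "\<And>q. q \<in> ?Q \<Longrightarrow> set (S q) \<subseteq> matchings (H - {p, q})"
      "\<And>q f. q \<in> ?Q \<Longrightarrow> f ` (H - {p, q}) \<subseteq> I \<Longrightarrow>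
        (\<Prod>i\<in>I. gauss_moment (card {r\<in>H - {p, q}. f r = i})) = (\<Sum>\<pi>\<leftarrow>S q. of_bool (pair_constant (H - {p, q}) \<pi> f))"
      using S' by blast+
    obtain qs where qs: "set qs = ?Q" "distinct qs"
      using less.prems finite_distinct_list[of ?Q] by auto
    \<comment> \<open>Each matching pairs \<open>p\<close> with some \<open>q\<close> and restricts to a matching of the other elements.\<close>
    let ?\<pi>s = "concat (map (\<lambda>q. map (\<lambda>\<pi>. \<pi>(p := q, q := p)) (S q)) qs)"
    have "set ?\<pi>s \<subseteq> matchings H"
      using qs(1) S(1) p by (auto intro!: matching_extend)
    moreover have "(\<Prod>i\<in>I. gauss_moment (card {r\<in>H. f r = i})) = (\<Sum>\<pi>\<leftarrow>?\<pi>s. of_bool (pair_constant H \<pi> f))"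
      if f: "f ` H \<subseteq> I" for f
    proof -
      have "(\<Prod>i\<in>I. gauss_moment (card {r\<in>H. f r = i})) =
        (\<Sum>q\<in>?Q. of_bool (f q = f p) * (\<Sum>\<pi>\<leftarrow>S q. of_bool (pair_constant (H - {p, q}) \<pi> f)))"
        unfolding moment_recursion[OF I less.prems f p]
        using f by (intro sum.cong refl arg_cong2[where f = "(*)"] S(2)) auto
      also have "\<dots> = (\<Sum>q\<in>?Q. \<Sum>\<pi>\<leftarrow>S q. of_bool (pair_constant H (\<pi>(p := q, q := p)) f))"
      proof (rule sum.cong[OF refl])
        fix q assume q: "q \<in> ?Q"
        show "of_bool (f q = f p) * (\<Sum>\<pi>\<leftarrow>S q. of_bool (pair_constant (H - {p, q}) \<pi> f))
          = (\<Sum>\<pi>\<leftarrow>S q. of_bool (pair_constant H (\<pi>(p := q, q := p)) f) :: real)"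
          using q p by (simp add: pair_constant_insert_pair[of q p H] sum_list_const_mult[symmetric] of_bool_conj
            del: fun_upd_apply)
      qed
      also have "\<dots> = (\<Sum>q\<leftarrow>qs. \<Sum>\<pi>\<leftarrow>S q. of_bool (pair_constant H (\<pi>(p := q, q := p)) f))"
        using qs by (simp add: sum_list_distinct_conv_sum_set)
      also have "\<dots> = (\<Sum>\<pi>\<leftarrow>?\<pi>s. of_bool (pair_constant H \<pi> f))"
        by (induction qs) (simp_all add: o_def)
      finally show ?thesis .
    qed
    ultimately show ?thesis by blast
  qed
qed


section \<open>Algebras of functions and uniform approximation\<close>

inductive_set function_algebra :: "('x \<Rightarrow> real) set \<Rightarrow> ('x \<Rightarrow> real) set" for G where
  gen: "g \<in> G \<Longrightarrow> g \<in> function_algebra G"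
| const: "(\<lambda>_. c) \<in> function_algebra G"
| add: "f \<in> function_algebra G \<Longrightarrow> g \<in> function_algebra G \<Longrightarrow> (\<lambda>x. f x + g x) \<in> function_algebra G"
| mult: "f \<in> function_algebra G \<Longrightarrow> g \<in> function_algebra G \<Longrightarrow> (\<lambda>x. f x * g x) \<in> function_algebra G"

lemma function_algebra_mono:
  assumes "f \<in> function_algebra G" "G \<subseteq> function_algebra G'"
  shows "f \<in> function_algebra G'"
  using assms(1) by induction (use assms(2) in \<open>auto intro: function_algebra.intros\<close>)

lemma function_algebra_sum:
  "(\<And>a. a \<in> A \<Longrightarrow> f a \<in> function_algebra G) \<Longrightarrow> (\<lambda>x. \<Sum>a\<in>A. f a x) \<in> function_algebra G"
  by (induction A rule: infinite_finite_induct) (auto intro: function_algebra.intros)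

lemma function_algebra_prod:
  "(\<And>a. a \<in> A \<Longrightarrow> f a \<in> function_algebra G) \<Longrightarrow> (\<lambda>x. \<Prod>a\<in>A. f a x) \<in> function_algebra G"
  by (induction A rule: infinite_finite_induct) (auto intro: function_algebra.intros)

lemma function_algebra_prod_list:
  "(\<And>a. a \<in> set as \<Longrightarrow> f a \<in> function_algebra G) \<Longrightarrow> (\<lambda>x. \<Prod>a\<leftarrow>as. f a x) \<in> function_algebra G"
  by (induction as) (auto intro: function_algebra.intros)

lemma continuous_on_function_algebra:
  fixes f :: "'x::topological_space \<Rightarrow> real"
  assumes "f \<in> function_algebra G" "\<And>g. g \<in> G \<Longrightarrow> continuous_on K g"
  shows "continuous_on K f"
  using assms(1) by induction (auto intro: continuous_intros assms(2))

text \<open>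
  The Stone-Weierstrass theorem for generators that do not separate points: a continuous function
  which is constant on their common fibres is approximated by the algebra they
  generate.  It is the usual theorem on the compact image of \<open>K\<close> under the map whose
  coordinates are the generators; an enumeration of them makes this a map to real sequences.
\<close>

theorem Stone_Weierstrass_fibres:
  fixes F :: "'x::topological_space \<Rightarrow> real"
  assumes K: "compact K" and "countable G" and G: "\<And>g. g \<in> G \<Longrightarrow> continuous_on K g" and F: "continuous_on K F"
    and fibres: "\<And>x y. x \<in> K \<Longrightarrow> y \<in> K \<Longrightarrow> (\<And>g. g \<in> G \<Longrightarrow> g x = g y) \<Longrightarrow> F x = F y"
    and \<epsilon>: "\<epsilon> > 0"
  shows "\<exists>b\<in>function_algebra G. \<forall>x\<in>K. \<bar>F x - b x\<bar> < \<epsilon>"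
proof -
  \<comment> \<open>The zero function is added because an enumeration needs a nonempty set.\<close>
  define g where "g = from_nat_into (insert (\<lambda>_. 0) G)"
  have range_g: "range g = insert (\<lambda>_. 0) G"
    unfolding g_def using \<open>countable G\<close> by (intro range_from_nat_into) auto
  define \<Psi> where "\<Psi> x = (\<lambda>i. g i x)" for x :: 'x
  have g: "g i = (\<lambda>_. 0) \<or> g i \<in> G" for i
    using range_g by (metis insertE rangeI)
  have \<Psi>: "continuous_on K \<Psi>"
  proof (rule continuous_on_coordinatewise_then_product)
    fix i show "continuous_on K (\<lambda>x. \<Psi> x i)"
      using g[of i] G by (auto simp: \<Psi>_def)
  qed
  let ?P = "function_algebra {\<lambda>y. y i | i. True} :: ((nat \<Rightarrow> real) \<Rightarrow> real) set"
  have pcont: "continuous_on UNIV p" if "p \<in> ?P" for p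
    using that by (rule continuous_on_function_algebra) auto
  have img: "compact (\<Psi> ` K)" using \<Psi> K by (rule compact_continuous_image)
  define F' where "F' y = F (SOME x. x \<in> K \<and> \<Psi> x = y)" for y
  have F': "F' (\<Psi> x) = F x" if "x \<in> K" for x
  proof -
    have "(SOME x'. x' \<in> K \<and> \<Psi> x' = \<Psi> x) \<in> K \<and> \<Psi> (SOME x'. x' \<in> K \<and> \<Psi> x' = \<Psi> x) = \<Psi> x"
      by (rule someI[of _ x]) (use that in simp)
    moreover have "h x' = h x" if "\<Psi> x' = \<Psi> x" "h \<in> G" for h x'
    proof -
      obtain i where "h = g i" using range_g \<open>h \<in> G\<close> by (metis insertCI rangeE)
      then show ?thesis using that(1) by (simp add: \<Psi>_def fun_eq_iff)
    qed
    ultimately show ?thesis unfolding F'_def using that by (intro fibres) auto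
  qed
  have "continuous_on (\<Psi> ` K) F'"
    unfolding continuous_on_closed_vimage[OF compact_imp_closed[OF img]]
  proof (intro allI impI)
    fix B :: "real set" assume B: "closed B"
    have "F' -` B \<inter> \<Psi> ` K = \<Psi> ` (F -` B \<inter> K)" using F' by auto
    moreover have "compact (F -` B \<inter> K)"
    proof -
      obtain T where T: "closed T" "T \<inter> K = F -` B \<inter> K"
        using F B unfolding continuous_on_closed_invariant by blast
      then show ?thesis using K by (metis closed_Int_compact)
    qed
    then have "compact (\<Psi> ` (F -` B \<inter> K))"
      using \<Psi> by (intro compact_continuous_image) (auto intro: continuous_on_subset)
    ultimately show "closed (F' -` B \<inter> \<Psi> ` K)" by (simp add: compact_imp_closed)
  qed
  interpret function_ring_on ?P "\<Psi> ` K"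
  proof
    fix x y :: "nat \<Rightarrow> real" assume "x \<noteq> y"
    then obtain i where "x i \<noteq> y i" by (auto simp: fun_eq_iff)
    then show "\<exists>f\<in>?P. f x \<noteq> f y"
      by (intro bexI[of _ "\<lambda>y. y i"]) (auto intro: function_algebra.gen)
  qed (auto intro: function_algebra.intros img continuous_on_subset[OF pcont])
  obtain p where p: "p \<in> ?P" "\<forall>y\<in>\<Psi> ` K. \<bar>F' y - p y\<bar> < \<epsilon>"
    using Stone_Weierstrass_basic[OF \<open>continuous_on (\<Psi> ` K) F'\<close> \<epsilon>] by blast
  have "(\<lambda>x. p (\<Psi> x)) \<in> function_algebra G"
    using p(1)
  proof induction
    case (gen q)
    then obtain i where "q = (\<lambda>y. y i)" by auto
    then have "(\<lambda>x. q (\<Psi> x)) = g i" by (simp add: \<Psi>_def)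
    then show ?case
      using g[of i] by (auto intro: function_algebra.gen function_algebra.const)
  qed (auto intro: function_algebra.intros)
  then show ?thesis using p(2) F' by (intro bexI[of _ "\<lambda>x. p (\<Psi> x)"]) auto
qed


section \<open>Polynomial functions orthogonal to an algebra\<close>

abbreviation polyfuns :: "'v set \<Rightarrow> (('v \<Rightarrow> real) \<Rightarrow> real) set" where
  "polyfuns I \<equiv> function_algebra {\<lambda>X. X v | v. v \<in> I}"

lemma continuous_polyfun: "f \<in> polyfuns I \<Longrightarrow> continuous_on S f"
  by (erule continuous_on_function_algebra) (auto intro: continuous_on_subset[OF continuous_on_product_coordinates])

lemma measurable_polyfun_shrink:
  assumes f: "f \<in> polyfuns I"
  shows "(\<lambda>X. f (shrink I X)) \<in> borel_measurable (gauss I)"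
  using f
proof induction
  case (gen g)
  then obtain v where v: "v \<in> I" "g = (\<lambda>X. X v)" by auto
  have "(\<lambda>X. X u) \<in> borel_measurable (gauss I)" if "u \<in> I" for u
    unfolding gauss_def using measurable_component_singleton[OF that, of "\<lambda>_. std_normal"] by simp
  then show ?case unfolding v(2) shrink_def using v(1) by simp
qed (auto intro: borel_measurable_add borel_measurable_times)

lemma polyfun_bounded_on_cube:
  assumes "f \<in> polyfuns I"
  obtains B where "\<And>Y. Y \<in> cube I \<Longrightarrow> \<bar>f Y\<bar> \<le> B"
proof -
  have "bounded (f ` cube I)"
    using compact_continuous_image[OF continuous_polyfun[OF assms] compact_cube] by (rule compact_imp_bounded)
  then show ?thesis using that by (auto simp: bounded_iff)
qed

lemma integrable_polyfun:
  assumes "finite I" "f \<in> polyfuns I"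
  shows "integrable (gauss I) (\<lambda>X. f (shrink I X))"
proof -
  interpret prob_space "gauss I" by (rule prob_space_gauss)
  obtain B where "\<And>Y. Y \<in> cube I \<Longrightarrow> \<bar>f Y\<bar> \<le> B" using polyfun_bounded_on_cube[OF assms(2)] by blast
  then show ?thesis
    using shrink_in_cube[OF assms(1)] measurable_polyfun_shrink[OF assms(2)]
    by (intro integrable_const_bound[where B = B]) auto
qed

lemma mean_bound:
  assumes "finite I" "f \<in> polyfuns I" "\<And>Y. Y \<in> cube I \<Longrightarrow> f Y \<le> B"
  shows "mean I f \<le> B"
proof -
  interpret prob_space "gauss I" by (rule prob_space_gauss)
  show ?thesis unfolding mean_def
    using integrable_polyfun[OF assms(1,2)] assms(3) shrink_in_cube[OF assms(1)]
    by (intro integral_le_const) auto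
qed

lemma mean_add:
  assumes "finite I" "f \<in> polyfuns I" "g \<in> polyfuns I"
  shows "mean I (\<lambda>Y. f Y + g Y) = mean I f + mean I g"
  unfolding mean_def using assms by (simp add: integrable_polyfun)

lemma mean_scale: "mean I (\<lambda>Y. c * f Y) = c * mean I f"
  unfolding mean_def by simp

lemma mean_sum:
  assumes "finite I" "\<And>a. a \<in> A \<Longrightarrow> f a \<in> polyfuns I"
  shows "mean I (\<lambda>Y. \<Sum>a\<in>A. f a Y) = (\<Sum>a\<in>A. mean I (f a))"
  unfolding mean_def using assms by (intro Bochner_Integration.integral_sum integrable_polyfun) auto

text \<open>
  The Gaussian measure has full support, which is used to see that a continuous function with zero
  mean square vanishes everywhere and not just almost everywhere.
\<close>

lemma emeasure_std_normal_open_pos: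
  assumes "open U" "U \<noteq> {}"
  shows "emeasure std_normal U > 0"
proof -
  have "U \<notin> null_sets lborel"
    using open_not_negligible[OF assms] null_sets_completionI[of U lborel]
    by (auto simp: negligible_iff_null_sets)
  moreover have "normal_density 0 1 x \<noteq> 0" for x :: real
    using normal_density_pos[of 1 0 x] by simp
  ultimately have "U \<notin> null_sets std_normal"
    using AE_iff_null_sets[of U lborel] assms(1) by (simp add: null_sets_density_iff)
  then show ?thesis
    using assms(1) by (auto simp: null_sets_def zero_less_iff_neq_zero)
qed

lemma mean_square_zero:
  assumes I: "finite I" and f: "f \<in> polyfuns I" and zero: "mean I (\<lambda>Y. f Y * f Y) = 0"
  shows "f (shrink I X) = 0"
proof (rule ccontr)
  assume nz: "f (shrink I X) \<noteq> 0"
  let ?g = "\<lambda>X. f (shrink I X)"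
  have cont: "continuous_on UNIV ?g"
  proof (rule continuous_on_compose2[OF continuous_polyfun[OF f, of UNIV]])
    show "continuous_on UNIV (shrink I :: ('a \<Rightarrow> real) \<Rightarrow> 'a \<Rightarrow> real)"
    proof (rule continuous_on_coordinatewise_then_product)
      fix i show "continuous_on UNIV (\<lambda>X :: 'a \<Rightarrow> real. shrink I X i)"
      proof (cases "i \<in> I")
        case True
        have coord: "continuous_on UNIV (\<lambda>X :: 'a \<Rightarrow> real. X u)" for u
          by (rule continuous_on_product_coordinates)
        have "continuous_on UNIV (\<lambda>X :: 'a \<Rightarrow> real. \<Sum>u\<in>I. (X u)\<^sup>2)"
          using continuous_on_power[OF coord] by (rule continuous_on_sum)
        from continuous_on_mult[OF continuous_on_exp[OF continuous_on_minus[OF this]] coord]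
        show ?thesis using True by (simp add: shrink_def)
      qed (simp add: shrink_def)
    qed
  qed simp
  let ?U = "{Z. ?g Z \<noteq> 0}"
  have "open ?U"
    using open_Collect_neq[OF cont continuous_on_const[of _ 0]] by simp
  then obtain B where B: "X \<in> Pi\<^sub>E UNIV B" "\<And>i. open (B i)" "Pi\<^sub>E UNIV B \<subseteq> ?U"
    using product_topology_open_contains_basis[of "\<lambda>_. euclidean" UNIV ?U X] nz
    by (simp add: open_fun_def flip: open_openin) blast
  interpret product_sigma_finite "\<lambda>_ :: 'a. std_normal" by (rule product_sigma_finite_std_normal)
  have "AE Z in gauss I. ?g Z * ?g Z = 0"
  proof -
    have "integrable (gauss I) (\<lambda>X. ?g X * ?g X)"
      using integrable_polyfun[OF I function_algebra.mult[OF f f]] .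
    then show ?thesis
      using zero integral_nonneg_eq_0_iff_AE[of "gauss I" "\<lambda>X. ?g X * ?g X"] by (simp add: mean_def)
  qed
  then have "AE Z in gauss I. \<not> Z \<in> Pi\<^sub>E I B"
  proof (rule AE_mp, intro AE_I2 impI notI)
    fix Z assume Z: "?g Z * ?g Z = 0" "Z \<in> Pi\<^sub>E I B"
    \<comment> \<open>Points of the product measure space are undefined outside of \<open>I\<close>; filling in the values of
      \<open>X\<close> gives a point of the open box without changing the value of the function.\<close>
    define Z' where "Z' = (\<lambda>i. if i \<in> I then Z i else X i)"
    have "Z' \<in> Pi\<^sub>E UNIV B" using B(1) Z(2) by (auto simp: Z'_def PiE_iff)
    then have "?g Z' \<noteq> 0" using B(3) by auto
    moreover have "shrink I Z' = shrink I Z" by (auto simp: shrink_def Z'_def cong: sum.cong)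
    ultimately show False using Z(1) by simp
  qed
  moreover have meas: "Pi\<^sub>E I B \<in> sets (gauss I)"
    unfolding gauss_def using B(2) I by (intro sets_PiM_I_finite) auto
  ultimately have "emeasure (gauss I) (Pi\<^sub>E I B) = 0"
    using AE_iff_measurable[OF meas, of "\<lambda>Z. \<not> Z \<in> Pi\<^sub>E I B"] sets.sets_into_space[OF meas]
    by (auto simp: Collect_conj_eq Int_absorb1 conj_commute)
  moreover have "emeasure (gauss I) (Pi\<^sub>E I B) = (\<Prod>i\<in>I. emeasure std_normal (B i))"
    unfolding gauss_def using B(2) I by (intro emeasure_PiM) auto
  ultimately obtain i where "i \<in> I" "emeasure std_normal (B i) = 0"
    using I by (auto simp: prod_zero_iff)
  then show False
    using emeasure_std_normal_open_pos[OF B(2), of i] B(1) by fastforce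
qed

text \<open>
  If \<open>b\<close> from the algebra approximates \<open>F\<close> uniformly, then the mean of \<open>F\<^sup>2\<close> equals the mean of
  \<open>F (F - b)\<close> by orthogonality, which is as small as the approximation is good.
\<close>

theorem orthogonal_polyfun_vanishes:
  assumes I: "finite I" and G: "G \<subseteq> polyfuns I" and "countable G" and F: "F \<in> polyfuns I"
    and fibres: "\<And>X Y. (\<And>g. g \<in> G \<Longrightarrow> g X = g Y) \<Longrightarrow> F X = F Y"
    and orth: "\<And>b. b \<in> function_algebra G \<Longrightarrow> mean I (\<lambda>Y. F Y * b Y) = 0"
  shows "F (shrink I X) = 0"
proof (rule mean_square_zero[OF I F])
  obtain B where B: "\<And>Y. Y \<in> cube I \<Longrightarrow> \<bar>F Y\<bar> \<le> B" using polyfun_bounded_on_cube[OF F] by blast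
  have "B \<ge> 0" using B[OF shrink_in_cube[OF I]] abs_ge_zero order_trans by blast
  have "mean I (\<lambda>Y. F Y * F Y) \<le> 0 + \<epsilon>" if \<epsilon>: "\<epsilon> > 0" for \<epsilon>
  proof -
    \<comment> \<open>The summand 1 avoids a division by zero, since the bound \<open>B\<close> of \<open>|F|\<close> may be 0.\<close>
    let ?\<delta> = "\<epsilon> / (B + 1)"
    have "?\<delta> > 0" using \<epsilon> \<open>B \<ge> 0\<close> by simp
    then have "\<exists>b\<in>function_algebra G. \<forall>Y\<in>cube I. \<bar>F Y - b Y\<bar> < ?\<delta>"
      using G F fibres
      by (intro Stone_Weierstrass_fibres[OF compact_cube \<open>countable G\<close>] continuous_polyfun) blast+
    then obtain b where b: "b \<in> function_algebra G" "\<forall>Y\<in>cube I. \<bar>F Y - b Y\<bar> < ?\<delta>" by blast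
    have bI: "b \<in> polyfuns I" using function_algebra_mono[OF b(1) G] .
    have diff: "(\<lambda>Y. F Y * (F Y + (- 1) * b Y)) \<in> polyfuns I"
      by (intro function_algebra.intros F bI)
    have "mean I (\<lambda>Y. F Y * F Y)
        = mean I (\<lambda>Y. F Y * (F Y + (- 1) * b Y) + F Y * b Y)" by (simp add: algebra_simps)
    also have "\<dots> = mean I (\<lambda>Y. F Y * (F Y + (- 1) * b Y)) + mean I (\<lambda>Y. F Y * b Y)"
      by (rule mean_add[OF I diff function_algebra.mult[OF F bI]])
    also have "\<dots> \<le> B * ?\<delta> + 0"
    proof (intro add_mono mean_bound[OF I diff])
      fix Y assume Y: "Y \<in> cube I"
      have "F Y * (F Y + (- 1) * b Y) \<le> \<bar>F Y\<bar> * \<bar>F Y - b Y\<bar>"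
        by (metis abs_ge_self abs_mult add_uminus_conv_diff mult_minus1)
      also have "\<dots> \<le> B * ?\<delta>"
        using B[OF Y] b(2) Y by (intro mult_mono) (auto intro: less_imp_le order_trans[OF abs_ge_zero])
      finally show "F Y * (F Y + (- 1) * b Y) \<le> B * ?\<delta>" .
    qed (simp add: orth[OF b(1)])
    also have "B * ?\<delta> + 0 \<le> \<epsilon>" using \<epsilon> \<open>B \<ge> 0\<close> by (simp add: field_simps)
    finally show ?thesis by simp
  qed
  then have "mean I (\<lambda>Y. F Y * F Y) \<le> 0" by (rule field_le_epsilon)
  moreover have "mean I (\<lambda>Y. F Y * F Y) \<ge> 0" unfolding mean_def by simp
  ultimately show "mean I (\<lambda>Y. F Y * F Y) = 0" by simp
qed


section \<open>Invariance of the coefficients of a fragment\<close>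

lemma sum_singletons: "finite A \<Longrightarrow> (\<Sum>a\<in>A. {#f a#}) = image_mset f (mset_set A)"
  by (induction A rule: finite_induct) auto

text \<open>
  Distributivity for functions on a set \<open>H\<close> that is partitioned into blocks by \<open>p\<close>: if
  the factor of each block depends on the values within this block only, the sum over all functions
  factorizes.  With half edges as elements, the blocks will be those of vertices.
\<close>

lemma sum_prod_blocks:
  fixes f :: "'a \<Rightarrow> ('h \<Rightarrow> 'c) \<Rightarrow> real"
  assumes A: "finite A" and H: "finite H" and S: "finite S" and p: "\<And>j. j \<in> H \<Longrightarrow> p j \<in> A"
    and local: "\<And>a \<chi> \<chi>'. a \<in> A \<Longrightarrow> (\<And>j. j \<in> H \<Longrightarrow> p j = a \<Longrightarrow> \<chi> j = \<chi>' j) \<Longrightarrow> f a \<chi> = f a \<chi>'"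
  shows "(\<Sum>\<chi>\<in>H \<rightarrow>\<^sub>E S. \<Prod>a\<in>A. f a \<chi>) = (\<Prod>a\<in>A. \<Sum>\<chi>\<in>{j\<in>H. p j = a} \<rightarrow>\<^sub>E S. f a \<chi>)"
proof -
  let ?B = "\<lambda>a. {j\<in>H. p j = a} \<rightarrow>\<^sub>E S"
  have "(\<Prod>a\<in>A. \<Sum>\<chi>\<in>?B a. f a \<chi>) = (\<Sum>g\<in>PiE A ?B. \<Prod>a\<in>A. f a (g a))"
    using H S by (intro prod_sum_PiE A) (auto intro!: finite_PiE)
  also have "\<dots> = (\<Sum>\<chi>\<in>H \<rightarrow>\<^sub>E S. \<Prod>a\<in>A. f a \<chi>)"
  proof (rule sum.reindex_bij_witness[where j = "\<lambda>g. \<lambda>j\<in>H. g (p j) j"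
        and i = "\<lambda>\<chi>. \<lambda>a\<in>A. restrict \<chi> {j\<in>H. p j = a}"])
    fix g assume g: "g \<in> PiE A ?B"
    have ga: "g a \<in> ?B a" if "a \<in> A" for a using g that by (rule PiE_mem)
    show "(\<lambda>a\<in>A. restrict (\<lambda>j\<in>H. g (p j) j) {j\<in>H. p j = a}) = g"
    proof
      fix a
      show "(\<lambda>a\<in>A. restrict (\<lambda>j\<in>H. g (p j) j) {j\<in>H. p j = a}) a = g a"
      proof (cases "a \<in> A")
        case True
        have "restrict (\<lambda>j\<in>H. g (p j) j) {j\<in>H. p j = a} j = g a j" for j
          using PiE_arb[OF ga[OF True], of j] by auto
        then show ?thesis using True by auto
      next
        case False
        then show ?thesis using PiE_arb[OF g] by simp
      qed
    qed
    show "(\<lambda>j\<in>H. g (p j) j) \<in> H \<rightarrow>\<^sub>E S"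
      using PiE_mem[OF ga] p by auto
    show "(\<Prod>a\<in>A. f a (\<lambda>j\<in>H. g (p j) j)) = (\<Prod>a\<in>A. f a (g a))"
      by (intro prod.cong local refl) auto
  next
    fix \<chi> assume \<chi>: "\<chi> \<in> H \<rightarrow>\<^sub>E S"
    show "(\<lambda>j\<in>H. (\<lambda>a\<in>A. restrict \<chi> {j\<in>H. p j = a}) (p j) j) = \<chi>"
    proof
      fix j show "(\<lambda>j\<in>H. (\<lambda>a\<in>A. restrict \<chi> {j\<in>H. p j = a}) (p j) j) j = \<chi> j"
        using p[of j] PiE_arb[OF \<chi>, of j] by (cases "j \<in> H") auto
    qed
    show "(\<lambda>a\<in>A. restrict \<chi> {j\<in>H. p j = a}) \<in> PiE A ?B"
      using \<chi> by (auto simp: PiE_iff extensional_def restrict_def)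
  qed
  finally show ?thesis ..
qed

text \<open>
  Words are colorings of the positions; here the positions are named by the elements of an
  arbitrary finite set, as needed for the half edges at a vertex.
\<close>

lemma sum_words_PiE:
  assumes "distinct xs"
  shows "(\<Sum>v\<in>words n (length xs). f v) = (\<Sum>\<chi>\<in>set xs \<rightarrow>\<^sub>E {..<n}. f (map \<chi> xs))"
proof (rule sum.reindex_bij_witness[where j = "\<lambda>v. restrict (the \<circ> map_of (zip xs v)) (set xs)"
      and i = "\<lambda>\<chi>. map \<chi> xs"])
  fix v assume v: "v \<in> words n (length xs)"
  then have len: "length v = length xs" by (rule length_words)
  have entry: "the (map_of (zip xs v) (xs ! i)) = v ! i" if "i < length xs" for i
    using that len assms by (simp add: map_of_zip_nth)
  show map: "map (restrict (the \<circ> map_of (zip xs v)) (set xs)) xs = v"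
    using len entry by (intro nth_equalityI) auto
  show "restrict (the \<circ> map_of (zip xs v)) (set xs) \<in> set xs \<rightarrow>\<^sub>E {..<n}"
    using entry nth_words[OF v] by (auto simp: in_set_conv_nth)
  show "f (map (restrict (the \<circ> map_of (zip xs v)) (set xs)) xs) = f v"
    by (simp only: map)
next
  fix \<chi> assume \<chi>: "\<chi> \<in> set xs \<rightarrow>\<^sub>E {..<n}"
  show "restrict (the \<circ> map_of (zip xs (map \<chi> xs))) (set xs) = \<chi>"
    using PiE_arb[OF \<chi>] by (auto simp: fun_eq_iff map_of_zip_map)
  show "map \<chi> xs \<in> words n (length xs)" using \<chi> by (auto simp: words_def)
qed

lemma vertex_invariance:
  assumes inv: "\<And>d u. u \<in> words n d \<Longrightarrow> transform n X (vertex_tensor h) u = vertex_tensor h u"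
    and J: "finite J" and c: "\<And>j. j \<in> J \<Longrightarrow> c j < n"
  shows "(\<Sum>\<chi>\<in>J \<rightarrow>\<^sub>E {..<n}. h (exponent_of (image_mset \<chi> (mset_set J))) * (\<Prod>j\<in>J. X (c j, \<chi> j)))
    = h (exponent_of (image_mset c (mset_set J)))"
proof -
  obtain xs where xs: "set xs = J" "distinct xs" using finite_distinct_list[OF J] by blast
  have mset: "mset_set J = mset xs" using xs by (metis mset_set_set)
  have entry: "word_entry X (map c xs) (map \<chi> xs) = (\<Prod>j\<in>J. X (c j, \<chi> j))" for \<chi>
  proof -
    have "word_entry X (map c xs) (map \<chi> xs) = (\<Prod>r<length xs. X (c (xs ! r), \<chi> (xs ! r)))"
      by (simp add: word_entry_def)
    also have "\<dots> = prod_list (map (\<lambda>j. X (c j, \<chi> j)) xs)"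
      by (simp add: prod.list_conv_set_nth lessThan_atLeast0)
    also have "\<dots> = (\<Prod>j\<in>J. X (c j, \<chi> j))"
      using xs by (metis prod.distinct_set_conv_list)
    finally show ?thesis .
  qed
  have "map c xs \<in> words n (length xs)" using c xs by (auto simp: words_def)
  then have "transform n X (vertex_tensor h) (map c xs) = vertex_tensor h (map c xs)" by (rule inv)
  then show ?thesis
    unfolding transform_def length_map sum_words_PiE[OF xs(2)] entry vertex_tensor_def xs(1) mset mset_map .
qed

lemma orthogonal_sums:
  assumes "U \<in> orthogonal_group n" "a < n" "b < n"
  shows "(\<Sum>c<n. entries U (c, a) * entries U (c, b)) = of_bool (a = b)"
    and "(\<Sum>c<n. entries U (a, c) * entries U (b, c)) = of_bool (a = b)"
proof -
  have col: "(\<Sum>c<n. entries U (c, a) * entries U (c, b)) = of_bool (a = b)"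
    if "U \<in> orthogonal_group n" for U
  proof -
    have U: "U \<in> carrier_mat n n" "transpose_mat U * U = 1\<^sub>m n"
      using that by (auto simp: orthogonal_group_def)
    have "(transpose_mat U * U) $$ (a, b) = (\<Sum>c<n. entries U (c, a) * entries U (c, b))"
      using U(1) assms by (simp add: scalar_prod_def entries_def lessThan_atLeast0)
    from this[symmetric] show ?thesis
      using assms(2,3) unfolding U(2) by (simp only: index_one_mat of_bool_def)
  qed
  show "(\<Sum>c<n. entries U (c, a) * entries U (c, b)) = of_bool (a = b)"
    using assms(1) by (rule col)
  have "U \<in> carrier_mat n n" using assms(1) by (simp add: orthogonal_group_def)
  then show "(\<Sum>c<n. entries U (a, c) * entries U (b, c)) = of_bool (a = b)"
    using col[OF transpose_orthogonal_inverse(1)[OF assms(1)]] assms(2,3) by (simp add: entries_def)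
qed

text \<open>
  The two half edges \<open>J\<close> of an edge carry the inner product, which an orthogonal matrix
  preserves; for a circle, \<open>J\<close> is empty and both sides are \<open>n\<close>.
\<close>

lemma edge_invariance:
  assumes U: "U \<in> orthogonal_group n" and J: "finite J" "card J \<in> {0, 2}" and \<chi>: "\<And>j. j \<in> J \<Longrightarrow> \<chi> j < n"
  shows "(\<Sum>c<n. \<Prod>j\<in>J. of_bool (\<chi> j = c)) = (\<Sum>c<n. \<Prod>j\<in>J. entries U (c, \<chi> j))"
proof (cases "J = {}")
  case False
  then obtain a b where ab: "J = {a, b}" "a \<noteq> b" using J by (auto simp: card_2_iff)
  have "(\<Sum>c<n. \<Prod>j\<in>J. of_bool (\<chi> j = c)) = (\<Sum>c<n. if \<chi> a = c then of_bool (\<chi> b = \<chi> a) else (0 :: real))"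
    using ab by (intro sum.cong) auto
  also have "\<dots> = of_bool (\<chi> a = \<chi> b)" using \<chi> ab by simp
  finally show ?thesis using ab \<chi> orthogonal_sums(1)[OF U, of "\<chi> a" "\<chi> b"] by simp
qed simp

text \<open>
  Half edges are triples of an edge, one of its endpoints, and a number which tells apart the
  two half edges of a loop.
\<close>

definition half_edges :: "pre_fragment \<Rightarrow> (nat \<times> nat \<times> nat) set" where
  "half_edges F = (SIGMA e:edges F. SIGMA v:verts F. {..<count (ends F e) v})"

lemma finite_half_edges: "wf_fragment F \<Longrightarrow> finite (half_edges F)"
  unfolding half_edges_def wf_fragment_def by (intro finite_SigmaI) auto

abbreviation half_edges_at :: "pre_fragment \<Rightarrow> nat \<Rightarrow> (nat \<times> nat \<times> nat) set" where
  "half_edges_at F v \<equiv> {j\<in>half_edges F. fst (snd j) = v}"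

abbreviation half_edges_of :: "pre_fragment \<Rightarrow> nat \<Rightarrow> (nat \<times> nat \<times> nat) set" where
  "half_edges_of F e \<equiv> {j\<in>half_edges F. fst j = e}"

lemma inc_edges_half_edges:
  assumes wf: "wf_fragment F" and v: "v \<in> verts F"
  shows "inc_edges F v = image_mset fst (mset_set (half_edges_at F v))"
proof -
  have E: "finite (edges F)" using wf by (simp add: wf_fragment_def)
  have "image_mset fst (mset_set (half_edges_at F v)) = (\<Sum>j\<in>half_edges_at F v. {#fst j#})"
    using finite_half_edges[OF wf] by (intro sum_singletons[symmetric]) simp
  also have "\<dots> = (\<Sum>(e, i)\<in>(SIGMA e:edges F. {..<count (ends F e) v}). {#e#})"
    by (rule sum.reindex_bij_witness[where i = "\<lambda>(e, i). (e, v, i)" and j = "\<lambda>(e, u, i). (e, i)"])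
      (use v in \<open>auto simp: half_edges_def\<close>)
  also have "\<dots> = (\<Sum>e\<in>edges F. \<Sum>i<count (ends F e) v. {#e#})"
    by (rule sum.Sigma[symmetric]) (use E in auto)
  also have "\<dots> = inc_edges F v"
  proof -
    have "(\<Sum>i<m. {#e#}) = replicate_mset m e" for m e :: nat
      by (induction m) auto
    then show ?thesis by (simp add: inc_edges_def)
  qed
  finally show ?thesis ..
qed

lemma card_half_edges_of:
  assumes wf: "wf_fragment F" and e: "e \<in> edges F"
  shows "card (half_edges_of F e) = size (ends F e)"
proof -
  have V: "finite (verts F)" "set_mset (ends F e) \<subseteq> verts F" using wf e by (auto simp: wf_fragment_def)
  have "half_edges_of F e = Pair e ` (SIGMA v:verts F. {..<count (ends F e) v})"
    using e by (auto simp: half_edges_def)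
  then have "card (half_edges_of F e) = (\<Sum>v\<in>verts F. count (ends F e) v)"
    using V(1) by (simp add: card_image inj_on_def)
  also have "\<dots> = size (ends F e)"
    unfolding size_multiset_overloaded_eq using V by (intro sum.mono_neutral_right) (auto simp: not_in_iff)
  finally show ?thesis .
qed

text \<open>
  Contracting the open ends with \<open>U\<close> attaches a factor of \<open>U\<close> to every open end.  Writing each
  edge as the inner product of its two half edges and using the invariance of the
  inner product attaches a factor of \<open>U\<close> to every half edge.  Regrouped by vertices, these factors
  are absorbed by the vertex tensors at inner vertices, and at the open ends they cancel
  against the factors put there at first.
\<close>

theorem pre_h_coeff_invariant:
  assumes wf: "wf_fragment F" and U: "U \<in> Stab n h" and w: "w \<in> words n (length (opens F))"
  shows "transform n (entries U) (\<lambda>u. pre_h_coeff n h u F) w = pre_h_coeff n h w F"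
proof -
  let ?E = "edges F" and ?V = "verts F" and ?H = "half_edges F" and ?k = "length (opens F)"
  let ?X = "entries U"
  let ?val = "\<lambda>\<chi> v. h (exponent_of (image_mset \<chi> (mset_set (half_edges_at F v))))"
  have inv: "transform n ?X (vertex_tensor h) u = vertex_tensor h u" if "u \<in> words n d" for u d
    using U that by (auto simp: Stab_iff)
  have orth: "U \<in> orthogonal_group n" using U by (simp add: Stab_iff)
  have V: "finite ?V" and E: "finite ?E" and opens: "set (opens F) \<subseteq> ?V" "distinct (opens F)"
    using wf by (auto simp: wf_fragment_def)
  have H: "finite ?H" using wf by (rule finite_half_edges)
  have half: "fst j \<in> ?E" "fst (snd j) \<in> ?V" if "j \<in> ?H" for j
    using that by (auto simp: half_edges_def)
  have open_vert: "opens F ! i \<in> ?V" if "i < ?k" for i using that opens by auto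
  have "\<exists>s. half_edges_at F (opens F ! i) = {s}" if "i < ?k" for i
  proof -
    have "size (inc_edges F (opens F ! i)) = 1" using wf that by (auto simp: wf_fragment_def)
    then have "card (half_edges_at F (opens F ! i)) = 1"
      by (simp add: inc_edges_half_edges[OF wf open_vert[OF that]])
    then show ?thesis by (simp add: card_1_singleton_iff)
  qed
  then have "\<forall>i\<in>{..<?k}. \<exists>s. half_edges_at F (opens F ! i) = {s}" by blast
  then obtain s where "\<forall>i\<in>{..<?k}. half_edges_at F (opens F ! i) = {s i}"
    unfolding bchoice_iff ..
  then have s: "half_edges_at F (opens F ! i) = {s i}" if "i < ?k" for i using that by blast
  have sH: "s i \<in> ?H" if "i < ?k" for i using s[OF that] by blast
  have open_edge: "opens F ! i \<in># ends F e \<longleftrightarrow> e = fst (s i)" if "i < ?k" "e \<in> ?E" for i e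
  proof -
    have "opens F ! i \<in># ends F e \<longleftrightarrow> (e, opens F ! i, 0) \<in> half_edges_at F (opens F ! i)"
      using that open_vert by (auto simp: half_edges_def)
    moreover have "opens F ! i \<in># ends F (fst (s i))"
    proof -
      obtain a b c where abc: "s i = (a, b, c)" by (cases "s i")
      have "s i \<in> half_edges_at F (opens F ! i)" using s[OF that(1)] by simp
      then show ?thesis
        unfolding abc half_edges_def by (auto intro: count_inI)
    qed
    ultimately show ?thesis using s[OF that(1)] by (metis fst_conv singletonD)
  qed
  have coeff: "pre_h_coeff n h u F = (\<Sum>\<psi>\<in>?E \<rightarrow>\<^sub>E {..<n}.
      of_bool (\<forall>i<?k. u ! i = \<psi> (fst (s i))) * (\<Prod>v\<in>inner_verts F. ?val (\<psi> \<circ> fst) v))" for u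
  proof -
    have "edge_colorings n F u = {\<psi> \<in> ?E \<rightarrow>\<^sub>E {..<n}. \<forall>i<?k. u ! i = \<psi> (fst (s i))}"
      unfolding edge_colorings_def using open_edge half(1)[OF sH] by auto
    moreover have "h (exponent_of (image_mset \<psi> (inc_edges F v))) = ?val (\<psi> \<circ> fst) v"
      if "v \<in> inner_verts F" for v \<psi>
      using that by (simp add: inner_verts_def inc_edges_half_edges[OF wf] multiset.map_comp)
    ultimately show ?thesis
      unfolding pre_h_coeff_def using E
      by (intro sum.mono_neutral_cong_left) (auto intro!: finite_PiE)
  qed
  define idx where "idx = inv_into {..<?k} ((!) (opens F))"
  have idx: "idx (opens F ! i) = i" if "i < ?k" for i
    unfolding idx_def using opens(2) that by (intro inv_into_f_f) (auto simp: inj_on_def nth_eq_iff_index_eq)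
  define B where "B v \<chi> = (if v \<in> inner_verts F then ?val \<chi> v
    else (\<Prod>j\<in>half_edges_at F v. ?X (w ! idx v, \<chi> j)))" for v \<chi>
  have prod_V: "(\<Prod>v\<in>?V. g v) = (\<Prod>v\<in>inner_verts F. g v) * (\<Prod>i<?k. g (opens F ! i))" for g :: "nat \<Rightarrow> real"
  proof -
    have "(\<Prod>v\<in>?V. g v) = (\<Prod>v\<in>inner_verts F. g v) * (\<Prod>v\<in>set (opens F). g v)"
      unfolding inner_verts_def using V opens(1) by (intro prod.subset_diff)
    also have "(\<Prod>v\<in>set (opens F). g v) = (\<Prod>i<?k. g (opens F ! i))"
      using opens(2) by (simp add: prod.distinct_set_conv_list prod.list_conv_set_nth lessThan_atLeast0)
    finally show ?thesis .
  qed
  have not_inner: "opens F ! i \<notin> inner_verts F" if "i < ?k" for i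
    using that by (simp add: inner_verts_def)
  have prod_B: "(\<Prod>v\<in>?V. B v \<chi>) = (\<Prod>v\<in>inner_verts F. ?val \<chi> v) * (\<Prod>i<?k. ?X (w ! i, \<chi> (s i)))" for \<chi>
    unfolding prod_V by (intro arg_cong2[where f = "(*)"] prod.cong refl) (simp_all add: B_def not_inner s idx)
  have B_local: "B v \<chi> = B v \<chi>'" if "\<And>j. j \<in> half_edges_at F v \<Longrightarrow> \<chi> j = \<chi>' j" for v \<chi> \<chi>'
  proof -
    have "image_mset \<chi> (mset_set (half_edges_at F v)) = image_mset \<chi>' (mset_set (half_edges_at F v))"
      using H that by (intro image_mset_cong) simp
    then show ?thesis unfolding B_def using that by (auto intro!: prod.cong)
  qed
  \<comment> \<open>The colors of the open ends are determined by the coloring of the edges, so the contraction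
    with \<open>U\<close> puts one entry of \<open>U\<close> at each open end.\<close>
  have "transform n ?X (\<lambda>u. pre_h_coeff n h u F) w
      = (\<Sum>\<psi>\<in>?E \<rightarrow>\<^sub>E {..<n}. \<Sum>u\<in>words n ?k. of_bool (\<forall>i<?k. u ! i = \<psi> (fst (s i)))
          * (\<Prod>v\<in>inner_verts F. ?val (\<psi> \<circ> fst) v) * word_entry ?X w u)"
    unfolding transform_def coeff length_words[OF w] sum_distrib_right by (rule sum.swap)
  also have "\<dots> = (\<Sum>\<psi>\<in>?E \<rightarrow>\<^sub>E {..<n}. \<Prod>v\<in>?V. B v (\<psi> \<circ> fst))"
  proof (rule sum.cong[OF refl])
    fix \<psi> assume \<psi>: "\<psi> \<in> ?E \<rightarrow>\<^sub>E {..<n}"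
    let ?u = "map (\<lambda>i. \<psi> (fst (s i))) [0..<?k]"
    have u: "?u \<in> words n ?k" using \<psi> half(1)[OF sH] by (auto simp: words_def)
    have iff: "(\<forall>i<?k. u ! i = \<psi> (fst (s i))) \<longleftrightarrow> u = ?u" if "u \<in> words n ?k" for u
    proof
      assume "\<forall>i<?k. u ! i = \<psi> (fst (s i))"
      then show "u = ?u" using length_words[OF that] by (intro nth_equalityI) simp_all
    qed simp
    have "(\<Sum>u\<in>words n ?k. of_bool (\<forall>i<?k. u ! i = \<psi> (fst (s i)))
          * (\<Prod>v\<in>inner_verts F. ?val (\<psi> \<circ> fst) v) * word_entry ?X w u)
        = (\<Sum>u\<in>words n ?k. if u = ?u then (\<Prod>v\<in>inner_verts F. ?val (\<psi> \<circ> fst) v) * word_entry ?X w ?u else 0)"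
      by (intro sum.cong refl) (auto simp: iff)
    also have "\<dots> = (\<Prod>v\<in>inner_verts F. ?val (\<psi> \<circ> fst) v) * word_entry ?X w ?u"
      using u by (simp add: finite_words)
    also have "\<dots> = (\<Prod>v\<in>?V. B v (\<psi> \<circ> fst))"
      unfolding prod_B word_entry_def length_words[OF w] by simp
    finally show "(\<Sum>u\<in>words n ?k. of_bool (\<forall>i<?k. u ! i = \<psi> (fst (s i)))
          * (\<Prod>v\<in>inner_verts F. ?val (\<psi> \<circ> fst) v) * word_entry ?X w u) = (\<Prod>v\<in>?V. B v (\<psi> \<circ> fst))" .
  qed
  \<comment> \<open>Now the half edges get colors of their own, which each edge forces to be equal.\<close>
  also have "\<dots> = (\<Sum>\<psi>\<in>?E \<rightarrow>\<^sub>E {..<n}. \<Sum>\<chi>\<in>?H \<rightarrow>\<^sub>E {..<n}. (\<Prod>v\<in>?V. B v \<chi>) *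
      (\<Prod>e\<in>?E. \<Prod>j\<in>half_edges_of F e. of_bool (\<chi> j = \<psi> e)))"
  proof (rule sum.cong[OF refl])
    fix \<psi> assume \<psi>: "\<psi> \<in> ?E \<rightarrow>\<^sub>E {..<n}"
    let ?\<chi> = "restrict (\<psi> \<circ> fst) ?H"
    have mem: "?\<chi> \<in> ?H \<rightarrow>\<^sub>E {..<n}" using \<psi> half(1) by auto
    have "(\<Prod>e\<in>?E. \<Prod>j\<in>half_edges_of F e. of_bool (\<chi> j = \<psi> e)) = (of_bool (\<chi> = ?\<chi>) :: real)"
      if \<chi>: "\<chi> \<in> ?H \<rightarrow>\<^sub>E {..<n}" for \<chi>
    proof (cases "\<chi> = ?\<chi>")
      case True
      then show ?thesis by (simp add: prod.neutral)
    next
      case False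
      then obtain j where j: "j \<in> ?H" "\<chi> j \<noteq> \<psi> (fst j)"
        using PiE_ext[OF \<chi> mem] by auto
      then have "(\<Prod>i\<in>half_edges_of F (fst j). of_bool (\<chi> i = \<psi> (fst j))) = (0 :: real)"
        using H by (intro prod_zero bexI[of _ j]) simp_all
      then have "\<exists>e\<in>?E. (\<Prod>i\<in>half_edges_of F e. of_bool (\<chi> i = \<psi> e)) = (0 :: real)"
        by (intro bexI[of _ "fst j"] half(1) j(1))
      then have "(\<Prod>e\<in>?E. \<Prod>i\<in>half_edges_of F e. of_bool (\<chi> i = \<psi> e)) = (0 :: real)"
        by (rule prod_zero[OF E])
      then show ?thesis using False by simp
    qed
    then have "(\<Sum>\<chi>\<in>?H \<rightarrow>\<^sub>E {..<n}. (\<Prod>v\<in>?V. B v \<chi>) *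
      (\<Prod>e\<in>?E. \<Prod>j\<in>half_edges_of F e. of_bool (\<chi> j = \<psi> e)))
      = (\<Sum>\<chi>\<in>?H \<rightarrow>\<^sub>E {..<n}. if \<chi> = ?\<chi> then \<Prod>v\<in>?V. B v ?\<chi> else 0)"
      by (intro sum.cong refl) auto
    also have "\<dots> = (\<Prod>v\<in>?V. B v ?\<chi>)"
      using mem H by (simp add: finite_PiE)
    also have "\<dots> = (\<Prod>v\<in>?V. B v (\<psi> \<circ> fst))"
      by (intro prod.cong B_local refl) simp
    finally show "(\<Prod>v\<in>?V. B v (\<psi> \<circ> fst)) = (\<Sum>\<chi>\<in>?H \<rightarrow>\<^sub>E {..<n}. (\<Prod>v\<in>?V. B v \<chi>) *
      (\<Prod>e\<in>?E. \<Prod>j\<in>half_edges_of F e. of_bool (\<chi> j = \<psi> e)))" ..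
  qed
  also have "\<dots> = (\<Sum>\<chi>\<in>?H \<rightarrow>\<^sub>E {..<n}. (\<Prod>v\<in>?V. B v \<chi>) *
      (\<Prod>e\<in>?E. \<Sum>c<n. \<Prod>j\<in>half_edges_of F e. of_bool (\<chi> j = c)))"
    by (subst sum.swap) (simp add: sum_distrib_left prod_sum_PiE E)
  also have "\<dots> = (\<Sum>\<chi>\<in>?H \<rightarrow>\<^sub>E {..<n}. (\<Prod>v\<in>?V. B v \<chi>) *
      (\<Prod>e\<in>?E. \<Sum>c<n. \<Prod>j\<in>half_edges_of F e. ?X (c, \<chi> j)))"
  proof (rule sum.cong[OF refl], rule arg_cong2[where f = "(*)", OF refl], rule prod.cong[OF refl])
    fix \<chi> e assume \<chi>: "\<chi> \<in> ?H \<rightarrow>\<^sub>E {..<n}" and e: "e \<in> ?E"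
    have "size (ends F e) \<in> {0, 2}" using wf e unfolding wf_fragment_def by blast
    then have "card (half_edges_of F e) \<in> {0, 2}"
      by (simp only: card_half_edges_of[OF wf e])
    then show "(\<Sum>c<n. \<Prod>j\<in>half_edges_of F e. of_bool (\<chi> j = c))
      = (\<Sum>c<n. \<Prod>j\<in>half_edges_of F e. ?X (c, \<chi> j))"
      using H \<chi> by (intro edge_invariance[OF orth]) auto
  qed
  also have "\<dots> = (\<Sum>\<psi>\<in>?E \<rightarrow>\<^sub>E {..<n}. \<Sum>\<chi>\<in>?H \<rightarrow>\<^sub>E {..<n}. (\<Prod>v\<in>?V. B v \<chi>) *
      (\<Prod>e\<in>?E. \<Prod>j\<in>half_edges_of F e. ?X (\<psi> e, \<chi> j)))"
    by (subst sum.swap) (simp add: sum_distrib_left prod_sum_PiE E)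
  \<comment> \<open>The factors of \<open>U\<close> that the edges released are collected at the vertices.\<close>
  also have "\<dots> = (\<Sum>\<psi>\<in>?E \<rightarrow>\<^sub>E {..<n}. \<Sum>\<chi>\<in>?H \<rightarrow>\<^sub>E {..<n}. \<Prod>v\<in>?V. B v \<chi> *
      (\<Prod>j\<in>half_edges_at F v. ?X (\<psi> (fst j), \<chi> j)))"
  proof (intro sum.cong refl)
    fix \<psi> \<chi>
    have "(\<Prod>e\<in>?E. \<Prod>j\<in>half_edges_of F e. ?X (\<psi> e, \<chi> j))
        = (\<Prod>e\<in>?E. \<Prod>j\<in>half_edges_of F e. ?X (\<psi> (fst j), \<chi> j))"
      by (intro prod.cong) auto
    also have "\<dots> = (\<Prod>j\<in>?H. ?X (\<psi> (fst j), \<chi> j))"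
      using H E half(1) by (intro prod.group) auto
    also have "\<dots> = (\<Prod>v\<in>?V. \<Prod>j\<in>half_edges_at F v. ?X (\<psi> (fst j), \<chi> j))"
      using H V half(2) by (intro prod.group[symmetric]) auto
    finally show "(\<Prod>v\<in>?V. B v \<chi>) * (\<Prod>e\<in>?E. \<Prod>j\<in>half_edges_of F e. ?X (\<psi> e, \<chi> j))
      = (\<Prod>v\<in>?V. B v \<chi> * (\<Prod>j\<in>half_edges_at F v. ?X (\<psi> (fst j), \<chi> j)))"
      by (simp add: prod.distrib)
  qed
  also have "\<dots> = (\<Sum>\<psi>\<in>?E \<rightarrow>\<^sub>E {..<n}. \<Prod>v\<in>?V. \<Sum>\<chi>\<in>half_edges_at F v \<rightarrow>\<^sub>E {..<n}. B v \<chi> *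
      (\<Prod>j\<in>half_edges_at F v. ?X (\<psi> (fst j), \<chi> j)))"
    using V H half(2)
    by (intro sum.cong refl sum_prod_blocks arg_cong2[where f = "(*)"] B_local prod.cong) auto
  also have "\<dots> = (\<Sum>\<psi>\<in>?E \<rightarrow>\<^sub>E {..<n}.
      of_bool (\<forall>i<?k. w ! i = \<psi> (fst (s i))) * (\<Prod>v\<in>inner_verts F. ?val (\<psi> \<circ> fst) v))"
  proof (rule sum.cong[OF refl])
    fix \<psi> assume \<psi>: "\<psi> \<in> ?E \<rightarrow>\<^sub>E {..<n}"
    have \<psi>n: "\<psi> (fst j) < n" if "j \<in> ?H" for j
      using PiE_mem[OF \<psi> half(1)[OF that]] by simp
    let ?S = "\<lambda>v. \<Sum>\<chi>\<in>half_edges_at F v \<rightarrow>\<^sub>E {..<n}. B v \<chi> *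
      (\<Prod>j\<in>half_edges_at F v. ?X (\<psi> (fst j), \<chi> j))"
    have "?S v = ?val (\<psi> \<circ> fst) v" if "v \<in> inner_verts F" for v
      using vertex_invariance[OF inv, where J = "half_edges_at F v" and c = "\<psi> \<circ> fst"] that H \<psi>n
      by (simp add: B_def)
    moreover have "?S (opens F ! i) = of_bool (w ! i = \<psi> (fst (s i)))" if i: "i < ?k" for i
    proof -
      have "?S (opens F ! i) = (\<Sum>\<chi>\<in>{s i} \<rightarrow>\<^sub>E {..<n}. ?X (w ! i, \<chi> (s i)) * ?X (\<psi> (fst (s i)), \<chi> (s i)))"
        by (simp add: B_def not_inner[OF i] s[OF i] idx[OF i])
      also have "\<dots> = (\<Sum>c<n. ?X (w ! i, c) * ?X (\<psi> (fst (s i)), c))"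
        by (rule sum.reindex_bij_witness[where j = "\<lambda>\<chi>. \<chi> (s i)" and i = "\<lambda>c. \<lambda>j\<in>{s i}. c"])
          (auto simp: PiE_iff extensional_def fun_eq_iff)
      also have "\<dots> = of_bool (w ! i = \<psi> (fst (s i)))"
        by (rule orthogonal_sums(2)[OF orth nth_words[OF w i] \<psi>n[OF sH[OF i]]])
      finally show ?thesis .
    qed
    moreover have "(\<Prod>i<?k. of_bool (w ! i = \<psi> (fst (s i)))) = (of_bool (\<forall>i<?k. w ! i = \<psi> (fst (s i))) :: real)"
      by (cases "\<forall>i<?k. w ! i = \<psi> (fst (s i))") (auto intro!: prod.neutral prod_zero)
    ultimately show "(\<Prod>v\<in>?V. ?S v) =
      of_bool (\<forall>i<?k. w ! i = \<psi> (fst (s i))) * (\<Prod>v\<in>inner_verts F. ?val (\<psi> \<circ> fst) v)"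
      unfolding prod_V by (simp add: mult.commute)
  qed
  also have "\<dots> = pre_h_coeff n h w F" by (rule coeff[symmetric])
  finally show ?thesis .
qed


section \<open>Fragments obtained from matchings\<close>

text \<open>
  Take \<open>N\<close> slots, of which the first \<open>k\<close> are the open ends, and let \<open>vtx\<close> assign the other slots
  to \<open>r\<close> inner vertices.  Joining the slots according to \<open>\<pi>\<close> gives a fragment; an edge is
  named by the smaller of its two slots.
\<close>

definition matching_fragment :: "nat \<Rightarrow> nat \<Rightarrow> nat \<Rightarrow> (nat \<Rightarrow> nat) \<Rightarrow> (nat \<Rightarrow> nat) \<Rightarrow> pre_fragment" where
  "matching_fragment k N r vtx \<pi> =
    Pre_Fragment {..<k + r} {p. p < N \<and> p < \<pi> p} (\<lambda>p. {#vtx p, vtx (\<pi> p)#}) [0..<k]"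

definition slot_map :: "nat \<Rightarrow> nat \<Rightarrow> nat \<Rightarrow> (nat \<Rightarrow> nat) \<Rightarrow> bool" where
  "slot_map k N r vtx \<longleftrightarrow> k \<le> N \<and> (\<forall>p<k. vtx p = p) \<and> (\<forall>p. k \<le> p \<and> p < N \<longrightarrow> k \<le> vtx p \<and> vtx p < k + r)"

lemma inc_edges_matching_fragment:
  assumes \<pi>: "\<pi> \<in> matchings {..<N}"
  shows "inc_edges (matching_fragment k N r vtx \<pi>) v
    = image_mset (\<lambda>p. min p (\<pi> p)) (mset_set {p\<in>{..<N}. vtx p = v})"
proof -
  let ?F = "matching_fragment k N r vtx \<pi>"
  let ?E = "{p. p < N \<and> p < \<pi> p}"
  let ?edge = "\<lambda>p. min p (\<pi> p)"
  let ?f = "\<lambda>p. if vtx p = v then {#?edge p#} else {#}"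
  have \<pi>': "\<pi> p < N" "\<pi> p \<noteq> p" "\<pi> (\<pi> p) = p" if "p < N" for p
    using \<pi> that by (auto simp: matchings_def)
  have fibre: "{p\<in>{..<N}. ?edge p = e} = {e, \<pi> e}" if "e \<in> ?E" for e
    using that \<pi>' by (auto simp: min_def split: if_splits)
  have edge: "?edge p \<in> ?E" if "p < N" for p
    using \<pi>'[OF that] that by (auto simp: min_def)
  have "inc_edges ?F v = (\<Sum>e\<in>?E. replicate_mset (count {#vtx e, vtx (\<pi> e)#} v) e)"
    by (simp add: inc_edges_def matching_fragment_def)
  also have "\<dots> = (\<Sum>e\<in>?E. \<Sum>p\<in>{p\<in>{..<N}. ?edge p = e}. ?f p)"
  proof (rule sum.cong[OF refl])
    fix e assume e: "e \<in> ?E"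
    then have "?edge e = e" "?edge (\<pi> e) = e" "e \<noteq> \<pi> e" using \<pi>'[of e] by auto
    then show "replicate_mset (count {#vtx e, vtx (\<pi> e)#} v) e = (\<Sum>p\<in>{p\<in>{..<N}. ?edge p = e}. ?f p)"
      unfolding fibre[OF e] by simp
  qed
  also have "\<dots> = (\<Sum>p<N. ?f p)"
    using edge by (intro sum.group) auto
  also have "\<dots> = (\<Sum>p\<in>{p\<in>{..<N}. vtx p = v}. {#?edge p#})"
    by (rule sum.inter_filter[symmetric]) simp
  also have "\<dots> = image_mset ?edge (mset_set {p\<in>{..<N}. vtx p = v})"
    by (intro sum_singletons) simp
  finally show ?thesis .
qed

lemma wf_matching_fragment:
  assumes \<pi>: "\<pi> \<in> matchings {..<N}" and vtx: "slot_map k N r vtx"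
  shows "wf_fragment (matching_fragment k N r vtx \<pi>)"
proof -
  have \<pi>': "\<pi> p < N" if "p < N" for p
    using \<pi> that by (auto simp: matchings_def)
  have v: "vtx p < k + r" if "p < N" for p
    using vtx that unfolding slot_map_def by (cases "p < k") auto
  have open_slot: "{p\<in>{..<N}. vtx p = i} = {i}" if "i < k" for i
    using vtx that unfolding slot_map_def by (auto, metis leD leI)
  then have "size (inc_edges (matching_fragment k N r vtx \<pi>) i) = 1" if "i < k" for i
    using that by (simp add: inc_edges_matching_fragment[OF \<pi>])
  then show ?thesis
    using \<pi>' v by (simp add: wf_fragment_def) (auto simp: matching_fragment_def)
qed

text \<open>
  Colorings of the edges are the words of length \<open>N\<close> which are constant on matched pairs.
\<close>

theorem pre_h_coeff_matching_fragment:
  assumes \<pi>: "\<pi> \<in> matchings {..<N}" and vtx: "slot_map k N r vtx" and w: "w \<in> words n k"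
  shows "pre_h_coeff n h w (matching_fragment k N r vtx \<pi>) =
    (\<Sum>u\<in>words n N. of_bool (take k u = w \<and> pair_constant {..<N} \<pi> ((!) u)) *
      (\<Prod>v\<in>{k..<k + r}. h (exponent_of (image_mset ((!) u) (mset_set {p\<in>{..<N}. vtx p = v})))))"
proof -
  let ?F = "matching_fragment k N r vtx \<pi>"
  let ?E = "{p. p < N \<and> p < \<pi> p}"
  let ?edge = "\<lambda>p. min p (\<pi> p)"
  let ?word = "\<lambda>\<psi>. map (\<lambda>p. \<psi> (?edge p)) [0..<N]"
  let ?val = "\<lambda>u. \<Prod>v\<in>{k..<k + r}. h (exponent_of (image_mset ((!) u) (mset_set {p\<in>{..<N}. vtx p = v})))"
  have k: "k \<le> N" using vtx by (simp add: slot_map_def)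
  have \<pi>': "\<pi> p < N" "\<pi> p \<noteq> p" "\<pi> (\<pi> p) = p" if "p < N" for p
    using \<pi> that by (auto simp: matchings_def)
  have edge: "?edge p \<in> ?E" if "p < N" for p
    using \<pi>'[OF that] that by (auto simp: min_def)
  have edge_\<pi>: "?edge (\<pi> p) = ?edge p" if "p < N" for p
    using \<pi>'[OF that] by (simp add: min.commute)
  have open_slot: "vtx p = i \<longleftrightarrow> p = i" if "i < k" "p < N" for i p
    using vtx that unfolding slot_map_def by (metis leD leI)
  have inner: "inner_verts ?F = {k..<k + r}"
    by (auto simp: inner_verts_def matching_fragment_def)
  have colorings: "edge_colorings n ?F w = {\<psi> \<in> ?E \<rightarrow>\<^sub>E {..<n}. take k (?word \<psi>) = w}"
  proof -
    have "(\<forall>i<k. \<forall>e\<in>?E. i \<in># {#vtx e, vtx (\<pi> e)#} \<longrightarrow> \<psi> e = w ! i) \<longleftrightarrow> take k (?word \<psi>) = w" for \<psi>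
    proof -
      have "(\<forall>i<k. \<forall>e\<in>?E. i \<in># {#vtx e, vtx (\<pi> e)#} \<longrightarrow> \<psi> e = w ! i) \<longleftrightarrow> (\<forall>i<k. \<psi> (?edge i) = w ! i)"
      proof (intro iffI allI impI ballI)
        fix i assume L: "\<forall>i<k. \<forall>e\<in>?E. i \<in># {#vtx e, vtx (\<pi> e)#} \<longrightarrow> \<psi> e = w ! i" and i: "i < k"
        have "i < N" using i k by simp
        then have "i \<in># {#vtx (?edge i), vtx (\<pi> (?edge i))#}"
          using open_slot[OF i \<open>i < N\<close>] \<pi>'[OF \<open>i < N\<close>] by (auto simp: min_def)
        then show "\<psi> (?edge i) = w ! i" using L i edge[OF \<open>i < N\<close>] by blast
      next
        fix i e assume R: "\<forall>i<k. \<psi> (?edge i) = w ! i" and i: "i < k" and e: "e \<in> ?E"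
          and m: "i \<in># {#vtx e, vtx (\<pi> e)#}"
        have "i = e \<or> i = \<pi> e"
          using m open_slot[OF i, of e] open_slot[OF i, of "\<pi> e"] e \<pi>' by auto
        then have "?edge i = e" using e \<pi>'[of e] by auto
        then show "\<psi> e = w ! i" using R i by auto
      qed
      also have "\<dots> \<longleftrightarrow> take k (?word \<psi>) = w"
        using k length_words[OF w] by (auto simp: list_eq_iff_nth_eq)
      finally show ?thesis .
    qed
    then show ?thesis unfolding edge_colorings_def matching_fragment_def by auto
  qed
  have val: "(\<Prod>v\<in>inner_verts ?F. h (exponent_of (image_mset \<psi> (inc_edges ?F v)))) = ?val (?word \<psi>)" for \<psi>
  proof -
    have "image_mset \<psi> (inc_edges ?F v) = image_mset ((!) (?word \<psi>)) (mset_set {p\<in>{..<N}. vtx p = v})" for v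
      unfolding inc_edges_matching_fragment[OF \<pi>] multiset.map_comp
      by (intro image_mset_cong) simp
    then show ?thesis by (simp add: inner)
  qed
  have "pre_h_coeff n h w ?F = (\<Sum>\<psi>\<in>{\<psi> \<in> ?E \<rightarrow>\<^sub>E {..<n}. take k (?word \<psi>) = w}. ?val (?word \<psi>))"
    unfolding pre_h_coeff_def colorings val ..
  also have "\<dots> = (\<Sum>u\<in>{u\<in>words n N. take k u = w \<and> pair_constant {..<N} \<pi> ((!) u)}. ?val u)"
  proof (rule sum.reindex_bij_witness[where j = ?word and i = "\<lambda>u. restrict ((!) u) ?E"])
    fix \<psi> assume "\<psi> \<in> {\<psi> \<in> ?E \<rightarrow>\<^sub>E {..<n}. take k (?word \<psi>) = w}"
    then have \<psi>: "\<psi> \<in> ?E \<rightarrow>\<^sub>E {..<n}" and tk: "take k (?word \<psi>) = w" by auto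
    show "restrict ((!) (?word \<psi>)) ?E = \<psi>"
      using PiE_arb[OF \<psi>] by (auto simp: fun_eq_iff)
    have "pair_constant {..<N} \<pi> ((!) (?word \<psi>))"
      unfolding pair_constant_def using \<pi>' edge_\<pi> by simp
    moreover have "?word \<psi> \<in> words n N"
      using PiE_mem[OF \<psi> edge] by (auto simp: words_def)
    ultimately show "?word \<psi> \<in> {u\<in>words n N. take k u = w \<and> pair_constant {..<N} \<pi> ((!) u)}"
      using tk by simp
  next
    fix u assume "u \<in> {u\<in>words n N. take k u = w \<and> pair_constant {..<N} \<pi> ((!) u)}"
    then have u: "u \<in> words n N" "take k u = w" "pair_constant {..<N} \<pi> ((!) u)" by auto
    have "restrict ((!) u) ?E (?edge p) = u ! p" if "p < N" for p
      using edge[OF that] u(3) that by (auto simp: pair_constant_def min_def)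
    then show word: "?word (restrict ((!) u) ?E) = u"
      using length_words[OF u(1)] by (intro nth_equalityI) (simp_all del: restrict_apply)
    show "restrict ((!) u) ?E \<in> {\<psi> \<in> ?E \<rightarrow>\<^sub>E {..<n}. take k (?word \<psi>) = w}"
      using nth_words[OF u(1)] u(2) unfolding mem_Collect_eq word by auto
  qed simp
  also have "\<dots> = (\<Sum>u\<in>words n N. of_bool (take k u = w \<and> pair_constant {..<N} \<pi> ((!) u)) * ?val u)"
    by (intro sum.mono_neutral_cong_left) (auto simp: finite_words)
  finally show ?thesis .
qed


section \<open>Orthogonality to the algebra of generators\<close>

text \<open>
  All complete contractions of \<open>T\<close> are zero.  By Wick's formula, this forces the mean of every
  entry of \<open>X T\<close> to vanish.
\<close>

definition unmatched :: "nat \<Rightarrow> nat \<Rightarrow> (nat list \<Rightarrow> real) \<Rightarrow> bool" where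
  "unmatched n N T \<longleftrightarrow> (\<forall>\<pi>\<in>matchings {..<N}.
     (\<Sum>u\<in>words n N. T u * of_bool (pair_constant {..<N} \<pi> ((!) u))) = 0)"

abbreviation grid :: "nat \<Rightarrow> (nat \<times> nat) set" where
  "grid n \<equiv> {..<n} \<times> {..<n}"

lemma word_entry_polyfun:
  assumes "u \<in> words n N" "v \<in> words n N"
  shows "(\<lambda>X. word_entry X u v) \<in> polyfuns (grid n)"
  unfolding word_entry_def length_words[OF assms(1)]
  using nth_words[OF assms(1)] nth_words[OF assms(2)]
  by (intro function_algebra_prod function_algebra.gen) auto

lemma transform_polyfun:
  assumes "u \<in> words n N"
  shows "(\<lambda>X. transform n X T u) \<in> polyfuns (grid n)"
  unfolding transform_def length_words[OF assms]
  by (intro function_algebra_sum function_algebra.mult function_algebra.const word_entry_polyfun[OF assms])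

text \<open>
  Matching Gaussian entries with index pairs \<open>(u\<^sub>p, v\<^sub>p)\<close> means matching rows and columns
  simultaneously, so each matching contributes a factor for the rows times the contraction of
  \<open>T\<close> along this matching.
\<close>

lemma mean_transform_unmatched:
  assumes u: "u \<in> words n N" and T: "unmatched n N T"
  shows "mean (grid n) (\<lambda>X. transform n X T u) = 0"
proof -
  let ?I = "grid n" and ?H = "{..<N}"
  let ?f = "\<lambda>v p. (u ! p, v ! p)"
  define c where "c = (1 / sqrt (1 + 2 * real (card ?H))) ^ (card ?I + card ?H)"
  obtain \<pi>s where \<pi>s: "set \<pi>s \<subseteq> matchings ?H" and
    wick: "\<And>f. f ` ?H \<subseteq> ?I \<Longrightarrow>
      (\<Prod>i\<in>?I. gauss_moment (card {p\<in>?H. f p = i})) = (\<Sum>\<pi>\<leftarrow>\<pi>s. of_bool (pair_constant ?H \<pi> f))"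
    using wick[of ?I ?H] by auto
  have entry: "mean ?I (\<lambda>X. word_entry X u v) =
      c * (\<Sum>\<pi>\<leftarrow>\<pi>s. of_bool (pair_constant ?H \<pi> ((!) u)) * of_bool (pair_constant ?H \<pi> ((!) v)))"
    if v: "v \<in> words n N" for v
  proof -
    have img: "?f v ` ?H \<subseteq> ?I" using nth_words[OF u] nth_words[OF v] by auto
    have split: "pair_constant ?H \<pi> (?f v) \<longleftrightarrow> pair_constant ?H \<pi> ((!) u) \<and> pair_constant ?H \<pi> ((!) v)" for \<pi>
      by (auto simp: pair_constant_def)
    have "mean ?I (\<lambda>X. word_entry X u v) = mean ?I (\<lambda>X. \<Prod>p\<in>?H. X (?f v p))"
      by (simp add: word_entry_def length_words[OF u])
    also have "\<dots> = c * (\<Prod>i\<in>?I. gauss_moment (card {p\<in>?H. ?f v p = i}))"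
      unfolding c_def by (rule mean_monomial) (use img in auto)
    also have "\<dots> = c * (\<Sum>\<pi>\<leftarrow>\<pi>s. of_bool (pair_constant ?H \<pi> (?f v)))"
      by (subst wick[OF img]) simp
    finally show ?thesis by (simp only: split of_bool_conj)
  qed
  have "mean ?I (\<lambda>X. transform n X T u) = (\<Sum>v\<in>words n N. T v * mean ?I (\<lambda>X. word_entry X u v))"
    unfolding transform_def length_words[OF u] mean_scale[symmetric]
    by (intro mean_sum function_algebra.mult function_algebra.const word_entry_polyfun[OF u]) auto
  also have "\<dots> = (\<Sum>v\<in>words n N. \<Sum>\<pi>\<leftarrow>\<pi>s. c * of_bool (pair_constant ?H \<pi> ((!) u)) *
      (T v * of_bool (pair_constant ?H \<pi> ((!) v))))"
    by (intro sum.cong refl) (simp add: entry sum_list_const_mult[symmetric] mult_ac)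
  also have "\<dots> = (\<Sum>\<pi>\<leftarrow>\<pi>s. \<Sum>v\<in>words n N. c * of_bool (pair_constant ?H \<pi> ((!) u)) *
      (T v * of_bool (pair_constant ?H \<pi> ((!) v))))"
    by (induction \<pi>s) (simp_all add: sum.distrib)
  also have "\<dots> = (\<Sum>\<pi>\<leftarrow>\<pi>s. 0)"
    using \<pi>s T unfolding unmatched_def sum_distrib_left[symmetric]
    by (intro arg_cong[where f = sum_list] map_cong refl) auto
  finally show ?thesis by simp
qed

text \<open>
  Contracting the last two slots of a matching with each other either closes a pair to a cycle,
  which gives the factor \<open>n\<close>, or joins the two partners of these slots to a new pair.
\<close>

lemma contract_matching:
  assumes \<pi>: "\<pi> \<in> matchings {..<N + 2}"
  obtains c \<rho> where "\<rho> \<in> matchings {..<N}"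
    "\<And>u. u \<in> words n N \<Longrightarrow> (\<Sum>l<n. of_bool (pair_constant {..<N + 2} \<pi> ((!) (u @ [l, l])))) =
      (c :: real) * of_bool (pair_constant {..<N} \<rho> ((!) u))"
proof -
  let ?a = "N" and ?b = "Suc N"
  have \<pi>': "\<pi> p < N + 2" "\<pi> p \<noteq> p" "\<pi> (\<pi> p) = p" if "p < N + 2" for p
    using \<pi> that by (auto simp: matchings_def)
  have split: "(\<forall>p<N + 2. P p) \<longleftrightarrow> (\<forall>p<N. P p) \<and> P ?a \<and> P ?b" for P
    by (auto simp: less_Suc_eq numeral_2_eq_2)
  show ?thesis
  proof (cases "\<pi> ?a = ?b")
    case True
    then have b: "\<pi> ?b = ?a" using \<pi>'(3)[of ?a] by simp
    have small: "\<pi> p < N" if "p < N" for p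
    proof -
      have "\<pi> p \<noteq> ?a" "\<pi> p \<noteq> ?b" using that \<pi>'(3)[of p] True b by auto
      then show ?thesis using \<pi>'(1)[of p] that by simp
    qed
    show ?thesis
    proof (rule that[of \<pi> "real n"])
      show "\<pi> \<in> matchings {..<N}" using small \<pi>' by (auto simp: matchings_def)
      fix u assume u: "u \<in> words n N"
      have "pair_constant {..<N + 2} \<pi> ((!) (u @ [l, l])) \<longleftrightarrow> pair_constant {..<N} \<pi> ((!) u)" for l
        unfolding pair_constant_def Ball_def lessThan_iff split
        using small length_words[OF u] True b by (simp add: nth_append)
      then show "(\<Sum>l<n. of_bool (pair_constant {..<N + 2} \<pi> ((!) (u @ [l, l])))) =
        real n * of_bool (pair_constant {..<N} \<pi> ((!) u))" by simp
    qed
  next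
    case False
    define r s where "r = \<pi> ?a" and "s = \<pi> ?b"
    have "s \<noteq> ?a" using False \<pi>'(3)[of ?b] by (auto simp: s_def)
    then have r: "r < N" "\<pi> r = ?a" and s: "s < N" "\<pi> s = ?b"
      using \<pi>'[of ?a] \<pi>'[of ?b] False by (auto simp: r_def s_def)
    have "r \<noteq> s" using r s by auto
    \<comment> \<open>The pairs of \<open>r\<close> with the last but one slot and of \<open>s\<close> with the last slot become one pair.\<close>
    let ?\<rho> = "\<pi>(r := s, s := r)"
    have small: "\<pi> p < N" "\<pi> p \<noteq> r" "\<pi> p \<noteq> s" if "p < N" "p \<noteq> r" "p \<noteq> s" for p
    proof -
      have "\<pi> p \<noteq> ?a" "\<pi> p \<noteq> ?b" using that \<pi>'(3)[of p] by (auto simp: r_def s_def)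
      then show "\<pi> p < N" using \<pi>'(1)[of p] that by simp
      show "\<pi> p \<noteq> r" "\<pi> p \<noteq> s" using that \<pi>'(3)[of p] r s by auto
    qed
    show ?thesis
    proof (rule that[of ?\<rho> 1])
      show "?\<rho> \<in> matchings {..<N}"
        using small \<pi>' r(1) s(1) \<open>r \<noteq> s\<close> by (auto simp: matchings_def)
      fix u assume u: "u \<in> words n N"
      let ?Q = "\<forall>p<N. p \<noteq> r \<and> p \<noteq> s \<longrightarrow> u ! \<pi> p = u ! p"
      have L: "pair_constant {..<N + 2} \<pi> ((!) (u @ [l, l])) \<longleftrightarrow> ?Q \<and> l = u ! r \<and> l = u ! s" for l
      proof -
        have "(\<forall>p<N. (u @ [l, l]) ! \<pi> p = (u @ [l, l]) ! p) \<longleftrightarrow> ?Q \<and> l = u ! r \<and> l = u ! s"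
        proof -
          have "(u @ [l, l]) ! \<pi> p = (if p = r \<or> p = s then l else u ! \<pi> p)" if "p < N" for p
            using that small(1)[of p] r s length_words[OF u] by (auto simp: nth_append)
          then have "(\<forall>p<N. (u @ [l, l]) ! \<pi> p = (u @ [l, l]) ! p) \<longleftrightarrow>
              (\<forall>p<N. (if p = r \<or> p = s then l else u ! \<pi> p) = u ! p)"
            using length_words[OF u] by (simp add: nth_append)
          then show ?thesis using r(1) s(1) by auto
        qed
        moreover have "(u @ [l, l]) ! \<pi> ?a = u ! r" "(u @ [l, l]) ! \<pi> ?b = u ! s"
          "(u @ [l, l]) ! ?a = l" "(u @ [l, l]) ! ?b = l"
          using r(1) s(1) length_words[OF u] by (simp_all add: nth_append flip: r_def s_def)
        ultimately show ?thesis unfolding pair_constant_def Ball_def lessThan_iff split by auto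
      qed
      have R: "pair_constant {..<N} ?\<rho> ((!) u) \<longleftrightarrow> ?Q \<and> u ! s = u ! r"
        unfolding pair_constant_def using r(1) s(1) \<open>r \<noteq> s\<close> by auto
      have "(\<Sum>l<n. of_bool (pair_constant {..<N + 2} \<pi> ((!) (u @ [l, l]))))
          = (\<Sum>l<n. if l = u ! r then of_bool (?Q \<and> u ! s = u ! r) else (0 :: real))"
        unfolding L by (intro sum.cong refl) auto
      also have "\<dots> = of_bool (?Q \<and> u ! s = u ! r)"
        using nth_words[OF u r(1)] by simp
      finally show "(\<Sum>l<n. of_bool (pair_constant {..<N + 2} \<pi> ((!) (u @ [l, l])))) =
        (1 :: real) * of_bool (pair_constant {..<N} ?\<rho> ((!) u))" unfolding R mult_1 .
    qed
  qed
qed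

text \<open>
  A contraction along a matching of all slots sums over the common color of the two slots of the
  identity tensor; by \<open>contract_matching\<close> this leaves a contraction of \<open>T\<close> along a matching of
  its own slots.  The action of \<open>X\<close> turns the identity tensor into \<open>X X\<^sup>T\<close>.
\<close>

lemma unmatched_tensor_identity:
  assumes "unmatched n N T"
  shows "unmatched n (N + 2) (\<lambda>u. T (take N u) * of_bool (u ! N = u ! Suc N))"
  unfolding unmatched_def
proof
  fix \<pi> :: "nat \<Rightarrow> nat" assume "\<pi> \<in> matchings {..<N + 2}"
  then obtain c \<rho> where \<rho>: "\<rho> \<in> matchings {..<N}"
    "\<And>u. u \<in> words n N \<Longrightarrow> (\<Sum>l<n. of_bool (pair_constant {..<N + 2} \<pi> ((!) (u @ [l, l])))) =
      (c :: real) * of_bool (pair_constant {..<N} \<rho> ((!) u))"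
    by (rule contract_matching[where n = n]) blast
  have "(\<Sum>u\<in>words n (N + 2). T (take N u) * of_bool (u ! N = u ! Suc N) *
      of_bool (pair_constant {..<N + 2} \<pi> ((!) u)))
    = (\<Sum>u\<in>words n N. \<Sum>l<n. \<Sum>m<n. T u * of_bool (l = m) *
      of_bool (pair_constant {..<N + 2} \<pi> ((!) (u @ [l, m]))))"
    unfolding sum_words_append numeral_2_eq_2 sum_words_Suc
    by (intro sum.cong refl) (simp add: length_words nth_append)
  also have "\<dots> = (\<Sum>u\<in>words n N. T u * (\<Sum>l<n. of_bool (pair_constant {..<N + 2} \<pi> ((!) (u @ [l, l])))))"
  proof (rule sum.cong[OF refl])
    fix u
    have "(\<Sum>m<n. T u * of_bool (l = m) * of_bool (pair_constant {..<N + 2} \<pi> ((!) (u @ [l, m]))))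
        = (\<Sum>m<n. if m = l then T u * of_bool (pair_constant {..<N + 2} \<pi> ((!) (u @ [l, l]))) else 0)" for l
      by (intro sum.cong refl) auto
    then show "(\<Sum>l<n. \<Sum>m<n. T u * of_bool (l = m) * of_bool (pair_constant {..<N + 2} \<pi> ((!) (u @ [l, m]))))
      = T u * (\<Sum>l<n. of_bool (pair_constant {..<N + 2} \<pi> ((!) (u @ [l, l]))))"
      by (simp add: sum_distrib_left)
  qed
  also have "\<dots> = (\<Sum>u\<in>words n N. T u * (c * of_bool (pair_constant {..<N} \<rho> ((!) u))))"
    by (intro sum.cong refl arg_cong2[where f = "(*)"] \<rho>(2))
  also have "\<dots> = c * (\<Sum>u\<in>words n N. T u * of_bool (pair_constant {..<N} \<rho> ((!) u)))"
    by (simp only: sum_distrib_left mult.left_commute)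
  finally show "(\<Sum>u\<in>words n (N + 2). T (take N u) * of_bool (u ! N = u ! Suc N) *
      of_bool (pair_constant {..<N + 2} \<pi> ((!) u))) = 0"
    using assms \<rho>(1) by (simp add: unmatched_def)
qed

definition gram :: "nat \<Rightarrow> nat \<Rightarrow> nat \<Rightarrow> (nat \<times> nat \<Rightarrow> real) \<Rightarrow> real" where
  "gram n i j X = (\<Sum>l<n. X (i, l) * X (j, l))"

lemma gram_transform: "gram n i j X = transform n X (\<lambda>v. of_bool (v ! 0 = v ! 1)) [i, j]"
proof -
  have "transform n X (\<lambda>v. of_bool (v ! 0 = v ! 1)) [i, j]
      = (\<Sum>l<n. \<Sum>m<n. if m = l then X (i, l) * X (j, l) else 0)"
    by (simp add: transform_def sum_words_Suc word_entry_Cons)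
  then show ?thesis by (simp add: gram_def)
qed

text \<open>
  The tensor product of \<open>r\<close> vertex tensors, with the slots distributed over the
  vertices as in \<open>matching_fragment\<close>.
\<close>

definition slot_tensor :: "((nat \<Rightarrow>\<^sub>0 nat) \<Rightarrow> real) \<Rightarrow> nat \<Rightarrow> nat \<Rightarrow> nat \<Rightarrow> (nat \<Rightarrow> nat) \<Rightarrow> nat list \<Rightarrow> real" where
  "slot_tensor h k N r vtx v =
    (\<Prod>a\<in>{k..<k + r}. h (exponent_of (image_mset ((!) v) (mset_set {p\<in>{..<N}. vtx p = a}))))"

definition orthogonal_to_fragments :: "nat \<Rightarrow> ((nat \<Rightarrow>\<^sub>0 nat) \<Rightarrow> real) \<Rightarrow> nat \<Rightarrow> (nat list \<Rightarrow> real) \<Rightarrow> bool" where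
  "orthogonal_to_fragments n h k x \<longleftrightarrow> (\<forall>F. wf_fragment F \<and> length (opens F) = k \<longrightarrow>
    (\<Sum>w\<in>words n k. x w * pre_h_coeff n h w F) = 0)"

text \<open>
  Contracting \<open>x\<close> with vertex tensors along a matching is the inner product of \<open>x\<close> with the
  tensor of the fragment of this matching.
\<close>

lemma unmatched_slot_tensor:
  assumes orth: "orthogonal_to_fragments n h k x" and vtx: "slot_map k N r vtx"
  shows "unmatched n N (\<lambda>v. x (take k v) * slot_tensor h k N r vtx v)"
  unfolding unmatched_def
proof
  fix \<pi> :: "nat \<Rightarrow> nat" assume \<pi>: "\<pi> \<in> matchings {..<N}"
  let ?F = "matching_fragment k N r vtx \<pi>"
  let ?pc = "\<lambda>v. pair_constant {..<N} \<pi> ((!) v)"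
  have k: "k \<le> N" using vtx by (simp add: slot_map_def)
  have "(\<Sum>w\<in>words n k. x w * pre_h_coeff n h w ?F) =
      (\<Sum>w\<in>words n k. \<Sum>v\<in>words n N. x w * (of_bool (take k v = w \<and> ?pc v) * slot_tensor h k N r vtx v))"
    by (intro sum.cong refl)
      (simp add: pre_h_coeff_matching_fragment[OF \<pi> vtx] slot_tensor_def sum_distrib_left)
  also have "\<dots> = (\<Sum>v\<in>words n N. \<Sum>w\<in>words n k. x w * (of_bool (take k v = w \<and> ?pc v) * slot_tensor h k N r vtx v))"
    by (rule sum.swap)
  also have "\<dots> = (\<Sum>v\<in>words n N. x (take k v) * slot_tensor h k N r vtx v * of_bool (?pc v))"
  proof (rule sum.cong[OF refl])
    fix v assume v: "v \<in> words n N"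
    then have tk: "take k v \<in> words n k" using k by (auto simp: words_def dest: in_set_takeD)
    have "(\<Sum>w\<in>words n k. x w * (of_bool (take k v = w \<and> ?pc v) * slot_tensor h k N r vtx v))
      = (\<Sum>w\<in>words n k. if w = take k v then x (take k v) * slot_tensor h k N r vtx v * of_bool (?pc v) else 0)"
      by (intro sum.cong refl) auto
    also have "\<dots> = x (take k v) * slot_tensor h k N r vtx v * of_bool (?pc v)"
      using tk by (simp add: finite_words)
    finally show "(\<Sum>w\<in>words n k. x w * (of_bool (take k v = w \<and> ?pc v) * slot_tensor h k N r vtx v))
      = x (take k v) * slot_tensor h k N r vtx v * of_bool (?pc v)" .
  qed
  moreover have "length (opens ?F) = k" by (simp add: matching_fragment_def)
  then have "(\<Sum>w\<in>words n k. x w * pre_h_coeff n h w ?F) = 0"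
    using orth wf_matching_fragment[OF \<pi> vtx] unfolding orthogonal_to_fragments_def by blast
  ultimately show "(\<Sum>v\<in>words n N. x (take k v) * slot_tensor h k N r vtx v * of_bool (?pc v)) = 0"
    by simp
qed

lemma mset_drop_nth: "mset (drop N v) = image_mset ((!) v) (mset_set {N..<length v})"
proof -
  have "drop N v = map ((!) v) [N..<length v]" by (rule nth_equalityI) auto
  then have "mset (drop N v) = mset (map ((!) v) [N..<length v])" by (rule arg_cong)
  then show ?thesis by (simp only: mset_map mset_upt)
qed

lemma prod_vertex_tensors:
  assumes u: "u \<in> words n k"
  shows "\<exists>r vtx. slot_map k (length (u @ concat us)) r vtx \<and>
    (\<forall>X. transform n X x u * (\<Prod>v\<leftarrow>us. transform n X (vertex_tensor h) v) =
      transform n X (\<lambda>v. x (take k v) * slot_tensor h k (length (u @ concat us)) r vtx v) (u @ concat us))"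
proof (induction us rule: rev_induct)
  case Nil
  have "slot_map k (length (u @ concat [])) 0 (\<lambda>p. p)" using length_words[OF u] by (simp add: slot_map_def)
  moreover have "transform n X (\<lambda>v. x (take k v) * slot_tensor h k (length u) 0 (\<lambda>p. p) v) u = transform n X x u" for X
    by (rule transform_cong) (simp add: slot_tensor_def words_def length_words[OF u])
  ultimately show ?case by (intro exI[of _ 0] exI[of _ "\<lambda>p. p"]) simp
next
  case (snoc w us)
  let ?N = "length (u @ concat us)" and ?N' = "length (u @ concat (us @ [w]))"
  obtain r vtx where vtx: "slot_map k ?N r vtx" and eq: "\<And>X. transform n X x u *
      (\<Prod>v\<leftarrow>us. transform n X (vertex_tensor h) v) =
      transform n X (\<lambda>v. x (take k v) * slot_tensor h k ?N r vtx v) (u @ concat us)"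
    using snoc.IH by blast
  \<comment> \<open>The slots of the new factor \<open>w\<close> go to one new vertex \<open>k + r\<close>.\<close>
  let ?vtx = "\<lambda>p. if p < ?N then vtx p else k + r"
  have k: "k \<le> ?N" using vtx by (simp add: slot_map_def)
  have N': "?N' = ?N + length w" by simp
  have slot: "slot_map k ?N' (Suc r) ?vtx"
    using vtx k unfolding slot_map_def N' by (auto simp: less_Suc_eq)
  have old: "vtx p \<noteq> k + r" if "p < ?N" for p
  proof (cases "p < k")
    case True
    then have "vtx p = p" using vtx by (simp add: slot_map_def)
    then show ?thesis using True by simp
  next
    case False
    then have "vtx p < k + r" using vtx that by (simp add: slot_map_def)
    then show ?thesis by simp
  qed
  have tensor: "slot_tensor h k ?N' (Suc r) ?vtx v =
      slot_tensor h k ?N r vtx (take ?N v) * vertex_tensor h (drop ?N v)" if v: "v \<in> words n ?N'" for v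
  proof -
    have len: "length v = ?N'" using v by (rule length_words)
    have "{p\<in>{..<?N'}. ?vtx p = k + r} = {?N..<length v}"
      using old len by (auto split: if_splits)
    moreover have "image_mset ((!) v) (mset_set {p\<in>{..<?N'}. ?vtx p = a})
        = image_mset ((!) (take ?N v)) (mset_set {p\<in>{..<?N}. vtx p = a})" if "a < k + r" for a
    proof -
      have "{p\<in>{..<?N'}. ?vtx p = a} = {p\<in>{..<?N}. vtx p = a}"
        using that by auto
      moreover have "image_mset ((!) v) (mset_set {p\<in>{..<?N}. vtx p = a})
          = image_mset ((!) (take ?N v)) (mset_set {p\<in>{..<?N}. vtx p = a})"
        by (intro image_mset_cong) (simp del: length_append)
      ultimately show ?thesis by simp
    qed
    ultimately show ?thesis
      by (simp add: slot_tensor_def vertex_tensor_def mset_drop_nth del: length_append)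
  qed
  have "transform n X x u * (\<Prod>v\<leftarrow>us @ [w]. transform n X (vertex_tensor h) v) =
      transform n X (\<lambda>v. x (take k v) * slot_tensor h k ?N' (Suc r) ?vtx v) (u @ concat (us @ [w]))" for X
  proof -
    have "transform n X x u * (\<Prod>v\<leftarrow>us @ [w]. transform n X (vertex_tensor h) v) =
      transform n X (\<lambda>v. x (take k v) * slot_tensor h k ?N r vtx v) (u @ concat us) * transform n X (vertex_tensor h) w"
      by (simp add: eq mult.assoc[symmetric])
    also have "\<dots> = transform n X (\<lambda>v. (x (take k (take ?N v)) * slot_tensor h k ?N r vtx (take ?N v)) *
        vertex_tensor h (drop ?N v)) ((u @ concat us) @ w)"
      by (rule transform_mult)
    also have "\<dots> = transform n X (\<lambda>v. x (take k v) * slot_tensor h k ?N' (Suc r) ?vtx v) ((u @ concat us) @ w)"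
    proof (rule transform_cong)
      fix v assume "v \<in> words n (length ((u @ concat us) @ w))"
      then have "v \<in> words n ?N'" by simp
      from tensor[OF this] show "x (take k (take ?N v)) * slot_tensor h k ?N r vtx (take ?N v) * vertex_tensor h (drop ?N v)
        = x (take k v) * slot_tensor h k ?N' (Suc r) ?vtx v"
        using k by (simp only: take_take min_absorb1 mult.assoc)
    qed
    finally show ?thesis by simp
  qed
  with slot show ?case by blast
qed

text \<open>
  The vertex tensors are multiplied to \<open>x\<close> first and the identity tensors last, so that
  the latter occupy the last slots and can be contracted one after the other.
\<close>

lemma mean_monomial_orthogonal:
  assumes u: "u \<in> words n k" and orth: "orthogonal_to_fragments n h k x"
    and us: "\<And>v. v \<in> set us \<Longrightarrow> set v \<subseteq> {..<n}" and ps: "set ps \<subseteq> grid n"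
  shows "mean (grid n) (\<lambda>X. transform n X x u * (\<Prod>v\<leftarrow>us. transform n X (vertex_tensor h) v) *
    (\<Prod>(i, j)\<leftarrow>ps. gram n i j X)) = 0"
proof -
  have "\<exists>w T. set w \<subseteq> {..<n} \<and> unmatched n (length w) T \<and>
    (\<forall>X. transform n X x u * (\<Prod>v\<leftarrow>us. transform n X (vertex_tensor h) v) *
      (\<Prod>(i, j)\<leftarrow>ps. gram n i j X) = transform n X T w)"
    using ps
  proof (induction ps rule: rev_induct)
    case Nil
    have "set (u @ concat us) \<subseteq> {..<n}" using u us by (auto simp: words_def)
    moreover obtain r vtx where vtx: "slot_map k (length (u @ concat us)) r vtx" and
      eq: "\<And>X. transform n X x u * (\<Prod>v\<leftarrow>us. transform n X (vertex_tensor h) v) =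
        transform n X (\<lambda>v. x (take k v) * slot_tensor h k (length (u @ concat us)) r vtx v) (u @ concat us)"
      using prod_vertex_tensors[OF u, of us x h] by blast
    ultimately show ?case
      using unmatched_slot_tensor[OF orth vtx] by (intro exI conjI allI) (simp_all add: eq)
  next
    case (snoc p ps)
    obtain i j where p: "p = (i, j)" "i < n" "j < n" using snoc.prems by auto
    obtain w T where w: "set w \<subseteq> {..<n}" "unmatched n (length w) T" and
      eq: "\<And>X. transform n X x u * (\<Prod>v\<leftarrow>us. transform n X (vertex_tensor h) v) *
      (\<Prod>(i, j)\<leftarrow>ps. gram n i j X) = transform n X T w"
      using snoc by auto
    let ?N = "length w" and ?T = "\<lambda>v. T (take (length w) v) * of_bool (v ! length w = v ! Suc (length w))"
    have "transform n X x u * (\<Prod>v\<leftarrow>us. transform n X (vertex_tensor h) v) *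
      (\<Prod>(i, j)\<leftarrow>ps @ [p]. gram n i j X) = transform n X ?T (w @ [i, j])" for X
    proof -
      have "transform n X x u * (\<Prod>v\<leftarrow>us. transform n X (vertex_tensor h) v) *
        (\<Prod>(i, j)\<leftarrow>ps @ [p]. gram n i j X) = transform n X T w * gram n i j X"
        using eq[of X] by (simp add: p(1) mult.assoc)
      also have "\<dots> = transform n X (\<lambda>v. T (take ?N v) * of_bool (drop ?N v ! 0 = drop ?N v ! 1)) (w @ [i, j])"
        unfolding gram_transform by (rule transform_mult)
      also have "\<dots> = transform n X ?T (w @ [i, j])"
        by (rule transform_cong) (simp add: words_def)
      finally show ?thesis .
    qed
    moreover have "unmatched n (length (w @ [i, j])) ?T"
      using unmatched_tensor_identity[OF w(2)] by simp
    ultimately show ?case using w(1) p by (intro exI[of _ "w @ [i, j]"] exI[of _ ?T]) auto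
  qed
  then obtain w T where w: "set w \<subseteq> {..<n}" "unmatched n (length w) T" and
      eq: "\<And>X. transform n X x u * (\<Prod>v\<leftarrow>us. transform n X (vertex_tensor h) v) *
      (\<Prod>(i, j)\<leftarrow>ps. gram n i j X) = transform n X T w"
    by blast
  show ?thesis unfolding eq
    using w by (intro mean_transform_unmatched[of w n "length w"]) (simp_all add: words_def)
qed

definition generators :: "nat \<Rightarrow> ((nat \<Rightarrow>\<^sub>0 nat) \<Rightarrow> real) \<Rightarrow> ((nat \<times> nat \<Rightarrow> real) \<Rightarrow> real) set" where
  "generators n h = {\<lambda>X. transform n X (vertex_tensor h) v | v. set v \<subseteq> {..<n}}
    \<union> {gram n i j | i j. i < n \<and> j < n}"

lemma countable_generators: "countable (generators n h)"
proof -
  have "generators n h \<subseteq> range (\<lambda>v X. transform n X (vertex_tensor h) v) \<union> range (\<lambda>(i, j). gram n i j)"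
    by (auto simp: generators_def)
  then show ?thesis by (rule countable_subset) auto
qed

lemma gram_polyfun: "i < n \<Longrightarrow> j < n \<Longrightarrow> gram n i j \<in> polyfuns (grid n)"
  using transform_polyfun[of "[i, j]" n 2] unfolding gram_transform[abs_def] by (simp add: words_def)

lemma generators_polyfuns: "generators n h \<subseteq> polyfuns (grid n)"
  using transform_polyfun gram_polyfun by (auto simp: generators_def words_def)

inductive_set linear_span :: "('x \<Rightarrow> real) set \<Rightarrow> ('x \<Rightarrow> real) set" for M where
  base: "f \<in> M \<Longrightarrow> f \<in> linear_span M"
| add: "f \<in> linear_span M \<Longrightarrow> g \<in> linear_span M \<Longrightarrow> (\<lambda>x. f x + g x) \<in> linear_span M"
| scale: "f \<in> linear_span M \<Longrightarrow> (\<lambda>x. c * f x) \<in> linear_span M"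

text \<open>
  The span of the products of \<open>(X x)\<^sub>u\<close> with monomials in the generators is a module over the
  algebra of generators, and the mean vanishes on it.
\<close>

lemma mean_orthogonal:
  assumes u: "u \<in> words n k" and orth: "orthogonal_to_fragments n h k x"
    and b: "b \<in> function_algebra (generators n h)"
  shows "mean (grid n) (\<lambda>X. transform n X x u * b X) = 0"
proof -
  define mono where "mono us ps X = transform n X x u * (\<Prod>v\<leftarrow>us. transform n X (vertex_tensor h) v) *
    (\<Prod>(i, j)\<leftarrow>ps. gram n i j X)" for us ps X
  define M where "M = {mono us ps | us ps. (\<forall>v\<in>set us. set v \<subseteq> {..<n}) \<and> set ps \<subseteq> grid n}"
  have gen: "(\<lambda>X. f X * g X) \<in> linear_span M" if "f \<in> linear_span M" "g \<in> generators n h" for f g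
    using that(1)
  proof induction
    case (base f)
    then obtain us ps where f: "f = mono us ps" "\<forall>v\<in>set us. set v \<subseteq> {..<n}" "set ps \<subseteq> grid n"
      by (auto simp: M_def)
    from that(2) consider v where "g = (\<lambda>X. transform n X (vertex_tensor h) v)" "set v \<subseteq> {..<n}"
      | i j where "g = gram n i j" "i < n" "j < n" by (auto simp: generators_def)
    then show ?case
    proof cases
      case 1
      have "(\<lambda>X. f X * g X) = mono (v # us) ps" by (simp add: fun_eq_iff f(1) 1(1) mono_def mult_ac)
      moreover have "mono (v # us) ps \<in> M"
        unfolding M_def mem_Collect_eq using f 1 by (intro exI[of _ "v # us"] exI[of _ ps]) auto
      ultimately show ?thesis by (simp add: linear_span.base)
    next
      case 2
      have "(\<lambda>X. f X * g X) = mono us ((i, j) # ps)" by (simp add: fun_eq_iff f(1) 2(1) mono_def mult_ac)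
      moreover have "mono us ((i, j) # ps) \<in> M" using f 2 unfolding M_def by fastforce
      ultimately show ?thesis by (simp add: linear_span.base)
    qed
  next
    case (add f f')
    from linear_span.add[OF add.IH] show ?case by (simp add: distrib_right)
  next
    case (scale f c)
    from linear_span.scale[OF scale.IH, of c] show ?case by (simp add: mult.assoc)
  qed
  have closed: "\<forall>f\<in>linear_span M. (\<lambda>X. f X * b X) \<in> linear_span M"
    using b
  proof induction
    case (const c)
    show ?case using linear_span.scale[of _ M c] by (simp add: mult.commute)
  next
    case (add b b')
    then show ?case using linear_span.add[of _ M] by (simp add: distrib_left)
  next
    case (mult b b')
    show ?case
    proof
      fix f assume "f \<in> linear_span M"
      with mult.IH(1) have "(\<lambda>X. f X * b X) \<in> linear_span M" by (rule bspec)
      with mult.IH(2) have "(\<lambda>X. f X * b X * b' X) \<in> linear_span M" by (rule bspec)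
      then show "(\<lambda>X. f X * (b X * b' X)) \<in> linear_span M" by (simp add: mult.assoc)
    qed
  qed (simp add: gen)
  have "mono [] [] \<in> M" unfolding M_def by fastforce
  then have "(\<lambda>X. mono [] [] X * b X) \<in> linear_span M" using closed linear_span.base by blast
  then have mem: "(\<lambda>X. transform n X x u * b X) \<in> linear_span M" by (simp add: mono_def)
  have "f \<in> polyfuns (grid n) \<and> mean (grid n) f = 0" if "f \<in> linear_span M" for f
    using that
  proof induction
    case (base f)
    then obtain us ps where f: "f = mono us ps" "\<forall>v\<in>set us. set v \<subseteq> {..<n}" "set ps \<subseteq> grid n"
      by (auto simp: M_def)
    have "(\<lambda>X. transform n X (vertex_tensor h) v) \<in> polyfuns (grid n)" if "set v \<subseteq> {..<n}" for v
      using that by (intro transform_polyfun[of v n "length v"]) (simp add: words_def)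
    with f(2) have "(\<lambda>X. \<Prod>v\<leftarrow>us. transform n X (vertex_tensor h) v) \<in> polyfuns (grid n)"
      by (intro function_algebra_prod_list) blast
    moreover have "(\<lambda>X. \<Prod>p\<leftarrow>ps. case p of (i, j) \<Rightarrow> gram n i j X) \<in> polyfuns (grid n)"
    proof (rule function_algebra_prod_list)
      fix p assume "p \<in> set ps"
      then obtain i j where "p = (i, j)" "i < n" "j < n" using f(3) by auto
      then show "(\<lambda>X. case p of (i, j) \<Rightarrow> gram n i j X) \<in> polyfuns (grid n)"
        using gram_polyfun[of i n j] by (simp only: prod.case)
    qed
    ultimately have "f \<in> polyfuns (grid n)"
      unfolding f(1) mono_def[abs_def] by (intro function_algebra.mult transform_polyfun[OF u])
    moreover have "mean (grid n) f = 0"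
      using mean_monomial_orthogonal[OF u orth, of us ps] f by (simp add: mono_def[abs_def])
    ultimately show ?case ..
  next
    case (add f g)
    then show ?case by (simp add: mean_add function_algebra.add)
  next
    case (scale f c)
    then show ?case by (simp add: mean_scale function_algebra.mult[OF function_algebra.const])
  qed
  with mem show ?thesis by blast
qed


section \<open>Invariant tensors orthogonal to all fragments\<close>

text \<open>
  The determinant of \<open>X X\<^sup>T\<close>, by the Leibniz formula as a polynomial in the generators.
\<close>

definition gram_det :: "nat \<Rightarrow> (nat \<times> nat \<Rightarrow> real) \<Rightarrow> real" where
  "gram_det n X = (\<Sum>p\<in>{p. p permutes {0..<n}}. signof p * (\<Prod>i = 0..<n. gram n i (p i) X))"

abbreviation to_mat :: "nat \<Rightarrow> (nat \<times> nat \<Rightarrow> real) \<Rightarrow> real mat" where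
  "to_mat n X \<equiv> Matrix.mat n n X"

lemma gram_mat: "i < n \<Longrightarrow> j < n \<Longrightarrow> (to_mat n X * transpose_mat (to_mat n X)) $$ (i, j) = gram n i j X"
  by (simp add: gram_def scalar_prod_def lessThan_atLeast0)

lemma gram_det_square: "gram_det n X = (Determinant.det (to_mat n X))\<^sup>2"
proof -
  have c: "to_mat n X \<in> carrier_mat n n" "transpose_mat (to_mat n X) \<in> carrier_mat n n" by auto
  have "Determinant.det (to_mat n X * transpose_mat (to_mat n X)) = gram_det n X"
    unfolding gram_det_def det_def'[OF mult_carrier_mat[OF c]]
  proof (intro sum.cong refl arg_cong2[where f = "(*)"] prod.cong)
    fix p i assume "p \<in> {p. p permutes {0..<n}}" "i \<in> {0..<n}"
    then have "i < n" "p i < n" by (auto dest: permutes_in_image)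
    then show "(to_mat n X * transpose_mat (to_mat n X)) $$ (i, p i) = gram n i (p i) X" by (rule gram_mat)
  qed
  then show ?thesis
    using det_mult[OF c] Determinant.det_transpose[OF c(1)] by (simp add: power2_eq_square)
qed

text \<open>
  If \<open>X X\<^sup>T = Y Y\<^sup>T\<close>, then \<open>W = Y\<^sup>-\<^sup>1 X\<close> satisfies \<open>W W\<^sup>T = 1\<close>.
\<close>

lemma same_gram_orthogonal:
  assumes gram: "\<And>i j. i < n \<Longrightarrow> j < n \<Longrightarrow> gram n i j X = gram n i j Y"
    and det: "Determinant.det (to_mat n Y) \<noteq> 0"
  obtains W B where "W \<in> orthogonal_group n" "B \<in> carrier_mat n n"
    "to_mat n Y * W = to_mat n X" "B * to_mat n X = W" "B * to_mat n Y = 1\<^sub>m n"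
proof -
  let ?X = "to_mat n X" and ?Y = "to_mat n Y"
  have X: "?X \<in> carrier_mat n n" and Y: "?Y \<in> carrier_mat n n" by auto
  obtain B where B: "B \<in> carrier_mat n n" and BY: "B * ?Y = 1\<^sub>m n" and YB: "?Y * B = 1\<^sub>m n"
    using det_non_zero_imp_unit[OF Y det, of undefined] by (auto simp: Units_def ring_mat_def)
  let ?W = "B * ?X"
  have W: "?W \<in> carrier_mat n n" using B X by simp
  have XX: "?X * transpose_mat ?X = ?Y * transpose_mat ?Y"
  proof (rule eq_matI)
    fix i j assume "i < dim_row (?Y * transpose_mat ?Y)" "j < dim_col (?Y * transpose_mat ?Y)"
    then have ij: "i < n" "j < n" by simp_all
    show "(?X * transpose_mat ?X) $$ (i, j) = (?Y * transpose_mat ?Y) $$ (i, j)"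
      unfolding gram_mat[OF ij] by (rule gram[OF ij])
  qed simp_all
  have conj: "(B * Z) * transpose_mat (B * Z) = B * (Z * transpose_mat Z) * transpose_mat B"
    if Z: "Z \<in> carrier_mat n n" for Z
  proof -
    have Zt: "transpose_mat Z \<in> carrier_mat n n" and Bt: "transpose_mat B \<in> carrier_mat n n"
      using Z B by auto
    show ?thesis
      unfolding transpose_mult[OF B Z] assoc_mult_mat[OF B Z mult_carrier_mat[OF Zt Bt]]
        assoc_mult_mat[OF Z Zt Bt, symmetric] assoc_mult_mat[OF B mult_carrier_mat[OF Z Zt] Bt] ..
  qed
  have "?W * transpose_mat ?W = (B * ?Y) * transpose_mat (B * ?Y)"
    unfolding conj[OF X] conj[OF Y] XX ..
  also have "\<dots> = 1\<^sub>m n" unfolding BY by simp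
  finally have "transpose_mat ?W * ?W = 1\<^sub>m n"
    using W by (intro mat_mult_left_right_inverse[of ?W n "transpose_mat ?W"]) auto
  then have "?W \<in> orthogonal_group n" using W by (simp add: orthogonal_group_def)
  moreover have "?Y * ?W = ?X"
    using assoc_mult_mat[OF Y B X] X by (simp add: YB)
  ultimately show ?thesis using that[OF _ B _ refl BY] by blast
qed

lemma mat_prod_entries:
  assumes "A \<in> carrier_mat n n" "B \<in> carrier_mat n n" "i < n" "j < n"
  shows "mat_prod n (entries A) (entries B) (i, j) = entries (A * B) (i, j)"
  using assms by (simp add: mat_prod_def entries_def scalar_prod_def lessThan_atLeast0)

lemma transform_to_mat:
  assumes "u \<in> words n k"
  shows "transform n X T u = transform n (entries (to_mat n X)) T u"
  using assms by (rule transform_entry_cong) (simp add: entries_def)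

lemma transform_entries_mult:
  assumes "A \<in> carrier_mat n n" "B \<in> carrier_mat n n" "u \<in> words n k"
  shows "transform n (entries A) (transform n (entries B) T) u = transform n (entries (A * B)) T u"
  unfolding transform_transform using assms(3)
  by (rule transform_entry_cong) (rule mat_prod_entries[OF assms(1,2)])

text \<open>
  The function \<open>det(X X\<^sup>T) (X x)\<^sub>u\<close> is orthogonal to the algebra of generators, and it is constant on
  the common fibres of the generators: two matrices in one fibre are either both
  singular or differ by an element of the stabilizer, which fixes \<open>x\<close>.  So the
  function vanishes on the image of the shrinking map.
\<close>

theorem invariant_orthogonal_zero:
  assumes inv: "\<And>W v. W \<in> Stab n h \<Longrightarrow> v \<in> words n k \<Longrightarrow> transform n (entries W) x v = x v"
    and orth: "orthogonal_to_fragments n h k x" and u: "u \<in> words n k"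
  shows "x u = 0"
proof -
  let ?F = "\<lambda>X. transform n X x u * gram_det n X"
  have gram_det: "gram_det n \<in> function_algebra (generators n h)"
    unfolding gram_det_def[abs_def]
  proof (rule function_algebra_sum, rule function_algebra.mult[OF function_algebra.const],
      rule function_algebra_prod, rule function_algebra.gen)
    fix p i assume "p \<in> {p. p permutes {0..<n}}" "i \<in> {0..<n}"
    then have "i < n" "p i < n" by (auto dest: permutes_in_image)
    then show "gram n i (p i) \<in> generators n h" by (auto simp: generators_def)
  qed
  have gram_det': "gram_det n \<in> polyfuns (grid n)"
    by (rule function_algebra_mono[OF gram_det generators_polyfuns])
  have fibres: "?F X = ?F Y" if eq: "\<And>g. g \<in> generators n h \<Longrightarrow> g X = g Y" for X Y
  proof -
    have det: "gram_det n X = gram_det n Y"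
      using gram_det by induction (auto simp: eq)
    show ?thesis
    proof (cases "Determinant.det (to_mat n Y) = 0")
      case True
      then have "gram_det n Y = 0" by (simp add: gram_det_square)
      then show ?thesis using det by simp
    next
      case False
      let ?X = "to_mat n X" and ?Y = "to_mat n Y"
      have c: "?X \<in> carrier_mat n n" "?Y \<in> carrier_mat n n" by auto
      have "gram n i j X = gram n i j Y" if "i < n" "j < n" for i j
        using eq that by (auto simp: generators_def)
      then obtain W B where W: "W \<in> orthogonal_group n" and B: "B \<in> carrier_mat n n"
        and YW: "?Y * W = ?X" and BX: "B * ?X = W" and BY: "B * ?Y = 1\<^sub>m n"
        using same_gram_orthogonal[OF _ False] by metis
      have Wc: "W \<in> carrier_mat n n" using W by (simp add: orthogonal_group_def)
      have "transform n (entries W) (vertex_tensor h) v = vertex_tensor h v" if v: "v \<in> words n d" for v d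
      proof -
        have "transform n (entries W) (vertex_tensor h) v
            = transform n (entries B) (transform n (entries ?X) (vertex_tensor h)) v"
          using transform_entries_mult[OF B c(1) v] by (simp add: BX)
        also have "\<dots> = transform n (entries B) (transform n (entries ?Y) (vertex_tensor h)) v"
        proof (rule transform_cong)
          fix v' assume v': "v' \<in> words n (length v)"
          then have "(\<lambda>X. transform n X (vertex_tensor h) v') \<in> generators n h"
            by (auto simp: generators_def words_def)
          from eq[OF this] show "transform n (entries ?X) (vertex_tensor h) v' = transform n (entries ?Y) (vertex_tensor h) v'"
            by (simp only: transform_to_mat[OF v', symmetric])
        qed
        also have "\<dots> = transform n (entries (1\<^sub>m n)) (vertex_tensor h) v"
          using transform_entries_mult[OF B c(2) v] by (simp add: BY)
        also have "\<dots> = vertex_tensor h v"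
          using transform_scaled_one[OF v, of "entries (1\<^sub>m n)" 1] by (simp add: entries_def)
        finally show ?thesis .
      qed
      then have stab: "W \<in> Stab n h" using W by (auto simp: Stab_iff)
      have "transform n X x u = transform n (entries ?Y) (transform n (entries W) x) u"
        using transform_entries_mult[OF c(2) Wc u] by (simp add: YW flip: transform_to_mat[OF u])
      also have "\<dots> = transform n (entries ?Y) x u"
        using inv[OF stab] by (intro transform_cong) (simp add: length_words[OF u])
      also have "\<dots> = transform n Y x u" by (simp only: transform_to_mat[OF u, symmetric])
      finally show ?thesis using det by simp
    qed
  qed
  have orth': "mean (grid n) (\<lambda>X. ?F X * b X) = 0" if "b \<in> function_algebra (generators n h)" for b
    using mean_orthogonal[OF u orth function_algebra.mult[OF gram_det that]] by (simp add: mult.assoc)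
  have zero: "?F (shrink (grid n) X) = 0" for X
  proof (rule orthogonal_polyfun_vanishes[OF _ generators_polyfuns[of n h] countable_generators[of n h]
        function_algebra.mult[OF transform_polyfun[OF u] gram_det']])
    show "?F X = ?F Y" if "\<And>g. g \<in> generators n h \<Longrightarrow> g X = g Y" for X Y
      using that by (rule fibres)
  qed (simp_all add: orth')
  \<comment> \<open>The shrinking map sends the identity matrix to a positive multiple of itself.\<close>
  let ?one = "\<lambda>(i, j). of_bool (i = j) :: real"
  define c where "c = exp (- (\<Sum>p\<in>grid n. (?one p)\<^sup>2))"
  have c: "c > 0" by (simp add: c_def)
  have entry: "shrink (grid n) ?one (i, j) = (if i = j then c else 0)" if "i < n" "j < n" for i j
    using that by (simp add: shrink_def c_def)
  have "to_mat n (shrink (grid n) ?one) = c \<cdot>\<^sub>m 1\<^sub>m n"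
    by (rule eq_matI) (simp_all add: entry)
  then have "gram_det n (shrink (grid n) ?one) \<noteq> 0"
    using c by (simp add: gram_det_square)
  moreover have "transform n (shrink (grid n) ?one) x u = c ^ k * x u"
    by (rule transform_scaled_one[OF u entry])
  ultimately show ?thesis using zero[of ?one] c by simp
qed


section \<open>The image of the map \<open>p_h\<close>\<close>

text \<open>
  Orthogonal projection onto a space of functions with respect to the sum over a finite
  set, by induction on this set: the functions in \<open>S\<close> that vanish at a new point \<open>z\<close> form a subspace
  of codimension at most one, and an element \<open>e\<close> orthogonal to it spans a complement.
\<close>

lemma orthogonal_projection:
  fixes S :: "('a \<Rightarrow> real) set" and t :: "'a \<Rightarrow> real"
  assumes "finite \<Omega>" and "(\<lambda>_. 0) \<in> S"
    and "\<And>f g. f \<in> S \<Longrightarrow> g \<in> S \<Longrightarrow> (\<lambda>\<omega>. f \<omega> + g \<omega>) \<in> S"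
    and "\<And>c f. f \<in> S \<Longrightarrow> (\<lambda>\<omega>. c * f \<omega>) \<in> S"
  shows "\<exists>a\<in>S. \<forall>b\<in>S. (\<Sum>\<omega>\<in>\<Omega>. (t \<omega> - a \<omega>) * b \<omega>) = 0"
  using assms
proof (induction \<Omega> arbitrary: S t rule: finite_induct)
  case empty
  then show ?case by auto
next
  case (insert z \<Omega>)
  note S = insert.prems
  define S0 where "S0 = {f\<in>S. f z = 0}"
  have proj: "\<exists>a\<in>S0. \<forall>b\<in>S0. (\<Sum>\<omega>\<in>insert z \<Omega>. (t \<omega> - a \<omega>) * b \<omega>) = 0" for t
  proof -
    have "\<exists>a\<in>S0. \<forall>b\<in>S0. (\<Sum>\<omega>\<in>\<Omega>. (t \<omega> - a \<omega>) * b \<omega>) = 0"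
      by (rule insert.IH) (auto simp: S0_def S)
    then show ?thesis using insert.hyps by (auto simp: S0_def)
  qed
  show ?case
  proof (cases "S = S0")
    case True
    then show ?thesis using proj[of t] by simp
  next
    case False
    then obtain f where f: "f \<in> S" "f z \<noteq> 0" by (auto simp: S0_def)
    obtain a0 where a0: "a0 \<in> S0" "\<And>b. b \<in> S0 \<Longrightarrow> (\<Sum>\<omega>\<in>insert z \<Omega>. (f \<omega> - a0 \<omega>) * b \<omega>) = 0"
      using proj[of f] by blast
    define e where "e \<omega> = f \<omega> + (- 1) * a0 \<omega>" for \<omega>
    have S0: "f \<in> S" if "f \<in> S0" for f using that by (simp add: S0_def)
    have e: "e \<in> S"
      unfolding e_def[abs_def] by (intro S f(1) S0 a0(1))
    have ez: "e z \<noteq> 0"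
      using f(2) a0(1) by (simp add: e_def S0_def)
    have e_orth: "(\<Sum>\<omega>\<in>insert z \<Omega>. e \<omega> * b \<omega>) = 0" if "b \<in> S0" for b
      using a0(2)[OF that] by (simp add: e_def)
    define q where "q = (\<Sum>\<omega>\<in>insert z \<Omega>. e \<omega> * e \<omega>)"
    have "q \<noteq> 0"
      unfolding q_def using ez insert.hyps by (subst sum_nonneg_eq_0_iff) auto
    obtain a1 where a1: "a1 \<in> S0" "\<And>b. b \<in> S0 \<Longrightarrow> (\<Sum>\<omega>\<in>insert z \<Omega>. (t \<omega> - a1 \<omega>) * b \<omega>) = 0"
      using proj[of t] by blast
    define c where "c = (\<Sum>\<omega>\<in>insert z \<Omega>. t \<omega> * e \<omega>) / q"
    define a where "a \<omega> = a1 \<omega> + c * e \<omega>" for \<omega>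
    have a: "a \<in> S"
      unfolding a_def[abs_def] by (intro S S0 a1(1) e)
    have diff: "(\<Sum>\<omega>\<in>insert z \<Omega>. (t \<omega> - a \<omega>) * b \<omega>) = (\<Sum>\<omega>\<in>insert z \<Omega>. (t \<omega> - a1 \<omega>) * b \<omega>)
        - c * (\<Sum>\<omega>\<in>insert z \<Omega>. e \<omega> * b \<omega>)" for b
      by (simp add: a_def sum_distrib_left sum_subtractf[symmetric] algebra_simps)
    have "(\<Sum>\<omega>\<in>insert z \<Omega>. (t \<omega> - a \<omega>) * b \<omega>) = 0" if b: "b \<in> S" for b
    proof -
      \<comment> \<open>Subtracting this multiple of \<open>e\<close> from \<open>b\<close> gives a function that vanishes at \<open>z\<close>.\<close>
      define d where "d = b z / e z"
      define b0 where "b0 \<omega> = b \<omega> + (- d) * e \<omega>" for \<omega>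
      have "b0 \<in> S" unfolding b0_def[abs_def] by (intro S b e)
      then have b0: "b0 \<in> S0" using ez by (simp add: S0_def b0_def d_def)
      have on_b0: "(\<Sum>\<omega>\<in>insert z \<Omega>. (t \<omega> - a \<omega>) * b0 \<omega>) = 0"
        unfolding diff a1(2)[OF b0] e_orth[OF b0] by simp
      have "(\<Sum>\<omega>\<in>insert z \<Omega>. a1 \<omega> * e \<omega>) = 0"
        using e_orth[OF a1(1)] by (simp add: mult.commute)
      then have "(\<Sum>\<omega>\<in>insert z \<Omega>. (t \<omega> - a1 \<omega>) * e \<omega>) = c * q"
        using \<open>q \<noteq> 0\<close> by (simp add: c_def left_diff_distrib sum_subtractf del: sum.insert)
      then have on_e: "(\<Sum>\<omega>\<in>insert z \<Omega>. (t \<omega> - a \<omega>) * e \<omega>) = 0"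
        unfolding diff q_def by simp
      have "b \<omega> = b0 \<omega> + d * e \<omega>" for \<omega> by (simp add: b0_def)
      then have "(\<Sum>\<omega>\<in>insert z \<Omega>. (t \<omega> - a \<omega>) * b \<omega>) = (\<Sum>\<omega>\<in>insert z \<Omega>. (t \<omega> - a \<omega>) * b0 \<omega>)
          + d * (\<Sum>\<omega>\<in>insert z \<Omega>. (t \<omega> - a \<omega>) * e \<omega>)"
        by (simp only: distrib_left sum.distrib sum_distrib_left mult.left_commute)
      then show ?thesis unfolding on_b0 on_e by simp
    qed
    with a show ?thesis by blast
  qed
qed

lemma fragment_cases:
  obtains F where "wf_fragment F" "f = abs_fragment F" "num_opens f = length (opens F)"
    "\<And>n h w. h_coeff n h w f = pre_h_coeff n h w F"
proof -
  have "\<exists>F. wf_fragment F \<and> f = abs_fragment F \<and> num_opens f = length (opens F)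
      \<and> (\<forall>n h w. h_coeff n h w f = pre_h_coeff n h w F)"
    by (induction f rule: fragment.abs_induct)
      (use h_coeff.abs_eq num_opens.abs_eq in \<open>auto simp: fragment_rel_def\<close>)
  then show ?thesis using that by blast
qed

lemma lookup_p_fragment:
  "Poly_Mapping.lookup (p_fragment n h f) w = (if w \<in> words n (num_opens f) then h_coeff n h w f else 0)"
  by (simp add: p_fragment_def lookup_sum lookup_single when_def finite_words)

lemma p_fragment_invariant:
  assumes U: "U \<in> Stab n h" and w: "w \<in> words n k"
  shows "transform n (entries U) (Poly_Mapping.lookup (p_fragment n h f)) w = Poly_Mapping.lookup (p_fragment n h f) w"
proof -
  obtain F where F: "wf_fragment F" "num_opens f = length (opens F)"
    "\<And>w. h_coeff n h w f = pre_h_coeff n h w F" using fragment_cases[of f] by metis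
  show ?thesis
  proof (cases "k = length (opens F)")
    case True
    have "transform n (entries U) (Poly_Mapping.lookup (p_fragment n h f)) w
        = transform n (entries U) (\<lambda>u. pre_h_coeff n h u F) w"
      by (rule transform_cong) (simp add: lookup_p_fragment F True[symmetric] length_words[OF w])
    also have "\<dots> = pre_h_coeff n h w F"
      using pre_h_coeff_invariant[OF F(1) U] w True by simp
    finally show ?thesis using w True by (simp add: lookup_p_fragment F)
  next
    case False
    then have "Poly_Mapping.lookup (p_fragment n h f) v = 0" if "v \<in> words n k" for v
      using that by (auto simp: lookup_p_fragment F words_def)
    then show ?thesis using w by (simp add: transform_def length_words[OF w])
  qed
qed

lemma lookup_p_map:
  "Poly_Mapping.lookup (p_map n h q) w = (\<Sum>f\<in>Poly_Mapping.keys q. Poly_Mapping.lookup q f * Poly_Mapping.lookup (p_fragment n h f) w)"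
  unfolding p_map_def by (rule lookup_lin_ext) auto

lemma p_map_invariant:
  assumes U: "U \<in> Stab n h" and w: "w \<in> words n k"
  shows "transform n (entries U) (Poly_Mapping.lookup (p_map n h q)) w = Poly_Mapping.lookup (p_map n h q) w"
proof -
  have "transform n (entries U) (Poly_Mapping.lookup (p_map n h q)) w = (\<Sum>f\<in>Poly_Mapping.keys q.
      Poly_Mapping.lookup q f * transform n (entries U) (Poly_Mapping.lookup (p_fragment n h f)) w)"
    unfolding transform_def lookup_p_map sum_distrib_right sum_distrib_left
    by (subst sum.swap) (simp add: mult.assoc)
  then show ?thesis by (simp add: p_fragment_invariant[OF assms] lookup_p_map)
qed

lemma p_map_in_tensor_algebra: "p_map n h q \<in> tensor_algebra n"
proof -
  have "set w \<subseteq> {..<n}" if w: "w \<in> Poly_Mapping.keys (p_map n h q)" for w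
  proof -
    have "(\<Sum>f\<in>Poly_Mapping.keys q. Poly_Mapping.lookup q f * Poly_Mapping.lookup (p_fragment n h f) w) \<noteq> 0"
      using w by (simp add: in_keys_iff flip: lookup_p_map)
    then obtain f where "Poly_Mapping.lookup q f * Poly_Mapping.lookup (p_fragment n h f) w \<noteq> 0"
      by (rule sum.not_neutral_contains_not_neutral)
    then show ?thesis by (auto simp: lookup_p_fragment words_def split: if_splits)
  qed
  then show ?thesis by (simp add: tensor_algebra_def)
qed

theorem theorem3:
  fixes n :: nat and h :: "(nat \<Rightarrow>\<^sub>0 nat) \<Rightarrow> real"
  shows "range (p_map n h) = tensor_invariants n (Stab n h)"
proof
  show "range (p_map n h) \<subseteq> tensor_invariants n (Stab n h)"
  proof
    fix t assume "t \<in> range (p_map n h)"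
    then obtain q where t: "t = p_map n h q" by auto
    have "tensor_act n U t = t" if U: "U \<in> Stab n h" for U
    proof (rule poly_mapping_eqI)
      fix w
      have Uc: "U \<in> carrier_mat n n" using U by (simp add: Stab_iff orthogonal_group_def)
      have "Poly_Mapping.lookup t w = 0" if "\<not> set w \<subseteq> {..<n}"
        using p_map_in_tensor_algebra[of n h q] that by (auto simp: t tensor_algebra_def in_keys_iff)
      moreover have "transform n (entries U) (Poly_Mapping.lookup t) w = Poly_Mapping.lookup t w"
        if "set w \<subseteq> {..<n}"
        using p_map_invariant[OF U, of w "length w"] that by (simp add: t words_def)
      ultimately show "Poly_Mapping.lookup (tensor_act n U t) w = Poly_Mapping.lookup t w"
        using p_map_in_tensor_algebra[of n h q] by (simp add: lookup_tensor_act[OF Uc] t)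
    qed
    then show "t \<in> tensor_invariants n (Stab n h)"
      by (simp add: tensor_invariants_def t p_map_in_tensor_algebra)
  qed
  show "tensor_invariants n (Stab n h) \<subseteq> range (p_map n h)"
  proof
    fix t assume "t \<in> tensor_invariants n (Stab n h)"
    then have t: "t \<in> tensor_algebra n" "\<And>U. U \<in> Stab n h \<Longrightarrow> tensor_act n U t = t"
      by (auto simp: tensor_invariants_def)
    let ?K = "length ` Poly_Mapping.keys t"
    \<comment> \<open>Only words whose length occurs in \<open>t\<close> enter the projection, so that \<open>x\<close> below vanishes in all
      other degrees.\<close>
    define \<Omega> where "\<Omega> = (\<Union>k\<in>?K. words n k)"
    define S where "S = {b. \<exists>q. b = Poly_Mapping.lookup (p_map n h q) \<and> (\<forall>w. w \<notin> \<Omega> \<longrightarrow> b w = 0)}"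
    have "\<exists>a\<in>S. \<forall>b\<in>S. (\<Sum>w\<in>\<Omega>. (Poly_Mapping.lookup t w - a w) * b w) = 0"
    proof (rule orthogonal_projection)
      show "finite \<Omega>" by (simp add: \<Omega>_def finite_words)
      show "(\<lambda>_. 0) \<in> S"
        unfolding S_def mem_Collect_eq by (intro exI[of _ 0]) (simp add: fun_eq_iff lookup_p_map)
      show "(\<lambda>w. f w + g w) \<in> S" if fg: "f \<in> S" "g \<in> S" for f g
      proof -
        obtain p q where "f = Poly_Mapping.lookup (p_map n h p)" "g = Poly_Mapping.lookup (p_map n h q)"
          using fg unfolding S_def by blast
        then have "(\<lambda>w. f w + g w) = Poly_Mapping.lookup (p_map n h (p + q))"
          by (simp add: fun_eq_iff p_map_def lin_ext_add lookup_add)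
        moreover have "\<forall>w. w \<notin> \<Omega> \<longrightarrow> f w + g w = 0" using fg by (auto simp: S_def)
        ultimately show ?thesis unfolding S_def by blast
      qed
      show "(\<lambda>w. c * f w) \<in> S" if f: "f \<in> S" for c f
      proof -
        obtain p where "f = Poly_Mapping.lookup (p_map n h p)"
          using f unfolding S_def by blast
        then have "(\<lambda>w. c * f w) = Poly_Mapping.lookup (p_map n h (scale_pm c p))"
          by (simp add: fun_eq_iff p_map_def lin_ext_scale)
        moreover have "\<forall>w. w \<notin> \<Omega> \<longrightarrow> c * f w = 0" using f by (auto simp: S_def)
        ultimately show ?thesis unfolding S_def by blast
      qed
    qed
    then obtain q where q: "\<And>w. w \<notin> \<Omega> \<Longrightarrow> Poly_Mapping.lookup (p_map n h q) w = 0"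
      and orth: "\<And>b. b \<in> S \<Longrightarrow> (\<Sum>w\<in>\<Omega>. (Poly_Mapping.lookup t w - Poly_Mapping.lookup (p_map n h q) w) * b w) = 0"
      by (auto simp: S_def)
    define x where "x w = Poly_Mapping.lookup t w - Poly_Mapping.lookup (p_map n h q) w" for w
    have out: "x w = 0" if "w \<notin> \<Omega>" for w
    proof -
      have "w \<notin> Poly_Mapping.keys t"
        using that t(1) by (auto simp: \<Omega>_def tensor_algebra_def words_def)
      then show ?thesis using q[OF that] by (simp add: x_def in_keys_iff)
    qed
    have inv: "transform n (entries W) x v = x v" if W: "W \<in> Stab n h" and v: "v \<in> words n k" for W v k
    proof -
      have Wc: "W \<in> carrier_mat n n" using W by (simp add: Stab_iff orthogonal_group_def)
      have "transform n (entries W) (Poly_Mapping.lookup t) v = Poly_Mapping.lookup t v"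
        using lookup_tensor_act[OF Wc t(1), of v] t(2)[OF W] v by (simp add: words_def)
      then show ?thesis
        using p_map_invariant[OF W v, of q]
        by (simp add: x_def transform_def left_diff_distrib sum_subtractf)
    qed
    have "orthogonal_to_fragments n h k x" for k
      unfolding orthogonal_to_fragments_def
    proof (intro allI impI)
      fix F assume F: "wf_fragment F \<and> length (opens F) = k"
      then have rel: "fragment_rel F F" by (simp add: fragment_rel_def fragment_iso_refl)
      let ?f = "abs_fragment F"
      have b: "Poly_Mapping.lookup (p_fragment n h ?f) w
          = (if w \<in> words n k then pre_h_coeff n h w F else 0)" for w
        using F by (simp add: lookup_p_fragment num_opens.abs_eq[OF rel] h_coeff.abs_eq[OF rel])
      show "(\<Sum>w\<in>words n k. x w * pre_h_coeff n h w F) = 0"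
      proof (cases "k \<in> ?K")
        case True
        then have sub: "words n k \<subseteq> \<Omega>" by (auto simp: \<Omega>_def)
        have "Poly_Mapping.lookup (p_fragment n h ?f) \<in> S"
          unfolding S_def mem_Collect_eq using sub b
          by (intro exI[of _ "Poly_Mapping.single ?f 1"]) (auto simp: p_map_def)
        from orth[OF this] have "(\<Sum>w\<in>\<Omega>. x w * (if w \<in> words n k then pre_h_coeff n h w F else 0)) = 0"
          by (simp add: x_def b)
        also have "(\<Sum>w\<in>\<Omega>. x w * (if w \<in> words n k then pre_h_coeff n h w F else 0))
            = (\<Sum>w\<in>words n k. x w * pre_h_coeff n h w F)"
          using sub by (intro sum.mono_neutral_cong_right) (auto simp: \<Omega>_def finite_words)
        finally show ?thesis .
      next
        case False
        then have "w \<notin> \<Omega>" if "w \<in> words n k" for w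
          using that by (auto simp: \<Omega>_def words_def)
        then show ?thesis using out by simp
      qed
    qed
    from invariant_orthogonal_zero[OF inv this]
    have "x w = 0" if "w \<in> \<Omega>" for w using that by (auto simp: \<Omega>_def)
    then have "Poly_Mapping.lookup t w = Poly_Mapping.lookup (p_map n h q) w" for w
      using out[of w] by (cases "w \<in> \<Omega>") (auto simp: x_def)
    then have "t = p_map n h q" by (intro poly_mapping_eqI)
    then show "t \<in> range (p_map n h)" by simp
  qed
qed

end
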